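(* Let $\delta_1>0$, $\delta_4>0$, $\delta_{14}=\min(\delta_1,\delta_4)$ and $0<\sigma<1$. Then, as $t\to\infty$, $$\frac{t}{\pi}\oint_{-t^{\delta_1-1}}^{1+t^{\delta_4-1}}\Re\left\{\frac{\Gamma(it-i\tau t)}{\Gamma(\sigma+it)}\,\Gamma(\sigma+i\tau t)\right\}\left|\zeta(\sigma+i\tau t)\right|^2\,d\tau+A(\sigma,t)+O\left(e^{-\pi t^{\delta_{14}}}\right)+O\left(\frac1{t^2}\right)=0,$$ where $\oint$ denotes the principal value integral with respect to $\tau=1$, and $$A(\sigma,t)=\begin{cases}\zeta(2\sigma)+2\,\Gamma(2\sigma-1)\,\zeta(2\sigma-1)\,\sin(\pi\sigma)\,t^{1-2\sigma}\left(1+O\left(\frac1t\right)\right), & 0<\sigma<1,\ \sigma\neq\frac12,\\[1mm] \ln t+2\gamma-\ln 2\pi, & \sigma=\frac12.\end{cases}$$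
   Context: $\Gamma$ is the gamma function, $\zeta$ the Riemann zeta function (analytically continued), and $\gamma$ the Euler constant. The principal value with respect to $\tau=1$ of an integral over $[a,b]\ni1$ is $\lim_{\varepsilon\to0^+}\left(\int_{a}^{1-\varepsilon}+\int_{1+\varepsilon}^{b}\right)$. *)

theory Defs
  imports "HOL-Complex_Analysis.Complex_Analysis" "HOL-Library.Landau_Symbols"
begin

text \<open>
  The Riemann zeta function as the analytic continuation of the Dirichlet series
  $\sum_{n \ge 1} n^{-s}$ from $\Re s > 1$ to $s \ne 1$. By the identity theorem the
  continuation is unique, so the choice operator leaves only the value at the pole
  \<open>s = 1\<close> unspecified.
\<close>

definition zeta :: "complex \<Rightarrow> complex" where
  "zeta = (SOME f. f holomorphic_on (- {1}) \<and>
             (\<forall>s. Re s > 1 \<longrightarrow> (\<lambda>n. 1 / of_nat (Suc n) powr s) sums f s))"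

text \<open>
  \<open>has_principal_value f c a b I\<close>: for \<open>a < c < b\<close>, the principal value with respect to \<open>c\<close>
  of the integral of \<open>f\<close> over \<open>[a, b]\<close> exists and equals \<open>I\<close>. Integrability of \<open>f\<close> on the
  two truncated intervals is part of the notion, as \<open>integral\<close> is total.
\<close>

definition has_principal_value ::
    "(real \<Rightarrow> real) \<Rightarrow> real \<Rightarrow> real \<Rightarrow> real \<Rightarrow> real \<Rightarrow> bool" where
  "has_principal_value f c a b I \<longleftrightarrow>
     a < c \<and> c < b \<and>
     (\<forall>\<^sub>F \<epsilon> in at_right 0. f integrable_on {a..c - \<epsilon>} \<and> f integrable_on {c + \<epsilon>..b}) \<and>
     ((\<lambda>\<epsilon>. integral {a..c - \<epsilon>} f + integral {c + \<epsilon>..b} f) \<longlongrightarrow> I) (at_right 0)"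

definition zeta_integrand :: "real \<Rightarrow> real \<Rightarrow> real \<Rightarrow> real" where
  "zeta_integrand \<sigma> t \<tau> =
     Re (Gamma (\<i> * of_real t - \<i> * of_real \<tau> * of_real t) / Gamma (of_real \<sigma> + \<i> * of_real t)
           * Gamma (of_real \<sigma> + \<i> * of_real \<tau> * of_real t))
       * (norm (zeta (of_real \<sigma> + \<i> * of_real \<tau> * of_real t)))\<^sup>2"

text \<open>
  \<open>A(\<sigma>, t)\<close> itself contains an O-term when \<open>\<sigma> \<noteq> 1/2\<close>, so it is rendered as the set of all
  functions of \<open>t\<close> of the prescribed shape. Since \<open>zeta\<close> is complex-valued and its values at
  real arguments other than 1 are real, \<open>Re\<close> here only converts the type.
\<close>

definition A_terms :: "real \<Rightarrow> (real \<Rightarrow> real) set" where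
  "A_terms \<sigma> =
     (if \<sigma> = 1 / 2
      then {\<lambda>t. ln t + 2 * euler_mascheroni - ln (2 * pi)}
      else {\<lambda>t. Re (zeta (of_real (2 * \<sigma>)))
                  + 2 * Gamma (2 * \<sigma> - 1) * Re (zeta (of_real (2 * \<sigma> - 1)))
                      * sin (pi * \<sigma>) * t powr (1 - 2 * \<sigma>) * (1 + r t)
            | r. r \<in> O[at_top](\<lambda>t. 1 / t)})"

end

theory Submission
  imports Defs
begin

text \<open>
  Let s = \<sigma> + it and w = \<sigma> - it. The proof rests on the integral of
  \<Gamma>(z) \<Gamma>(s - z) \<zeta>(z) \<zeta>(s + w - z) / \<Gamma>(s) over a line Re z = c with -1 < c < 0. For large
  \<sigma>, moving the line to the right past the poles at 0 and 1 and expanding both zeta factors turns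
  it, by a Mellin-Barnes formula, into the sum of n^(-w) (n + m)^(-s) over n, m \<ge> 1. Adding the same
  sum with s and w exchanged and the diagonal \<zeta>(s + w) gives \<zeta>(s) \<zeta>(w). Both sides of the
  resulting identity are holomorphic in \<sigma>, so it persists for 0 < \<sigma> < 1. There the line is
  moved to Re z = \<sigma>, which crosses the poles at 0 and 2\<sigma> - 1 (a double pole if \<sigma> = 1/2) and
  runs into the pole at z = s. The integrand of the theorem is the real part on this line, and the
  polar part at s is purely imaginary there, so the principal value is an ordinary integral, and its
  value over the whole line is known exactly. The tails cut off by the finite range decay faster
  than every power of t and are absorbed by the error O(1/t^2), so that the exponential error term
  can be taken to be 0; A comes from the asymptotics of \<Gamma>(1 - \<sigma> + it) / \<Gamma>(\<sigma> + it) and, if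
  \<sigma> = 1/2, of the digamma function.
\<close>

section \<open>The Riemann zeta function on the half-plane of real part greater than -1\<close>

text \<open>The position of the line, -1 < c < 0, is dictated by the continuation in \<sigma>. While
  \<sigma> moves from large values into (0, 1), the poles of the kernel at 0, 1, s and s + w - 1 = 2
  \<sigma> - 1 must stay to the right of the line. The last one is critical: it requires c < 2
  \<sigma> - 1, so small \<sigma> forces c towards -1. That is as far as the Euler-Maclaurin form of
  zeta with a single correction term reaches, and it is also where the next pole of Gamma sits. This
  one form therefore supplies everything that is needed of zeta: holomorphy, polynomial growth,
  symmetry under conjugation and the constants at 0 and 1. Taking the pole at s out of the integrand
  contributes half a residue, which is |zeta(s)|^2 up to sign; the continued identity contributes
  the same quantity with the opposite sign, so no such term survives. Besides A there remains the
  pole term with 1 / (s - 1) + 1 / (w - 1), which is as small as 1/t^2 only because s and w are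
  conjugate.\<close>

lemma trapezoid_rule_has_integral:
  fixes F f f' f'' :: "real \<Rightarrow> complex"
  assumes F: "\<And>x. x \<in> {0..1} \<Longrightarrow> (F has_vector_derivative f x) (at x within {0..1})"
    and f: "\<And>x. x \<in> {0..1} \<Longrightarrow> (f has_vector_derivative f' x) (at x within {0..1})"
    and f': "\<And>x. x \<in> {0..1} \<Longrightarrow> (f' has_vector_derivative f'' x) (at x within {0..1})"
  shows "((\<lambda>x. of_real (x * (1 - x) / 2) * f'' x) has_integral ((f 0 + f 1) / 2 - (F 1 - F 0))) {0..1}"
proof -
  \<comment> \<open>\<open>x * (1 - x) / 2\<close> is the Peano kernel of the trapezoid rule: it
    vanishes at 0 and 1 and its second derivative is -1. \<open>A\<close> packs two integrations by
    parts into one antiderivative, so that at the end points only \<open>f\<close> and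
    \<open>F\<close> survive.\<close>
  define A where "A x = of_real (x * (1 - x) / 2) * f' x - of_real ((1 - 2 * x) / 2) * f x - F x" for x
  have "(A has_vector_derivative of_real (x * (1 - x) / 2) * f'' x) (at x within {0..1})"
    if x: "x \<in> {0..1}" for x
  proof -
    have 1: "((\<lambda>x. complex_of_real (x * (1 - x) / 2)) has_vector_derivative of_real ((1 - 2 * x) / 2))
        (at x within {0..1})"
      by (rule has_vector_derivative_of_real)
         (auto intro!: derivative_eq_intros simp: field_simps simp flip: has_real_derivative_iff_has_vector_derivative)
    have 2: "((\<lambda>x. complex_of_real ((1 - 2 * x) / 2)) has_vector_derivative of_real (- 1))
        (at x within {0..1})"
      by (rule has_vector_derivative_of_real)
         (auto intro!: derivative_eq_intros simp: field_simps simp flip: has_real_derivative_iff_has_vector_derivative)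
    show ?thesis unfolding A_def
      by (rule has_vector_derivative_eq_rhs, rule has_vector_derivative_diff[OF has_vector_derivative_diff[OF
          has_vector_derivative_mult[OF 1 f'[OF x]] has_vector_derivative_mult[OF 2 f[OF x]]] F[OF x]])
         (simp add: algebra_simps)
  qed
  from fundamental_theorem_of_calculus[OF _ this]
  have "((\<lambda>x. of_real (x * (1 - x) / 2) * f'' x) has_integral (A 1 - A 0)) {0..1}" by auto
  also have "A 1 - A 0 = (f 0 + f 1) / 2 - (F 1 - F 0)" by (simp add: A_def field_simps)
  finally show ?thesis .
qed

section \<open>Periodic integrals and their continuation to the whole plane\<close>

lemma holomorphic_on_suminf:
  fixes f :: "nat \<Rightarrow> complex \<Rightarrow> complex"
  assumes S: "open S" and hol: "\<And>n. f n holomorphic_on S"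
    and bound: "\<And>x. x \<in> S \<Longrightarrow> \<exists>d>0. \<exists>M. cball x d \<subseteq> S \<and> summable M \<and> (\<forall>n. \<forall>y\<in>cball x d. norm (f n y) \<le> M n)"
  shows "(\<lambda>x. \<Sum>n. f n x) holomorphic_on S"
proof (rule holomorphic_uniform_sequence[OF S, where f = "\<lambda>n x. \<Sum>i<n. f i x"])
  fix x assume "x \<in> S"
  from bound[OF this] obtain d M where "d > 0" "cball x d \<subseteq> S" "summable M"
    "\<And>n y. y \<in> cball x d \<Longrightarrow> norm (f n y) \<le> M n" by blast
  thus "\<exists>d>0. cball x d \<subseteq> S \<and> uniform_limit (cball x d) (\<lambda>n x. \<Sum>i<n. f i x) (\<lambda>x. \<Sum>n. f n x) sequentially"
    by (intro exI[of _ d] conjI Weierstrass_m_test) auto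
qed (auto intro!: holomorphic_intros hol)

text \<open>
  \<open>period_sum p s\<close> is the integral of p({x}) x^(-s) over [1, \<infinity>). Integrating by parts against a
  periodic antiderivative of p minus its mean raises s by 1, which continues the function to the
  whole plane, one unit strip at a time.
\<close>

definition period_term :: "(real \<Rightarrow> real) \<Rightarrow> complex \<Rightarrow> nat \<Rightarrow> complex" where
  "period_term p s n = integral {0..1} (\<lambda>x. of_real (p x) * of_real (real (Suc n) + x) powr (- s))"

definition period_sum :: "(real \<Rightarrow> real) \<Rightarrow> complex \<Rightarrow> complex" where
  "period_sum p s = (\<Sum>n. period_term p s n)"

lemma continuous_on_period_integrand:
  assumes "continuous_on {0..1} p"
  shows "continuous_on {0..1} (\<lambda>x. complex_of_real (p x) * of_real (real (Suc n) + x) powr (- s))"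
proof -
  have "complex_of_real (real (Suc n) + x) \<in> \<real>\<^sub>\<le>\<^sub>0 \<Longrightarrow> x \<in> {0..1} \<Longrightarrow> False" for x
    by (simp only: nonpos_Reals_of_real_iff) auto
  thus ?thesis by (intro continuous_intros assms) (auto simp: complex_nonpos_Reals_iff complex_eq_iff)
qed

lemma integrable_period_integrand:
  assumes "continuous_on {0..1} p"
  shows "(\<lambda>x. complex_of_real (p x) * of_real (real (Suc n) + x) powr (- s)) integrable_on {0..1}"
  by (rule integrable_continuous_real continuous_on_period_integrand assms)+

lemma holomorphic_period_term:
  assumes p: "continuous_on {0..1} p"
  shows "(\<lambda>s. period_term p s n) holomorphic_on UNIV"
proof -
  define y where "y x = real (Suc n) + x" for x
  have y: "y x > 0" if "x \<in> {0..1}" for x using that by (auto simp: y_def)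
  have nz: "complex_of_real (y x) \<notin> \<real>\<^sub>\<le>\<^sub>0" "complex_of_real (y x) \<noteq> 0" if "x \<in> {0..1}" for x
    using y[OF that] by (simp_all only: nonpos_Reals_of_real_iff of_real_eq_0_iff)
  have cy: "continuous_on A y" for A unfolding y_def by (intro continuous_intros)
  have cs: "continuous_on (UNIV \<times> {0..1}) (\<lambda>(s :: complex, x). complex_of_real (p x) * of_real (y x) powr (- s) * (- Ln (of_real (y x))))"
    unfolding case_prod_unfold
    by (intro continuous_intros continuous_on_compose2[OF p] continuous_on_compose2[OF cy])
       (use nz y in \<open>auto intro: less_imp_le\<close>)
  have "(\<lambda>s. integral (cbox 0 1) (\<lambda>x. complex_of_real (p x) * of_real (y x) powr (- s))) holomorphic_on UNIV"
  proof (rule leibniz_rule_holomorphic)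
    show "continuous_on (UNIV \<times> cbox 0 1) (\<lambda>(s :: complex, x). complex_of_real (p x) * of_real (y x) powr (- s) * (- Ln (of_real (y x))))"
      using cs by simp
  next
    fix s :: complex and x :: real assume "x \<in> cbox 0 1"
    hence "x \<in> {0..1}" by simp
    from nz[OF this] show "((\<lambda>s. complex_of_real (p x) * of_real (y x) powr (- s)) has_field_derivative
        complex_of_real (p x) * of_real (y x) powr (- s) * (- Ln (of_real (y x)))) (at s within UNIV)"
      by (auto simp: powr_def intro!: derivative_eq_intros)
  next
    fix s show "(\<lambda>x. complex_of_real (p x) * of_real (y x) powr (- s)) integrable_on cbox 0 1"
      using integrable_period_integrand[OF p, of n s] unfolding y_def by simp
  qed simp
  thus ?thesis by (simp add: period_term_def y_def)
qed

lemma period_term_bound: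
  assumes p: "continuous_on {0..1} p" and B: "\<And>x. x \<in> {0..1} \<Longrightarrow> \<bar>p x\<bar> \<le> B" and s: "Re s \<ge> 0"
  shows "norm (period_term p s n) \<le> B * real (Suc n) powr (- Re s)"
proof -
  have "norm (integral {0..1} (\<lambda>x. complex_of_real (p x) * of_real (real (Suc n) + x) powr (- s)))
      \<le> integral {0..1} (\<lambda>x::real. B * real (Suc n) powr (- Re s))"
  proof (rule integral_norm_bound_integral[OF integrable_period_integrand[OF p]])
    fix x :: real assume x: "x \<in> {0..1}"
    have "norm (complex_of_real (real (Suc n) + x) powr (- s)) = (real (Suc n) + x) powr (- Re s)"
      using x by (subst norm_powr_real_powr) auto
    also have "\<dots> \<le> real (Suc n) powr (- Re s)"
      using x s by (intro powr_mono2') auto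
    finally show "norm (complex_of_real (p x) * complex_of_real (real (Suc n) + x) powr (- s))
        \<le> B * real (Suc n) powr (- Re s)"
      unfolding norm_mult using B[OF x] by (intro mult_mono) auto
  qed auto
  thus ?thesis by (simp add: period_term_def)
qed

lemma summable_Suc_powr: "a > 1 \<Longrightarrow> summable (\<lambda>n. real (Suc n) powr (- a))"
  using summable_real_powr_iff[of "-a"] by (subst summable_Suc_iff) simp

lemma period_bound_exists:
  assumes p: "continuous_on {0..1::real} p"
  obtains B :: real where "B \<ge> 0" "\<And>x. x \<in> {0..1} \<Longrightarrow> \<bar>p x\<bar> \<le> B"
proof -
  have "bounded (p ` {0..1})" by (rule compact_imp_bounded[OF compact_continuous_image[OF p]]) simp
  then obtain B where "\<And>y. y \<in> p ` {0..1} \<Longrightarrow> norm y \<le> B" by (auto simp: bounded_iff)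
  from this that[of "max B 0"] show ?thesis by (force simp: le_max_iff_disj)
qed

lemma summable_period_term:
  assumes p: "continuous_on {0..1} p" and s: "Re s > 1"
  shows "summable (\<lambda>n. norm (period_term p s n))"
proof -
  obtain B where "\<And>x. x \<in> {0..1} \<Longrightarrow> \<bar>p x\<bar> \<le> B" using period_bound_exists[OF p] by metis
  thus ?thesis using s
    by (intro summable_comparison_test'[OF summable_mult[OF summable_Suc_powr[of "Re s"], of B], of 0])
       (auto intro!: period_term_bound[OF p, simplified])
qed

lemma holomorphic_period_sum:
  assumes p: "continuous_on {0..1} p"
  shows "period_sum p holomorphic_on {s. Re s > 1}"
  unfolding period_sum_def
proof (rule holomorphic_on_suminf)
  show "open {s. Re s > 1}" by (rule open_halfspace_Re_gt)
  show "(\<lambda>s. period_term p s n) holomorphic_on {s. Re s > 1}" for n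
    using holomorphic_period_term[OF p] by (rule holomorphic_on_subset) auto
next
  fix s assume s: "s \<in> {s. Re s > 1}"
  obtain B where B: "B \<ge> 0" "\<And>x. x \<in> {0..1} \<Longrightarrow> \<bar>p x\<bar> \<le> B" using period_bound_exists[OF p] by metis
  define d where "d = (Re s - 1) / 2"
  have d: "d > 0" "1 + d > 1" using s by (auto simp: d_def)
  have re: "Re y \<ge> 1 + d" if "y \<in> cball s d" for y
    using that abs_Re_le_cmod[of "s - y"] by (auto simp: dist_norm d_def field_simps)
  have "norm (period_term p y n) \<le> B * real (Suc n) powr (- (1 + d))" if "y \<in> cball s d" for y n
  proof -
    have "norm (period_term p y n) \<le> B * real (Suc n) powr (- Re y)"
      using re[OF that] d by (intro period_term_bound p B) auto
    also have "\<dots> \<le> B * real (Suc n) powr (- (1 + d))"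
      using re[OF that] B by (intro mult_left_mono powr_mono) auto
    finally show ?thesis .
  qed
  moreover have "cball s d \<subseteq> {s. Re s > 1}" using re d by fastforce
  ultimately show "\<exists>d>0. \<exists>M. cball s d \<subseteq> {s. Re s > 1} \<and> summable M \<and> (\<forall>n. \<forall>y\<in>cball s d. norm (period_term p y n) \<le> M n)"
    using d by (intro exI[of _ d] exI[of _ "\<lambda>n. B * real (Suc n) powr (- (1 + d))"] conjI summable_mult summable_Suc_powr) auto
qed

lemma has_vector_derivative_powr_shift:
  assumes "a > 0" "x \<ge> 0"
  shows "((\<lambda>x. complex_of_real (a + x) powr w) has_vector_derivative w * of_real (a + x) powr (w - 1)) (at x within S)"
proof -
  have "complex_of_real (a + x) \<notin> \<real>\<^sub>\<le>\<^sub>0" using assms by (simp only: nonpos_Reals_of_real_iff)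
  hence "((\<lambda>z. z powr w) has_field_derivative w * complex_of_real (a + x) powr (w - 1)) (at (of_real (a + x)))"
    by (rule has_field_derivative_powr)
  moreover have "((\<lambda>x. complex_of_real (a + x)) has_vector_derivative of_real 1) (at x within S)"
    by (rule has_vector_derivative_of_real) (auto intro!: derivative_eq_intros simp flip: has_real_derivative_iff_has_vector_derivative)
  ultimately show ?thesis
    using field_vector_diff_chain_within[of "\<lambda>x. complex_of_real (a + x)" 1 x S "\<lambda>z. z powr w"]
    by (simp add: o_def has_field_derivative_at_within)
qed

text \<open>The weight splits as (\<open>p\<close> - \<open>m\<close>) + \<open>m\<close>. The first
  part has the antiderivative \<open>q\<close>, which vanishes at both ends and so leaves no
  boundary term; the constant part integrates in closed form to a difference that telescopes over
  \<open>n\<close>.\<close>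

lemma period_term_parts:
  assumes p: "continuous_on {0..1} p"
    and q: "\<And>x. x \<in> {0..1} \<Longrightarrow> (q has_vector_derivative p x - m) (at x within {0..1})"
    and q0: "q 0 = 0" "q 1 = 0" and s: "s \<noteq> 1"
  shows "period_term p s n = s * period_term q (s + 1) n
           + of_real m * (of_nat (Suc n) powr (1 - s) - of_nat (Suc (Suc n)) powr (1 - s)) / (s - 1)"
proof -
  define a where "a = real (Suc n)"
  have a: "a > 0" by (simp add: a_def)
  have cq: "continuous_on {0..1} q"
    by (rule continuous_on_vector_derivative[OF q])
  define G where "G x = of_real (q x) * of_real (a + x) powr (- s) + of_real m * (of_real (a + x) powr (1 - s) / (1 - s))" for x
  have "(G has_vector_derivative (of_real (p x) * of_real (a + x) powr (- s) - s * (of_real (q x) * of_real (a + x) powr (- (s + 1)))))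
          (at x within {0..1})" if x: "x \<in> {0..1}" for x
  proof -
    have "x \<ge> 0" using x by simp
    note D = has_vector_derivative_powr_shift[OF a this, where S = "{0..1}"]
    have "(G has_vector_derivative (of_real (q x) * (-s * of_real (a + x) powr (-s - 1)) + of_real (p x - m) * of_real (a + x) powr (- s)
        + of_real m * (((1 - s) * of_real (a + x) powr ((1 - s) - 1)) / (1 - s)))) (at x within {0..1})"
      unfolding G_def
      by (intro has_vector_derivative_add has_vector_derivative_mult has_vector_derivative_of_real
            q[OF x, folded has_real_derivative_iff_has_vector_derivative]
            has_vector_derivative_mult_right has_vector_derivative_divide D)
    moreover have e: "- s - 1 = - (s + 1)" "1 - s - 1 = - s" by simp_all
    ultimately show ?thesis
      by (elim has_vector_derivative_eq_rhs) (simp only: e, use s in \<open>simp, simp add: algebra_simps\<close>)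
  qed
  from fundamental_theorem_of_calculus[OF _ this]
  have "((\<lambda>x. of_real (p x) * of_real (a + x) powr (- s) - s * (of_real (q x) * of_real (a + x) powr (- (s + 1))))
     has_integral (G 1 - G 0)) {0..1}" by auto
  moreover have "((\<lambda>x. of_real (p x) * of_real (a + x) powr (- s) - s * (of_real (q x) * of_real (a + x) powr (- (s + 1))))
     has_integral (period_term p s n - s * period_term q (s + 1) n)) {0..1}"
    unfolding period_term_def a_def
    by (intro has_integral_diff has_integral_mult_right integrable_integral integrable_period_integrand p cq)
  ultimately have "period_term p s n - s * period_term q (s + 1) n = G 1 - G 0"
    by (rule has_integral_unique[symmetric])
  moreover have "complex_of_real (a + 1) = of_nat (Suc (Suc n))" "complex_of_real (a + 0) = of_nat (Suc n)" by (simp_all add: a_def)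
  ultimately have "period_term p s n - s * period_term q (s + 1) n = 
      of_real m * (of_nat (Suc (Suc n)) powr (1 - s) / (1 - s)) - of_real m * (of_nat (Suc n) powr (1 - s) / (1 - s))"
    by (simp only: G_def q0) simp
  also have "\<dots> = of_real m * (of_nat (Suc n) powr (1 - s) - of_nat (Suc (Suc n)) powr (1 - s)) / (s - 1)"
    using s by (simp add: divide_simps) (simp add: algebra_simps)
  finally show ?thesis by (simp add: algebra_simps)
qed

lemma Suc_powr_tendsto_0:
  assumes "Re w < 0"
  shows "(\<lambda>n. of_nat (Suc n) powr w :: complex) \<longlonglongrightarrow> 0"
proof (rule tendsto_norm_zero_cancel)
  have "(\<lambda>n. real n powr Re w) \<longlonglongrightarrow> 0"
    by (rule tendsto_neg_powr[OF assms filterlim_real_sequentially])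
  hence "(\<lambda>n. real (Suc n) powr Re w) \<longlonglongrightarrow> 0" by (rule filterlim_compose) (rule filterlim_Suc)
  moreover have "norm (of_nat (Suc n) powr w :: complex) = real (Suc n) powr Re w" for n
    using norm_powr_real_powr[of "of_nat (Suc n)" w] by (simp del: of_nat_Suc)
  ultimately show "(\<lambda>n. norm (of_nat (Suc n) powr w :: complex)) \<longlonglongrightarrow> 0" by simp
qed

lemma Suc_powr_telescope_sums:
  assumes "Re s > 1"
  shows "(\<lambda>n. of_nat (Suc n) powr (1 - s) - of_nat (Suc (Suc n)) powr (1 - s) :: complex) sums 1"
  using telescope_sums'[OF Suc_powr_tendsto_0[of "1 - s"]] assms by simp

text \<open>The telescoping differences sum to 1, so the mean contributes \<open>m\<close> / (s -
  1), the only pole produced by the step. Multiplying by s - 1 clears it, which is why the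
  continuation below is built for (s - 1) times the period sum.\<close>

lemma period_sum_parts:
  assumes p: "continuous_on {0..1} p"
    and q: "\<And>x. x \<in> {0..1} \<Longrightarrow> (q has_vector_derivative p x - m) (at x within {0..1})"
    and q0: "q 0 = 0" "q 1 = 0" and s: "Re s > 1"
  shows "(s - 1) * period_sum p s = of_real m + (s - 1) * (s * period_sum q (s + 1))"
proof -
  have cq: "continuous_on {0..1} q"
    by (rule continuous_on_vector_derivative[OF q])
  have s1: "s \<noteq> 1" using s by auto
  have q_sums: "period_term q (s + 1) sums period_sum q (s + 1)"
    unfolding period_sum_def using summable_period_term[OF cq, of "s + 1"] s
    by (intro summable_sums) (auto intro: summable_norm_cancel)
  have p_sums: "period_term p s sums period_sum p s"
    unfolding period_sum_def using summable_period_term[OF p s]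
    by (intro summable_sums) (auto intro: summable_norm_cancel)
  have "(\<lambda>n. s * period_term q (s + 1) n + of_real m * (of_nat (Suc n) powr (1 - s) - of_nat (Suc (Suc n)) powr (1 - s)) / (s - 1))
     sums (s * period_sum q (s + 1) + of_real m * 1 / (s - 1))"
    by (intro sums_add sums_mult sums_divide q_sums Suc_powr_telescope_sums s)
  also have "(\<lambda>n. s * period_term q (s + 1) n + of_real m * (of_nat (Suc n) powr (1 - s) - of_nat (Suc (Suc n)) powr (1 - s)) / (s - 1)) = period_term p s"
    using period_term_parts[OF p q q0 s1] by (intro ext) simp
  finally have "period_sum p s = s * period_sum q (s + 1) + of_real m * 1 / (s - 1)"
    using p_sums sums_unique2 by blast
  thus ?thesis using s1 by (simp add: field_simps)
qed

text \<open>Every step trades \<open>p\<close> for the antiderivative of its centred version, so the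
  induction has to cover all continuous weights at once. One unit of real part is gained per step
  because the sum for \<open>q\<close> is taken at s + 1.\<close>

lemma period_sum_continuation_step:
  assumes "continuous_on {0..1::real} p"
  shows "\<exists>J. J holomorphic_on {s. Re s > 1 - real k} \<and> (\<forall>s. Re s > 1 \<longrightarrow> J s = (s - 1) * period_sum p s)"
  using assms
proof (induction k arbitrary: p)
  case 0
  thus ?case by (intro exI[of _ "\<lambda>s. (s - 1) * period_sum p s"]) (auto intro!: holomorphic_intros holomorphic_period_sum)
next
  case (Suc k)
  \<comment> \<open>With \<open>m\<close> the mean of \<open>p\<close>, the antiderivative satisfies
    \<open>q 1 = 0\<close>, that is, it is again a continuous periodic weight.\<close>
  define m where "m = integral {0..1} p"
  define q where "q x = integral {0..x} (\<lambda>y. p y - m)" for x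
  have int: "p integrable_on {0..1}" using Suc.prems by (rule integrable_continuous_real)
  have q: "(q has_vector_derivative p x - m) (at x within {0..1})" if "x \<in> {0..1}" for x
    unfolding q_def by (rule integral_has_vector_derivative[OF _ that]) (intro continuous_intros Suc.prems)
  have q0: "q 0 = 0" "q 1 = 0" by (simp_all add: q_def m_def integral_diff[OF int integrable_const_ivl])
  have cq: "continuous_on {0..1} q"
    by (rule continuous_on_vector_derivative[OF q])
  from Suc.IH[OF cq] obtain J where J: "J holomorphic_on {s. Re s > 1 - real k}"
    "\<And>s. Re s > 1 \<Longrightarrow> J s = (s - 1) * period_sum q s" by blast
  have "(\<lambda>s. of_real m + (s - 1) * J (s + 1)) holomorphic_on {s. Re s > 1 - real (Suc k)}"
    by (intro holomorphic_intros holomorphic_on_compose_gen[OF _ J(1), unfolded o_def]) auto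
  moreover have "of_real m + (s - 1) * J (s + 1) = (s - 1) * period_sum p s" if "Re s > 1" for s
    using period_sum_parts[OF Suc.prems q q0 that] that by (simp add: J)
  ultimately show ?case by blast
qed

lemma holomorphic_eq_halfplane:
  assumes "f holomorphic_on {s. Re s > a}" "g holomorphic_on {s. Re s > a}"
    and "\<And>s. Re s > 1 \<Longrightarrow> f s = g s" and "Re s > a" and "a < 1"
  shows "f s = g s"
proof (rule analytic_continuation_open[where s = "{s. Re s > 1}" and s' = "{s. Re s > a}" and f = f and g = g])
  have "complex_of_real 2 \<in> {s. Re s > 1}" by simp
  thus "{s. Re s > 1} \<noteq> {}" by blast
  show "connected {s. Re s > a}" by (rule convex_connected[OF convex_halfspace_Re_gt])
qed (use assms in \<open>auto simp: open_halfspace_Re_gt\<close>)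

lemma period_sum_continuation:
  assumes p: "continuous_on {0..1::real} p"
  obtains J where "J holomorphic_on UNIV" "\<And>s. Re s > 1 \<Longrightarrow> J s = (s - 1) * period_sum p s"
proof -
  obtain J where J: "\<And>k. J k holomorphic_on {s. Re s > 1 - real k}" "\<And>k s. Re s > 1 \<Longrightarrow> J k s = (s - 1) * period_sum p s"
    using period_sum_continuation_step[OF p] by metis
  \<comment> \<open>\<open>Suc\<close> makes the inequality Re s > 1 - \<open>real (Suc l)\<close>
    strict, so every s lies in the open half-plane of the function chosen for it. Different choices
    agree by the identity theorem.\<close>
  define L where "L s = J (Suc (nat \<lceil>1 - Re s\<rceil>)) s" for s
  have eq: "L s = J (Suc k) s" if "Re s > 1 - real (Suc k)" for s k
  proof -
    define l where "l = nat \<lceil>1 - Re s\<rceil>"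
    have l: "Re s > 1 - real (Suc l)" unfolding l_def by linarith
    define a where "a = max (1 - real (Suc l)) (1 - real (Suc k))"
    have "J (Suc l) s = J (Suc k) s"
      by (rule holomorphic_eq_halfplane[of _ a, OF holomorphic_on_subset[OF J(1)] holomorphic_on_subset[OF J(1)]])
         (use l that J(2) in \<open>auto simp: a_def\<close>)
    thus ?thesis by (simp add: L_def l_def)
  qed
  have "L holomorphic_on (\<Union>k. {s. Re s > 1 - real (Suc k)})"
  proof (rule holomorphic_on_UN_open)
    show "L holomorphic_on {s. Re s > 1 - real (Suc k)}" for k
      by (rule holomorphic_transform[OF J(1)]) (use eq in auto)
  qed (auto simp: open_halfspace_Re_gt)
  also have "(\<Union>k. {s. Re s > 1 - real (Suc k)}) = UNIV"
  proof -
    have "\<exists>k. Re s > 1 - real (Suc k)" for s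
      using reals_Archimedean2[of "1 - Re s"] by (smt (verit) of_nat_Suc)
    thus ?thesis by auto
  qed
  finally have "L holomorphic_on UNIV" .
  moreover have "L s = (s - 1) * period_sum p s" if "Re s > 1" for s
    using eq[of 0 s] J(2)[of s] that by simp
  ultimately show ?thesis using that by blast
qed

section \<open>The Euler-Maclaurin form of zeta\<close>

abbreviation zeta_bump :: "real \<Rightarrow> real" where
  "zeta_bump \<equiv> (\<lambda>x. x * (1 - x))"

text \<open>The Euler-Maclaurin form of (s - 1) \<zeta>(s), which converges for Re s > -1.\<close>

definition zeta_reg :: "complex \<Rightarrow> complex" where
  "zeta_reg s = 1 + (s - 1) / 2 + (s - 1) * (s * (s + 1) / 2) * period_sum zeta_bump (s + 2)"

lemma continuous_zeta_bump: "continuous_on A zeta_bump"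
  by (intro continuous_intros)

lemma zeta_bump_le: "x \<in> {0..1} \<Longrightarrow> \<bar>zeta_bump x\<bar> \<le> 1"
  using mult_mono[of x 1 "1 - x" 1] by (simp add: abs_of_nonneg)

lemma has_integral_zeta_bump:
  "((\<lambda>x. complex_of_real (zeta_bump x) * of_real (real (Suc n) + x) powr (- s)) has_integral period_term zeta_bump s n) {0..1}"
  unfolding period_term_def
  by (intro integrable_integral integrable_period_integrand continuous_zeta_bump)

text \<open>The trapezoid rule for x^(-s) on [n + 1, n + 2]: the second derivative supplies s (s +
  1) and the kernel the factor 1/2.\<close>

lemma period_term_zeta_bump:
  assumes s: "s \<noteq> 1"
  shows "s * (s + 1) / 2 * period_term zeta_bump (s + 2) n =
    (of_nat (Suc n) powr (- s) + of_nat (Suc (Suc n)) powr (- s)) / 2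
      + (of_nat (Suc (Suc n)) powr (1 - s) - of_nat (Suc n) powr (1 - s)) / (s - 1)"
proof -
  define a where "a = real (Suc n)"
  have a: "a > 0" by (simp add: a_def)
  note D = has_vector_derivative_powr_shift[OF a, where S = "{0..1}"]
  let ?F = "\<lambda>x. of_real (a + x) powr (1 - s) / (1 - s)" and ?f = "\<lambda>x. of_real (a + x) powr (- s)"
  have "((\<lambda>x. of_real (x * (1 - x) / 2) * (s * (s + 1) * of_real (a + x) powr (- (s + 2))))
      has_integral ((?f 0 + ?f 1) / 2 - (?F 1 - ?F 0))) {0..1}"
  proof (rule trapezoid_rule_has_integral)
    fix x :: real assume "x \<in> {0..1}"
    hence x: "x \<ge> 0" by simp
    show "(?F has_vector_derivative ?f x) (at x within {0..1})"
      by (rule has_vector_derivative_eq_rhs, rule has_vector_derivative_divide[OF D[OF x]]) (use s in simp)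
    show "(?f has_vector_derivative -s * of_real (a + x) powr (-s-1)) (at x within {0..1})"
      by (rule D[OF x])
    show "((\<lambda>x. -s * of_real (a + x) powr (-s-1)) has_vector_derivative s * (s + 1) * of_real (a + x) powr (- (s + 2))) (at x within {0..1})"
      by (rule has_vector_derivative_eq_rhs, rule has_vector_derivative_mult_right[OF D[OF x]]) (simp add: algebra_simps)
  qed
  moreover have "((\<lambda>x. of_real (x * (1 - x) / 2) * (s * (s + 1) * of_real (a + x) powr (- (s + 2))))
      has_integral (s * (s + 1) / 2 * period_term zeta_bump (s + 2) n)) {0..1}"
    using has_integral_mult_right[OF has_integral_zeta_bump[of n "s + 2"], of "s * (s + 1) / 2"]
    unfolding a_def by (rule has_integral_eq[rotated]) (simp add: field_simps)
  ultimately have "s * (s + 1) / 2 * period_term zeta_bump (s + 2) n = (?f 0 + ?f 1) / 2 - (?F 1 - ?F 0)"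
    by (rule has_integral_unique[symmetric])
  also have "\<dots> = (?f 0 + ?f 1) / 2 + (of_real (a + 1) powr (1 - s) - of_real (a + 0) powr (1 - s)) / (s - 1)"
    using s by (simp add: divide_simps) (simp add: algebra_simps)
  also have "complex_of_real (a + 1) = of_nat (Suc (Suc n))" by (simp add: a_def)
  also have "complex_of_real (a + 0) = of_nat (Suc n)" by (simp add: a_def)
  finally show ?thesis .
qed

lemma summable_Suc_cpowr:
  assumes "Re s > 1"
  shows "summable (\<lambda>n. norm (of_nat (Suc n) powr (- s) :: complex))"
proof -
  have "norm (of_nat (Suc n) powr (- s) :: complex) = real (Suc n) powr (- Re s)" for n
    using norm_powr_real_powr[of "of_nat (Suc n)" "-s"] by (simp del: of_nat_Suc)
  thus ?thesis using summable_Suc_powr[OF assms] by (simp only:)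
qed

text \<open>Summing the trapezoid rule over n counts every term of the Dirichlet series twice with
  weight 1/2, except the first, which occurs once: hence the mean of \<open>Z\<close> and
  \<open>Z - 1\<close>. The integrals of x^(-s) telescope to 1 / (s - 1).\<close>

lemma dirichlet_series_sums:
  assumes s: "Re s > 1"
  shows "(\<lambda>n. of_nat (Suc n) powr (- s)) sums (zeta_reg s / (s - 1))"
proof -
  define Z :: complex where "Z = (\<Sum>n. of_nat (Suc n) powr (- s))"
  have s1: "s \<noteq> 1" using s by auto
  have Z: "(\<lambda>n. of_nat (Suc n) powr (- s)) sums Z"
    unfolding Z_def using summable_norm_cancel[OF summable_Suc_cpowr[OF s]] by (rule summable_sums)
  hence Z': "(\<lambda>n. of_nat (Suc (Suc n)) powr (- s)) sums (Z - 1)"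
    by (subst sums_Suc_iff[of "\<lambda>n. of_nat (Suc n) powr (- s)"]) simp
  have P: "period_term zeta_bump (s + 2) sums period_sum zeta_bump (s + 2)"
    unfolding period_sum_def using summable_period_term[OF continuous_zeta_bump, of "s + 2"] s
    by (intro summable_sums) (auto intro: summable_norm_cancel)
  have "(\<lambda>n. (of_nat (Suc n) powr (- s) + of_nat (Suc (Suc n)) powr (- s)) / 2
       - (of_nat (Suc n) powr (1 - s) - of_nat (Suc (Suc n)) powr (1 - s)) / (s - 1)) sums ((Z + (Z - 1)) / 2 - 1 / (s - 1))"
    by (intro sums_add sums_diff sums_divide Z Z' Suc_powr_telescope_sums s)
  also have "(\<lambda>n. (of_nat (Suc n) powr (- s) + of_nat (Suc (Suc n)) powr (- s)) / 2
       - (of_nat (Suc n) powr (1 - s) - of_nat (Suc (Suc n)) powr (1 - s)) / (s - 1))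
       = (\<lambda>n. s * (s + 1) / 2 * period_term zeta_bump (s + 2) n)"
    unfolding period_term_zeta_bump[OF s1] by (intro ext) (simp add: diff_divide_distrib)
  finally have "s * (s + 1) / 2 * period_sum zeta_bump (s + 2) = (Z + (Z - 1)) / 2 - 1 / (s - 1)"
    using sums_mult[OF P, of "s * (s + 1) / 2"] sums_unique2 by blast
  hence "zeta_reg s = 1 + (s - 1) / 2 + (s - 1) * ((Z + (Z - 1)) / 2 - 1 / (s - 1))"
    by (simp only: zeta_reg_def mult.assoc)
  also have "\<dots> = Z * (s - 1)" using s1 by (simp add: field_simps)
  finally show ?thesis using Z s1 by simp
qed

text \<open>Makes the choice in the definition of \<open>zeta\<close> meaningful. That definition
  asks for holomorphy on the whole punctured plane, so the half-plane Re s > -1 of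
  \<open>zeta_reg\<close> does not suffice here and the full continuation of
  \<open>period_sum\<close> enters.\<close>

lemma zeta_continuation_exists:
  "\<exists>f. f holomorphic_on (- {1}) \<and> (\<forall>s. Re s > 1 \<longrightarrow> (\<lambda>n. 1 / of_nat (Suc n) powr s) sums f s)"
proof -
  obtain J where J: "J holomorphic_on UNIV" "\<And>s. Re s > 1 \<Longrightarrow> J s = (s - 1) * period_sum zeta_bump s"
    using period_sum_continuation[OF continuous_zeta_bump] by blast
  \<comment> \<open>\<open>J (s + 2)\<close> stands for s + 1 times the period sum at s + 2, hence s
    / 2 in place of s (s + 1) / 2.\<close>
  define f where "f s = (1 + (s - 1) / 2 + (s - 1) * (s / 2) * J (s + 2)) / (s - 1)" for s
  have "f holomorphic_on (- {1})"
    unfolding f_def by (intro holomorphic_intros holomorphic_on_compose_gen[OF _ J(1), unfolded o_def]) auto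
  moreover have "(\<lambda>n. 1 / of_nat (Suc n) powr s) sums f s" if s: "Re s > 1" for s
  proof -
    have "f s = zeta_reg s / (s - 1)"
      using s by (simp add: f_def zeta_reg_def J mult.assoc)
    thus ?thesis using dirichlet_series_sums[OF s]
      by (simp add: powr_minus field_simps del: of_nat_Suc)
  qed
  ultimately show ?thesis by blast
qed

lemma holomorphic_zeta: "zeta holomorphic_on (- {1})"
  and zeta_sums: "Re s > 1 \<Longrightarrow> (\<lambda>n. of_nat (Suc n) powr (- s)) sums zeta s"
proof -
  from someI_ex[OF zeta_continuation_exists]
  have "zeta holomorphic_on (- {1}) \<and> (\<forall>s. Re s > 1 \<longrightarrow> (\<lambda>n. 1 / of_nat (Suc n) powr s) sums zeta s)"
    unfolding zeta_def[symmetric] .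
  thus "zeta holomorphic_on (- {1})" "Re s > 1 \<Longrightarrow> (\<lambda>n. of_nat (Suc n) powr (- s)) sums zeta s"
    by (auto simp: powr_minus field_simps simp del: of_nat_Suc)
qed

lemma holomorphic_zeta' [holomorphic_intros]:
  "f holomorphic_on A \<Longrightarrow> (\<And>z. z \<in> A \<Longrightarrow> f z \<noteq> 1) \<Longrightarrow> (\<lambda>z. zeta (f z)) holomorphic_on A"
  by (rule holomorphic_on_compose_gen[OF _ holomorphic_zeta, unfolded o_def]) auto

lemma holomorphic_zeta_reg: "zeta_reg holomorphic_on {s. Re s > -1}"
  unfolding zeta_reg_def
  by (intro holomorphic_intros holomorphic_on_compose_gen[OF _ holomorphic_period_sum[OF continuous_zeta_bump], unfolded o_def]) auto

lemma holomorphic_zeta_reg' [holomorphic_intros]: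
  "f holomorphic_on A \<Longrightarrow> (\<And>z. z \<in> A \<Longrightarrow> Re (f z) > -1) \<Longrightarrow> (\<lambda>z. zeta_reg (f z)) holomorphic_on A"
  by (rule holomorphic_on_compose_gen[OF _ holomorphic_zeta_reg, unfolded o_def]) auto

text \<open>Both sides agree for Re s > 1, and the half-plane stays connected when the point 1 is
  removed, so the identity theorem applies.\<close>

lemma zeta_eq_zeta_reg:
  assumes "Re s > -1" "s \<noteq> 1"
  shows "zeta s = zeta_reg s / (s - 1)"
proof (rule analytic_continuation_open[where s = "{s. Re s > 1}" and s' = "{s. Re s > -1} - {1}"
      and f = zeta and g = "\<lambda>s. zeta_reg s / (s - 1)"])
  have "complex_of_real 2 \<in> {s. Re s > 1}" by simp
  thus "{s. Re s > 1} \<noteq> {}" by blast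
  show "connected ({s. Re s > -1} - {1})"
    by (rule connected_open_delete)
       (auto simp: open_halfspace_Re_gt convex_halfspace_Re_gt intro: convex_connected)
  show "zeta z = zeta_reg z / (z - 1)" if "z \<in> {s. Re s > 1}" for z
    using sums_unique2[OF zeta_sums dirichlet_series_sums, of z] that by simp
qed (use assms in \<open>auto simp: open_halfspace_Re_gt intro!: holomorphic_intros open_Diff\<close>)

lemma cnj_period_term: "cnj (period_term p s n) = period_term p (cnj s) n"
proof -
  have "cnj (complex_of_real (real (Suc n) + x) powr (- s)) = complex_of_real (real (Suc n) + x) powr (- cnj s)"
    if "x \<in> {0..1}" for x
    using that by (subst cnj_powr) (auto simp: complex_nonpos_Reals_iff)
  thus ?thesis unfolding period_term_def integral_cnj
    by (intro integral_cong) (simp del: of_nat_Suc)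
qed

lemma cnj_suminf:
  assumes "summable f" shows "cnj (suminf f) = (\<Sum>n. cnj (f n))"
  using sums_unique[OF sums_cnj[THEN iffD2, OF summable_sums[OF assms]]] by simp

text \<open>All weights and bases in the Euler-Maclaurin form are real, so conjugation passes
  through to s term by term.\<close>

lemma cnj_zeta:
  assumes "Re s > -1" "s \<noteq> 1"
  shows "cnj (zeta s) = zeta (cnj s)"
proof -
  have "cnj (period_sum zeta_bump (s + 2)) = period_sum zeta_bump (cnj s + 2)"
    unfolding period_sum_def using summable_period_term[OF continuous_zeta_bump, of "s + 2"] assms
    by (subst cnj_suminf) (auto intro: summable_norm_cancel simp: cnj_period_term)
  moreover have "cnj s \<noteq> 1" using assms(2) by (metis complex_cnj_cnj complex_cnj_one)
  ultimately show ?thesis using assms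
    by (simp add: zeta_eq_zeta_reg zeta_reg_def)
qed

text \<open>The cubic growth comes from the three linear factors s - 1, s and s + 1. The period sum
  is bounded uniformly, because its argument s + 2 has real part at least 1 + e.\<close>

lemma zeta_reg_bound:
  assumes "e > 0"
  obtains C where "C > 0" "\<And>s. Re s \<ge> -1 + e \<Longrightarrow> norm (zeta_reg s) \<le> C * (1 + norm s) ^ 3"
proof -
  define K where "K = (\<Sum>n. real (Suc n) powr (- (1 + e)))"
  have K: "K \<ge> 0" "summable (\<lambda>n. real (Suc n) powr (- (1 + e)))"
    using summable_Suc_powr[of "1 + e"] assms by (auto simp: K_def intro!: suminf_nonneg simp del: of_nat_Suc)
  have "norm (zeta_reg s) \<le> (2 + K) * (1 + norm s) ^ 3" if s: "Re s \<ge> -1 + e" for s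
  proof -
    have b: "norm (period_term zeta_bump (s + 2) n) \<le> real (Suc n) powr (- (1 + e))" for n
    proof -
      have "norm (period_term zeta_bump (s + 2) n) \<le> 1 * real (Suc n) powr (- Re (s + 2))"
        by (rule period_term_bound[OF continuous_zeta_bump zeta_bump_le]) (use s assms in auto)
      also have "\<dots> \<le> real (Suc n) powr (- (1 + e))"
        using s by (simp add: powr_mono del: of_nat_Suc)
      finally show ?thesis .
    qed
    have sm: "summable (\<lambda>n. norm (period_term zeta_bump (s + 2) n))"
      using b K(2) by (intro summable_comparison_test'[OF K(2), of 0]) auto
    have "norm (period_sum zeta_bump (s + 2)) \<le> (\<Sum>n. norm (period_term zeta_bump (s + 2) n))"
      unfolding period_sum_def by (rule summable_norm[OF sm])
    also have "\<dots> \<le> K" unfolding K_def by (rule suminf_le[OF b sm K(2)])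
    finally have P: "norm (period_sum zeta_bump (s + 2)) \<le> K" .
    define y where "y = 1 + norm s"
    have y: "y \<ge> 1" by (simp add: y_def)
    have 1: "norm (s - 1) \<le> y" "norm s \<le> y" "norm (s + 1) \<le> y"
      using norm_triangle_ineq4[of s 1] norm_triangle_ineq[of s 1] by (auto simp: y_def)
    have "norm (zeta_reg s) \<le> norm (1 + (s - 1) / 2) + norm ((s - 1) * (s * (s + 1) / 2) * period_sum zeta_bump (s + 2))"
      unfolding zeta_reg_def by (rule norm_triangle_ineq)
    also have "norm (1 + (s - 1) / 2) \<le> 1 + norm (s - 1) / 2"
      using norm_triangle_ineq[of 1 "(s - 1) / 2"] by simp
    also have "\<dots> \<le> 2 * y ^ 3"
    proof -
      have "1 + norm (s - 1) / 2 \<le> 2 * y" using 1(1) y by linarith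
      also have "y \<le> y ^ 3" using y by (intro self_le_power) auto
      finally show ?thesis by simp
    qed
    also have "norm ((s - 1) * (s * (s + 1) / 2) * period_sum zeta_bump (s + 2))
       = (norm (s - 1) * (norm s * norm (s + 1))) * (norm (period_sum zeta_bump (s + 2)) / 2)"
      by (simp add: norm_mult norm_divide)
    also have "\<dots> \<le> (y * (y * y)) * K"
      using 1 P K(1) y by (intro mult_mono) auto
    finally show ?thesis by (simp add: y_def power3_eq_cube algebra_simps)
  qed
  thus ?thesis using K(1) by (intro that[of "2 + K"]) auto
qed

section \<open>Special values of zeta and its derivative at 0 and 1\<close>

lemma zeta_reg_1: "zeta_reg 1 = 1"
  by (simp add: zeta_reg_def)

lemma zeta_0: "zeta 0 = -1/2"
  by (simp add: zeta_eq_zeta_reg zeta_reg_def)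

lemma period_sum_zeta_bump_sums:
  assumes "Re s > 1" shows "period_term zeta_bump s sums period_sum zeta_bump s"
  unfolding period_sum_def using summable_period_term[OF continuous_zeta_bump, of s] assms
  by (intro summable_sums) (auto intro: summable_norm_cancel)

text \<open>The trapezoid rule for 1/x: summed over n it compares harmonic numbers with logarithms,
  and the limit brings in the Euler constant. The argument 3 is s + 2 at s = 1.\<close>

lemma period_sum_zeta_bump_3: "period_sum zeta_bump 3 = of_real (euler_mascheroni - 1 / 2)"
proof -
  have t_eq: "period_term zeta_bump 3 n = of_real ((1 / real (Suc n) + 1 / real (Suc (Suc n))) / 2
      - (ln (real (Suc (Suc n))) - ln (real (Suc n))))" for n
  proof -
    define a where "a = real (Suc n)"
    have a: "a > 0" by (simp add: a_def)
    let ?F = "\<lambda>x. complex_of_real (ln (a + x))" and ?f = "\<lambda>x. complex_of_real (1 / (a + x))"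
    have "((\<lambda>x. of_real (x * (1 - x) / 2) * of_real (2 / (a + x) ^ 3))
        has_integral ((?f 0 + ?f 1) / 2 - (?F 1 - ?F 0))) {0..1}"
    proof (rule trapezoid_rule_has_integral)
      fix x :: real assume "x \<in> {0..1}"
      hence x: "a + x > 0" using a by simp
      show "(?F has_vector_derivative ?f x) (at x within {0..1})"
        by (rule has_vector_derivative_of_real) (use x in \<open>auto intro!: derivative_eq_intros\<close>)
      show "(?f has_vector_derivative of_real (- 1 / (a + x) ^ 2)) (at x within {0..1})"
        by (rule has_vector_derivative_of_real) (use x in \<open>auto intro!: derivative_eq_intros simp: power2_eq_square\<close>)
      show "((\<lambda>x. complex_of_real (- 1 / (a + x) ^ 2)) has_vector_derivative of_real (2 / (a + x) ^ 3)) (at x within {0..1})"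
        proof (rule has_vector_derivative_of_real)
        have "((\<lambda>x. - 1 / (a + x) ^ 2) has_real_derivative (2 * (a + x)) / ((a + x) ^ 2 * (a + x) ^ 2)) (at x within {0..1})"
          using x by (auto intro!: derivative_eq_intros simp: add_divide_distrib diff_divide_distrib)
        also have "(2 * (a + x)) / ((a + x) ^ 2 * (a + x) ^ 2) = 2 / (a + x) ^ 3"
          using x by (simp add: divide_simps power3_eq_cube power2_eq_square)
        finally show "((\<lambda>x. - 1 / (a + x) ^ 2) has_real_derivative 2 / (a + x) ^ 3) (at x within {0..1})" .
      qed
    qed
    moreover have "((\<lambda>x. of_real (x * (1 - x) / 2) * of_real (2 / (a + x) ^ 3)) has_integral (period_term zeta_bump 3 n)) {0..1}"
    proof (rule has_integral_eq[OF _ has_integral_zeta_bump[of n 3]])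
      fix x :: real assume "x \<in> {0..1}"
      hence x: "a + x > 0" using a by simp
      have "complex_of_real (a + x) powr (- 3) = of_real ((a + x) powr (- 3))"
        using x by (subst powr_of_real[symmetric]) auto
      also have "(a + x) powr (- 3) = 1 / (a + x) ^ 3"
        using x by (simp add: powr_minus_divide)
      finally show "complex_of_real (zeta_bump x) * of_real (real (Suc n) + x) powr (- 3) =
         of_real (x * (1 - x) / 2) * of_real (2 / (a + x) ^ 3)"
        by (simp add: a_def)
    qed
    ultimately have "period_term zeta_bump 3 n = (?f 0 + ?f 1) / 2 - (?F 1 - ?F 0)"
      by (rule has_integral_unique[symmetric])
    moreover have "a + 0 = real (Suc n)" "a + 1 = real (Suc (Suc n))" by (simp_all add: a_def)
    ultimately show ?thesis by (simp only:) simp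
  qed
  \<comment> \<open>In the partial sums the first and the last term of the harmonic sum carry weight
    1/2, which gives the two corrections 1/2 and 1 / (2 (N + 1)).\<close>
  define g where "g N = (harm (Suc N) - ln (real (Suc N))) - 1 / 2 - 1 / (2 * real (Suc N))" for N
  have sum: "(\<Sum>n<N. ((1 / real (Suc n) + 1 / real (Suc (Suc n))) / 2
      - (ln (real (Suc (Suc n))) - ln (real (Suc n))))) = g N" for N
  proof (induction N)
    case 0
    show ?case by (simp add: g_def harm_expand)
  next
    case (Suc N)
    have half: "1 / (2 * real (Suc n)) = (1 / real (Suc n)) / 2" for n by simp
    show ?case unfolding sum.lessThan_Suc Suc g_def harm_Suc[of "Suc N"] half
      by (simp add: inverse_eq_divide add_divide_distrib del: of_nat_Suc)
  qed
  have "g \<longlonglongrightarrow> euler_mascheroni - 1 / 2 - 0"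
    unfolding g_def
    by (intro tendsto_intros LIMSEQ_Suc[OF euler_mascheroni_LIMSEQ]) real_asymp
  hence "(\<lambda>n. (1 / real (Suc n) + 1 / real (Suc (Suc n))) / 2
      - (ln (real (Suc (Suc n))) - ln (real (Suc n)))) sums (euler_mascheroni - 1 / 2)"
    unfolding sums_def sum by simp
  from sums_of_real[OF this, where ?'a = complex]
  have "period_term zeta_bump 3 sums of_real (euler_mascheroni - 1 / 2)"
    unfolding t_eq[symmetric] .
  with period_sum_zeta_bump_sums[of 3] show ?thesis using sums_unique2 by force
qed

text \<open>The derivative \<open>D\<close> of the period sum is multiplied by s - 1, which vanishes
  at 1; there remain 1/2 and the value of the period sum at 3. The result is the constant term in
  the Laurent expansion of zeta at 1.\<close>

lemma zeta_reg_deriv_1: "(zeta_reg has_field_derivative of_real euler_mascheroni) (at 1)"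
proof -
  have "(\<lambda>s. period_sum zeta_bump (s + 2)) holomorphic_on {s. Re s > -1}"
    by (intro holomorphic_intros holomorphic_on_compose_gen[OF _ holomorphic_period_sum[OF continuous_zeta_bump], unfolded o_def]) auto
  from holomorphic_on_imp_differentiable_at[OF this open_halfspace_Re_gt, of 1]
  obtain D where "((\<lambda>s. period_sum zeta_bump (s + 2)) has_field_derivative D) (at 1)"
    by (auto simp: field_differentiable_def)
  note D = this
  have 1: "((\<lambda>s::complex. (s - 1) / 2) has_field_derivative 1 / 2) (at 1)"
    by (auto intro!: derivative_eq_intros)
  have 2: "((\<lambda>s::complex. (s - 1) * (s * (s + 1) / 2)) has_field_derivative 1) (at 1)"
    by (auto intro!: derivative_eq_intros)
  have "(zeta_reg has_field_derivative 0 + 1 / 2 + (1 * period_sum zeta_bump (1 + 2) + D * ((1 - 1) * (1 * (1 + 1) / 2)))) (at 1)"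
    unfolding zeta_reg_def by (intro DERIV_add DERIV_mult 1 2 D DERIV_const)
  thus ?thesis by (simp add: period_sum_zeta_bump_3)
qed

text \<open>Field arithmetic of the induction step for the partial Wallis products, with
  \<open>y\<close> = m, \<open>P\<close> = 2^(4m), \<open>F\<close> = m! and \<open>G\<close> =
  (2m)!.\<close>

lemma wallis_step:
  fixes y P F G :: real
  assumes "y \<ge> 0" "G \<noteq> 0"
  shows "P * F ^ 4 / (G ^ 2 * (2 * y + 1)) * (4 * (y + 1) ^ 2 / ((2 * y + 1) * (2 * y + 3)))
     = 16 * P * ((y + 1) * F) ^ 4 / (((2 * y + 2) * (2 * y + 1) * G) ^ 2 * (2 * (y + 1) + 1))"
proof -
  define u v w where "u = y + 1" and "v = 2 * y + 1" and "w = 2 * y + 3"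
  have "u \<noteq> 0" "v \<noteq> 0" "w \<noteq> 0" using assms by (auto simp: u_def v_def w_def)
  moreover have "2 * y + 2 = 2 * u" "2 * (y + 1) + 1 = w" by (auto simp: u_def w_def)
  moreover define U F4 G2 where "U = u\<^sup>2" and "F4 = F ^ 4" and "G2 = G\<^sup>2"
  moreover have "(u * F) ^ 4 = U * U * F4" "(2 * u * v * G)\<^sup>2 = 4 * U * (v * v * G2)"
    by (simp_all add: U_def F4_def G2_def power_mult_distrib power2_eq_square power4_eq_xxxx)
  ultimately show ?thesis using assms(2)
    by (simp only: u_def[symmetric] v_def[symmetric] w_def[symmetric] U_def[symmetric] F4_def[symmetric] G2_def[symmetric])
       (simp add: field_simps U_def G2_def)
qed

text \<open>Identifies the constant in Stirling's formula once a limit is known to exist: 4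
  \<open>a n\<close> - 2 \<open>a (2 * n)\<close> is, up to elementary logarithms, the logarithm of
  a partial Wallis product.\<close>

lemma stirling_limit:
  assumes "a \<longlonglongrightarrow> L" and a: "\<And>n. n > 0 \<Longrightarrow> a n = ln (fact n) - (real n + 1 / 2) * ln (real n) + real n"
  shows "L = ln (2 * pi) / 2"
proof -
  have "(\<lambda>n. 4 * a (Suc n) - 2 * a (2 * Suc n) - ln 2 + ln (real (Suc n)) - ln (2 * real (Suc n) + 1)) \<longlonglongrightarrow> 4 * L - 2 * L - ln 2 - ln 2"
  proof -
    have 1: "(\<lambda>n. a (Suc n)) \<longlonglongrightarrow> L" using assms(1) by (rule LIMSEQ_Suc)
    have 2: "(\<lambda>n. a (2 * Suc n)) \<longlonglongrightarrow> L"
      by (rule filterlim_compose[OF assms(1)]) (rule filterlim_subseq, auto simp: strict_mono_def)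
    have 3: "(\<lambda>n. ln (real (Suc n)) - ln (2 * real (Suc n) + 1)) \<longlonglongrightarrow> - ln 2" by real_asymp
    show ?thesis using tendsto_add[OF tendsto_diff[OF tendsto_diff[OF tendsto_mult_left[OF 1, of 4] tendsto_mult_left[OF 2, of 2]] tendsto_const[of "ln 2"]] 3]
      by (simp add: algebra_simps)
  qed
  moreover have "4 * a (Suc n) - 2 * a (2 * Suc n) - ln 2 + ln (real (Suc n)) - ln (2 * real (Suc n) + 1) =
     ln (\<Prod>k=1..Suc n. (4*real k^2) / (4*real k^2 - 1))" for n
  proof -
    define m where "m = Suc n"
    have m: "m > 0" by (simp add: m_def)
    have prod: "(\<Prod>k=1..m. (4*real k^2) / (4*real k^2 - 1)) = 2 ^ (4 * m) * fact m ^ 4 / (fact (2 * m) ^ 2 * (2 * real m + 1))" for m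
    proof (induction m)
      case (Suc m)
      define y where "y = real m"
      have y: "y \<ge> 0" by (simp add: y_def)
      have f: "fact (2 * Suc m) = (2 * y + 2) * (2 * y + 1) * (fact (2 * m) :: real)" "fact (Suc m) = (y + 1) * (fact m :: real)"
        by (simp_all add: y_def algebra_simps)
      have p: "(4*real (Suc m)^2) / (4*real (Suc m)^2 - 1) = 4 * (y + 1)^2 / ((2 * y + 1) * (2 * y + 3))"
        by (simp add: y_def power2_eq_square algebra_simps)
      have "(\<Prod>k=1..Suc m. (4*real k^2) / (4*real k^2 - 1)) = 2 ^ (4 * m) * fact m ^ 4 / (fact (2 * m) ^ 2 * (2 * y + 1)) * (4 * (y + 1)^2 / ((2 * y + 1) * (2 * y + 3)))"
        by (simp only: prod.nat_ivl_Suc' Suc p y_def) (simp add: Suc mult_ac)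
      also have "\<dots> = 16 * 2 ^ (4 * m) * ((y + 1) * fact m) ^ 4 / (((2 * y + 2) * (2 * y + 1) * fact (2 * m)) ^ 2 * (2 * (y + 1) + 1))"
        by (rule wallis_step) (use y in auto)
      moreover have "real (Suc m) = y + 1" "2 ^ (4 * Suc m) = 16 * (2 ^ (4 * m) :: real)"
        by (simp_all add: y_def power_add)
      ultimately show ?case by (simp only: f)
    qed simp
    have "ln (2 ^ (4 * m) * fact m ^ 4 / (fact (2 * m) ^ 2 * (2 * real m + 1))) =
       4 * m * ln 2 + 4 * ln (fact m) - (2 * ln (fact (2 * m)) + ln (2 * real m + 1))"
      by (simp add: ln_div ln_mult ln_realpow)
    also have "\<dots> = 4 * a m - 2 * a (2 * m) - ln 2 + ln (real m) - ln (2 * real m + 1)"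
      using m by (simp add: a ln_mult field_simps)
    finally show ?thesis unfolding m_def prod by simp
  qed
  ultimately have "(\<lambda>n. ln (\<Prod>k=1..Suc n. (4*real k^2) / (4*real k^2 - 1))) \<longlonglongrightarrow> 4 * L - 2 * L - ln 2 - ln 2"
    by simp
  moreover have "(\<lambda>n. ln (\<Prod>k=1..Suc n. (4*real k^2) / (4*real k^2 - 1))) \<longlonglongrightarrow> ln (pi / 2)"
    by (intro tendsto_ln LIMSEQ_Suc[OF wallis]) auto
  ultimately have "4 * L - 2 * L - ln 2 - ln 2 = ln (pi / 2)" by (rule LIMSEQ_unique)
  thus ?thesis by (simp add: ln_div ln_mult)
qed

text \<open>The trapezoid rule for - ln x telescopes to the Stirling sequence. The convergence of
  the period sum thus proves that this sequence has a limit, which \<open>stirling_limit\<close>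
  evaluates. The argument 2 is s + 2 at s = 0.\<close>

lemma period_sum_zeta_bump_2: "period_sum zeta_bump 2 = of_real (2 - ln (2 * pi))"
proof -
  define b where "b n = - (ln (real (Suc n)) + ln (real (Suc (Suc n)))) / 2
      + (real (Suc (Suc n)) * ln (real (Suc (Suc n))) - real (Suc n) * ln (real (Suc n)) - 1)" for n
  have t_eq: "period_term zeta_bump 2 n = of_real (2 * b n)" for n
  proof -
    define a where "a = real (Suc n)"
    have a: "a > 0" by (simp add: a_def)
    let ?F = "\<lambda>x. complex_of_real (- ((a + x) * ln (a + x) - (a + x)))" and ?f = "\<lambda>x. complex_of_real (- ln (a + x))"
    have "((\<lambda>x. of_real (x * (1 - x) / 2) * of_real (1 / (a + x) ^ 2))
        has_integral ((?f 0 + ?f 1) / 2 - (?F 1 - ?F 0))) {0..1}"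
    proof (rule trapezoid_rule_has_integral)
      fix x :: real assume "x \<in> {0..1}"
      hence x: "a + x > 0" using a by simp
      show "(?F has_vector_derivative ?f x) (at x within {0..1})"
        by (rule has_vector_derivative_of_real) (use x in \<open>auto intro!: derivative_eq_intros\<close>)
      show "(?f has_vector_derivative of_real (- 1 / (a + x))) (at x within {0..1})"
        by (rule has_vector_derivative_of_real) (use x in \<open>auto intro!: derivative_eq_intros\<close>)
      show "((\<lambda>x. complex_of_real (- 1 / (a + x))) has_vector_derivative of_real (1 / (a + x) ^ 2)) (at x within {0..1})"
        by (rule has_vector_derivative_of_real) (use x in \<open>auto intro!: derivative_eq_intros simp: power2_eq_square\<close>)
    qed
    hence "((\<lambda>x. 2 * (of_real (x * (1 - x) / 2) * of_real (1 / (a + x) ^ 2)))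
        has_integral (2 * ((?f 0 + ?f 1) / 2 - (?F 1 - ?F 0)))) {0..1}" by (rule has_integral_mult_right)
    moreover have "((\<lambda>x. 2 * (of_real (x * (1 - x) / 2) * of_real (1 / (a + x) ^ 2))) has_integral (period_term zeta_bump 2 n)) {0..1}"
    proof (rule has_integral_eq[OF _ has_integral_zeta_bump[of n 2]])
      fix x :: real assume "x \<in> {0..1}"
      hence x: "a + x > 0" using a by simp
      have "complex_of_real (a + x) powr (- 2) = of_real ((a + x) powr (- 2))"
        using x by (subst powr_of_real[symmetric]) auto
      also have "(a + x) powr (- 2) = 1 / (a + x) ^ 2"
        using x by (simp add: powr_minus_divide)
      finally show "complex_of_real (zeta_bump x) * of_real (real (Suc n) + x) powr (- 2) =
         2 * (of_real (x * (1 - x) / 2) * of_real (1 / (a + x) ^ 2))"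
        by (simp add: a_def)
    qed
    ultimately have "period_term zeta_bump 2 n = 2 * ((?f 0 + ?f 1) / 2 - (?F 1 - ?F 0))"
      by (rule has_integral_unique[symmetric])
    moreover have "a + 0 = real (Suc n)" "a + 1 = real (Suc (Suc n))" by (simp_all add: a_def)
    ultimately show ?thesis by (simp only: b_def) (simp add: field_simps)
  qed
  \<comment> \<open>The Stirling sequence. Since \<open>A 1 = 1\<close>, the partial sums of
    \<open>b\<close> are 1 - \<open>A (Suc N)\<close>.\<close>
  define A where "A N = ln (fact N) - (real N + 1 / 2) * ln (real N) + real N" for N
  have bA: "b N = A (Suc N) - A (Suc (Suc N))" for N
  proof -
    have "ln (fact (Suc (Suc N))) = ln (real (Suc (Suc N))) + ln (fact (Suc N) :: real)"
      by (subst fact_Suc) (simp add: ln_mult del: fact_Suc)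
    thus ?thesis unfolding b_def A_def by (simp add: field_simps del: fact_Suc)
  qed
  have sm: "(\<Sum>n<N. b n) = 1 - A (Suc N)" for N
    by (induction N) (simp_all add: bA, simp add: A_def)
  have re: "period_sum zeta_bump 2 = of_real (Re (period_sum zeta_bump 2))" "b sums (Re (period_sum zeta_bump 2) / 2)"
  proof -
    have *: "(\<lambda>n. of_real (2 * b n)) sums period_sum zeta_bump 2"
      using period_sum_zeta_bump_sums[of 2] unfolding t_eq[symmetric] by simp
    from sums_Re[OF *] have r: "(\<lambda>n. 2 * b n) sums Re (period_sum zeta_bump 2)" by simp
    from sums_of_real[OF this, where ?'a = complex] * show "period_sum zeta_bump 2 = of_real (Re (period_sum zeta_bump 2))"
      using sums_unique2 by blast
    from sums_divide[OF r, of 2] show "b sums (Re (period_sum zeta_bump 2) / 2)" by simp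
  qed
  have "(\<lambda>N. 1 - A (Suc N)) \<longlonglongrightarrow> Re (period_sum zeta_bump 2) / 2"
    using re(2) unfolding sums_def sm .
  hence "(\<lambda>N. 1 - (1 - A (Suc N))) \<longlonglongrightarrow> 1 - Re (period_sum zeta_bump 2) / 2"
    by (intro tendsto_intros)
  hence "A \<longlonglongrightarrow> 1 - Re (period_sum zeta_bump 2) / 2"
    by (simp add: filterlim_sequentially_Suc)
  from stirling_limit[OF this A_def] have "Re (period_sum zeta_bump 2) = 2 - ln (2 * pi)" by simp
  thus ?thesis using re(1) by simp
qed

text \<open>At 0 the factor s (s + 1) / 2 vanishes with derivative 1/2, so only the value of the
  period sum at 2 enters: -1 + (2 - ln (2 pi)) / 2.\<close>

lemma zeta_deriv_0: "(zeta has_field_derivative - of_real (ln (2 * pi)) / 2) (at 0)"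
proof -
  have "(\<lambda>s. period_sum zeta_bump (s + 2)) holomorphic_on {s. Re s > -1}"
    by (intro holomorphic_intros holomorphic_on_compose_gen[OF _ holomorphic_period_sum[OF continuous_zeta_bump], unfolded o_def]) auto
  from holomorphic_on_imp_differentiable_at[OF this open_halfspace_Re_gt, of 0]
  obtain D where D: "((\<lambda>s. period_sum zeta_bump (s + 2)) has_field_derivative D) (at 0)"
    by (auto simp: field_differentiable_def)
  have 1: "((\<lambda>s::complex. 1 / (s - 1)) has_field_derivative - 1) (at 0)"
    by (auto intro!: derivative_eq_intros)
  have 2: "((\<lambda>s::complex. s * (s + 1) / 2) has_field_derivative 1 / 2) (at 0)"
    by (auto intro!: derivative_eq_intros)
  have "((\<lambda>s. 1 / (s - 1) + 1 / 2 + (s * (s + 1) / 2) * period_sum zeta_bump (s + 2)) has_field_derivative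
      - 1 + 0 + (1 / 2 * period_sum zeta_bump (0 + 2) + D * (0 * (0 + 1) / 2))) (at 0)"
    by (intro DERIV_add DERIV_mult 1 2 D DERIV_const)
  also have "- 1 + 0 + (1 / 2 * period_sum zeta_bump (0 + 2) + D * (0 * (0 + 1) / 2)) = - of_real (ln (2 * pi)) / 2"
    by (simp add: period_sum_zeta_bump_2 diff_divide_distrib)
  finally have "((\<lambda>s. 1 / (s - 1) + 1 / 2 + (s * (s + 1) / 2) * period_sum zeta_bump (s + 2)) has_field_derivative
      - of_real (ln (2 * pi)) / 2) (at 0)" .
  moreover have "eventually (\<lambda>s. s \<in> {s. Re s > -1} - {1}) (nhds 0)"
    by (intro eventually_nhds_in_open open_Diff) (auto simp: open_halfspace_Re_gt)
  hence "eventually (\<lambda>s. zeta s = 1 / (s - 1) + 1 / 2 + (s * (s + 1) / 2) * period_sum zeta_bump (s + 2)) (nhds 0)"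
    by eventually_elim (simp add: zeta_eq_zeta_reg zeta_reg_def field_simps)
  ultimately show ?thesis by (simp add: DERIV_cong_ev[OF refl _ refl])
qed

section \<open>Integrals along vertical lines\<close>

lemma integrable_inverse_1_plus_square: "integrable lborel (\<lambda>x::real. 1 / (1 + x\<^sup>2))"
proof -
  have "set_integrable lborel (einterval (-\<infinity>) \<infinity>) (\<lambda>x. inverse (1 + x\<^sup>2))"
  proof (rule interval_integral_FTC_nonneg(1)[where F = arctan and A = "- (pi / 2)" and B = "pi / 2"])
    show "isCont (\<lambda>x. inverse (1 + x\<^sup>2)) x" for x :: real
      by (intro continuous_intros) (simp add: add_nonneg_eq_0_iff)
  qed (auto intro: DERIV_arctan tendsto_arctan_at_bot tendsto_arctan_at_top simp: ereal_tendsto_simps)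
  thus ?thesis by (simp add: set_integrable_def inverse_eq_divide)
qed

text \<open>Integration is with respect to the imaginary part, without the factor i of dz; residues
  therefore enter with 2 pi instead of 2 pi i.\<close>

definition line_integral :: "real \<Rightarrow> (complex \<Rightarrow> complex) \<Rightarrow> complex" where
  "line_integral c f = (LINT u|lborel. f (Complex c u))"

lemma integrable_quadratic_decay:
  fixes g :: "real \<Rightarrow> complex"
  assumes g: "continuous_on UNIV g" and b: "\<And>u. \<bar>u\<bar> \<ge> R \<Longrightarrow> norm (g u) \<le> K / (1 + u\<^sup>2)"
  shows "integrable lborel g"
proof -
  have "compact ((\<lambda>u. norm (g u) * (1 + u\<^sup>2)) ` {-\<bar>R\<bar>..\<bar>R\<bar>})"
    by (intro compact_continuous_image continuous_intros continuous_on_subset[OF g]) auto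
  then obtain B where "\<forall>x \<in> (\<lambda>u. norm (g u) * (1 + u\<^sup>2)) ` {-\<bar>R\<bar>..\<bar>R\<bar>}. norm x \<le> B"
    using compact_imp_bounded bounded_iff by blast
  hence B: "norm (g u) * (1 + u\<^sup>2) \<le> B" if "u \<in> {-\<bar>R\<bar>..\<bar>R\<bar>}" for u
    using that by fastforce
  have pos: "1 + u\<^sup>2 > 0" for u :: real by (simp add: add_pos_nonneg)
  have "norm (g u) \<le> norm (max B K * (1 / (1 + u\<^sup>2)))" for u
  proof -
    have "norm (g u) * (1 + u\<^sup>2) \<le> max B K"
    proof (cases "\<bar>u\<bar> \<ge> R")
      case True
      with b[OF True] pos[of u] show ?thesis by (simp add: field_simps)
    next
      case False
      hence "u \<in> {-\<bar>R\<bar>..\<bar>R\<bar>}" by auto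
      from B[OF this] show ?thesis by simp
    qed
    hence "norm (g u) \<le> max B K * (1 / (1 + u\<^sup>2))" using pos[of u] by (simp add: field_simps)
    also have "\<dots> \<le> norm (max B K * (1 / (1 + u\<^sup>2)))" unfolding real_norm_def by (rule abs_ge_self)
    finally show ?thesis .
  qed
  moreover have "g \<in> borel_measurable lborel" using borel_measurable_continuous_onI[OF g] by simp
  ultimately show ?thesis
    by (intro Bochner_Integration.integrable_bound[OF integrable_mult_right[OF integrable_inverse_1_plus_square, of "max B K"]]) auto
qed

lemma continuous_on_line:
  assumes "f holomorphic_on A" "\<And>u. Complex c u \<in> A"
  shows "continuous_on UNIV (\<lambda>u. f (Complex c u))"
  by (rule continuous_on_compose2[OF holomorphic_on_imp_continuous_on[OF assms(1)]])
     (use assms(2) in \<open>auto simp: Complex_eq intro!: continuous_intros\<close>)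

text \<open>Links the contour integrals over finite segments, which the residue theorem provides, to
  the Lebesgue integral over the full line.\<close>

lemma tendsto_symmetric_integral:
  fixes g :: "real \<Rightarrow> complex"
  assumes "integrable lborel g"
  shows "(\<lambda>n. integral {- real n..real n} g) \<longlonglongrightarrow> (LINT u|lborel. g u)"
proof -
  have s: "set_integrable lborel {- real n..real n} g" for n
    unfolding set_integrable_def by (rule integrable_mult_indicator[OF _ assms]) simp
  have "(\<lambda>n. LINT u|lborel. indicator {- real n..real n} u *\<^sub>R g u) \<longlonglongrightarrow> (LINT u|lborel. g u)"
  proof (rule integral_dominated_convergence[where w = "\<lambda>u. norm (g u)"])
    show "AE u in lborel. (\<lambda>n. indicator {- real n..real n} u *\<^sub>R g u) \<longlonglongrightarrow> g u"
    proof (intro AE_I2 tendsto_eventually)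
      fix u :: real
      obtain N where "\<bar>u\<bar> \<le> real N" using real_arch_simple by blast
      thus "\<forall>\<^sub>F n in sequentially. indicator {- real n..real n} u *\<^sub>R g u = g u"
        by (intro eventually_sequentiallyI[of N]) (auto simp: indicator_def)
    qed
    show "g \<in> borel_measurable lborel" using assms by (rule borel_measurable_integrable)
    thus "(\<lambda>u. indicator {- real n..real n} u *\<^sub>R g u) \<in> borel_measurable lborel" for n
      by measurable
    show "integrable lborel (\<lambda>u. norm (g u))" using assms by (rule integrable_norm)
    show "AE u in lborel. norm (indicator {- real n..real n} u *\<^sub>R g u) \<le> norm (g u)" for n
      by (intro AE_I2) (simp add: indicator_def)
  qed
  moreover have "(LINT u|lborel. indicator {- real n..real n} u *\<^sub>R g u) = integral {- real n..real n} g" for n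
    using set_borel_integral_eq_integral(2)[OF s, of n] by (simp only: set_lebesgue_integral_def)
  ultimately show ?thesis by (simp only:)
qed

text \<open>The residue theorem on rectangles of heights -n to n. Quadratic decay makes the
  horizontal sides vanish in the limit and the vertical sides integrable; \<open>a'\<close> and
  \<open>b'\<close> provide an open strip around the closed one.\<close>

lemma line_integral_shift:
  assumes ab: "a < b" "a' < a" "b < b'" and S: "finite S" "\<And>p. p \<in> S \<Longrightarrow> a < Re p \<and> Re p < b"
    and hol: "f holomorphic_on {z. a' < Re z \<and> Re z < b'} - S"
    and bound: "\<And>z. a \<le> Re z \<Longrightarrow> Re z \<le> b \<Longrightarrow> \<bar>Im z\<bar> \<ge> R \<Longrightarrow> norm (f z) \<le> K / (1 + (Im z)\<^sup>2)"
  shows "line_integral b f = line_integral a f + 2 * pi * (\<Sum>p\<in>S. residue f p)"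
    and "integrable lborel (\<lambda>u. f (Complex a u))" and "integrable lborel (\<lambda>u. f (Complex b u))"
proof -
  define U where "U = {z. a' < Re z \<and> Re z < b'}"
  have U_eq: "U = {z. Re z > a'} \<inter> {z. Re z < b'}" by (auto simp: U_def)
  have U: "open U" "connected U"
    unfolding U_eq by (auto intro!: open_Int convex_connected convex_Int
        simp: open_halfspace_Re_gt open_halfspace_Re_lt convex_halfspace_Re_gt convex_halfspace_Re_lt)
  have cont: "continuous_on (U - S) f" using hol by (simp add: U_def holomorphic_on_imp_continuous_on)
  show ia: "integrable lborel (\<lambda>u. f (Complex a u))"
  proof (rule integrable_quadratic_decay[where R = R and K = K])
    show "continuous_on UNIV (\<lambda>u. f (Complex a u))"
      by (rule continuous_on_line[OF hol]) (use ab S in fastforce)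
    show "norm (f (Complex a u)) \<le> K / (1 + u\<^sup>2)" if "\<bar>u\<bar> \<ge> R" for u
      using bound[of "Complex a u"] that ab by simp
  qed
  show ib: "integrable lborel (\<lambda>u. f (Complex b u))"
  proof (rule integrable_quadratic_decay[where R = R and K = K])
    show "continuous_on UNIV (\<lambda>u. f (Complex b u))"
      by (rule continuous_on_line[OF hol]) (use ab S in fastforce)
    show "norm (f (Complex b u)) \<le> K / (1 + u\<^sup>2)" if "\<bar>u\<bar> \<ge> R" for u
      using bound[of "Complex b u"] that ab by simp
  qed
  obtain M where M: "\<And>p. p \<in> S \<Longrightarrow> \<bar>Im p\<bar> < M"
  proof -
    have "bounded ((\<lambda>p. Im p) ` S)" using S(1) by (intro finite_imp_bounded) auto
    then obtain B where "\<And>p. p \<in> S \<Longrightarrow> \<bar>Im p\<bar> \<le> B" by (auto simp: bounded_iff)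
    thus ?thesis by (intro that[of "B + 1"]) fastforce
  qed
  \<comment> \<open>The defect of the claimed identity at height n. By the residue theorem it equals
    minus the two horizontal sides as soon as the rectangle contains all poles.\<close>
  define E where "E n = \<i> * integral {- real n..real n} (\<lambda>u. f (Complex b u))
       - \<i> * integral {- real n..real n} (\<lambda>u. f (Complex a u)) - 2 * pi * \<i> * (\<Sum>p\<in>S. residue f p)" for n
  have E_bound: "norm (E n) \<le> 2 * (\<bar>K\<bar> * (b - a)) / (1 + (real n)\<^sup>2)" if n: "real n > max (max R M) 0" for n
  proof -
    define N where "N = real n"
    have N: "N > 0" "N > R" "N > M" using n by (auto simp: N_def)
    define z1 z2 z3 z4 where "z1 = Complex a (-N)" and "z2 = Complex b (-N)" and "z3 = Complex b N" and "z4 = Complex a N"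
    note zs = z1_def z2_def z3_def z4_def
    have box: "cbox z1 z3 \<subseteq> U" using ab by (auto simp: in_cbox_complex_iff U_def zs)
    have Sbox: "p \<in> box z1 z3" if "p \<in> S" for p
      using S(2)[OF that] M[OF that] N by (auto simp: in_box_complex_iff zs)
    have im: "path_image (rectpath z1 z3) \<subseteq> U - S"
    proof -
      have le: "Re z1 \<le> Re z3" "Im z1 \<le> Im z3" using ab N by (auto simp: zs)
      show ?thesis unfolding path_image_rectpath_cbox_minus_box[OF le] using box Sbox by blast
    qed
    have rp: "rectpath z1 z3 = linepath z1 z2 +++ linepath z2 z3 +++ linepath z3 z4 +++ linepath z4 z1"
      by (simp add: rectpath_def Let_def zs)
    have segs: "closed_segment z1 z2 \<subseteq> U - S" "closed_segment z2 z3 \<subseteq> U - S" "closed_segment z3 z4 \<subseteq> U - S" "closed_segment z4 z1 \<subseteq> U - S"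
      using im unfolding rp by (auto simp: path_image_join)
    have ints: "f contour_integrable_on linepath z1 z2" "f contour_integrable_on linepath z2 z3"
       "f contour_integrable_on linepath z3 z4" "f contour_integrable_on linepath z4 z1"
      using segs by (auto intro!: contour_integrable_continuous_linepath continuous_on_subset[OF cont])
    have "contour_integral (rectpath z1 z3) f = 2 * pi * \<i> * (\<Sum>p\<in>S. winding_number (rectpath z1 z3) p * residue f p)"
    proof (rule Residue_theorem[OF U S(1)])
      show "\<forall>z. z \<notin> U \<longrightarrow> winding_number (rectpath z1 z3) z = 0"
        using box ab N by (intro allI impI winding_number_rectpath_outside) (auto simp: zs)
    qed (use hol im in \<open>auto simp: U_def\<close>)
    also have "(\<Sum>p\<in>S. winding_number (rectpath z1 z3) p * residue f p) = (\<Sum>p\<in>S. residue f p)"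
      using Sbox by (intro sum.cong) (auto simp: winding_number_rectpath)
    also have "contour_integral (rectpath z1 z3) f = contour_integral (linepath z1 z2) f + (contour_integral (linepath z2 z3) f
        + (contour_integral (linepath z3 z4) f + contour_integral (linepath z4 z1) f))"
      unfolding rp using ints by (simp add: contour_integrable_joinI)
    also have "contour_integral (linepath z2 z3) f = \<i> * integral {-N..N} (\<lambda>u. f (Complex b u))"
      by (rule contour_integral_linepath_same_Re) (use N in \<open>auto simp: zs\<close>)
    also have "contour_integral (linepath z4 z1) f = - contour_integral (linepath z1 z4) f"
      by (rule contour_integral_reverse_linepath[OF continuous_on_subset[OF cont segs(4)]])
    also have "contour_integral (linepath z1 z4) f = \<i> * integral {-N..N} (\<lambda>u. f (Complex a u))"
      by (rule contour_integral_linepath_same_Re) (use N in \<open>auto simp: zs\<close>)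
    finally have eq: "contour_integral (linepath z1 z2) f + (\<i> * integral {-N..N} (\<lambda>u. f (Complex b u))
        + (contour_integral (linepath z3 z4) f + - (\<i> * integral {-N..N} (\<lambda>u. f (Complex a u)))))
        = 2 * pi * \<i> * (\<Sum>p\<in>S. residue f p)" .
    have "E n = - contour_integral (linepath z1 z2) f - contour_integral (linepath z3 z4) f"
      unfolding E_def N_def[symmetric] eq[symmetric] by simp
    hence "norm (E n) \<le> norm (contour_integral (linepath z1 z2) f) + norm (contour_integral (linepath z3 z4) f)"
      by (metis norm_minus_cancel norm_triangle_ineq4)
    also have "norm (contour_integral (linepath z1 z2) f) \<le> \<bar>K\<bar> / (1 + N\<^sup>2) * norm (z2 - z1)"
    proof (rule contour_integral_bound_linepath[OF ints(1)])
      fix z assume "z \<in> closed_segment z1 z2"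
      hence "Im z = - N" "a \<le> Re z" "Re z \<le> b" using ab by (auto simp: zs closed_segment_same_Im closed_segment_eq_real_ivl)
      with bound[of z] N have "norm (f z) \<le> K / (1 + N\<^sup>2)" by simp
      also have "\<dots> \<le> \<bar>K\<bar> / (1 + N\<^sup>2)" by (intro divide_right_mono) auto
      finally show "norm (f z) \<le> \<bar>K\<bar> / (1 + N\<^sup>2)" .
    qed simp
    also have "norm (contour_integral (linepath z3 z4) f) \<le> \<bar>K\<bar> / (1 + N\<^sup>2) * norm (z4 - z3)"
    proof (rule contour_integral_bound_linepath[OF ints(3)])
      fix z assume "z \<in> closed_segment z3 z4"
      hence "Im z = N" "a \<le> Re z" "Re z \<le> b" using ab by (auto simp: zs closed_segment_same_Im closed_segment_eq_real_ivl)
      with bound[of z] N have "norm (f z) \<le> K / (1 + N\<^sup>2)" by simp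
      also have "\<dots> \<le> \<bar>K\<bar> / (1 + N\<^sup>2)" by (intro divide_right_mono) auto
      finally show "norm (f z) \<le> \<bar>K\<bar> / (1 + N\<^sup>2)" .
    qed simp
    also have "z2 - z1 = of_real (b - a)" by (simp add: zs complex_eq_iff)
    also have "z4 - z3 = - of_real (b - a)" by (simp add: zs complex_eq_iff)
    finally show ?thesis using ab by (simp add: N_def norm_minus_cancel del: of_real_diff)
  qed
  have "E \<longlonglongrightarrow> 0"
  proof (rule Lim_null_comparison)
    show "\<forall>\<^sub>F n in sequentially. norm (E n) \<le> 2 * (\<bar>K\<bar> * (b - a)) / (1 + (real n)\<^sup>2)"
      using eventually_gt_at_top[of "nat \<lceil>max (max R M) 0\<rceil>"]
    proof eventually_elim
      case (elim n)
      hence "real n > max (max R M) 0" by linarith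
      thus ?case by (rule E_bound)
    qed
    have "(\<lambda>n. 1 / (1 + (real n)\<^sup>2)) \<longlonglongrightarrow> 0" by real_asymp
    from tendsto_mult_left[OF this, of "2 * (\<bar>K\<bar> * (b - a))"]
    show "(\<lambda>n. 2 * (\<bar>K\<bar> * (b - a)) / (1 + (real n)\<^sup>2)) \<longlonglongrightarrow> 0" by simp
  qed
  moreover have "E \<longlonglongrightarrow> \<i> * line_integral b f - \<i> * line_integral a f - 2 * pi * \<i> * (\<Sum>p\<in>S. residue f p)"
    unfolding E_def line_integral_def
    by (intro tendsto_intros tendsto_symmetric_integral ia ib)
  ultimately have "\<i> * line_integral b f - \<i> * line_integral a f - 2 * pi * \<i> * (\<Sum>p\<in>S. residue f p) = 0"
    by (rule LIMSEQ_unique[symmetric])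
  hence "\<i> * (line_integral b f - line_integral a f - 2 * pi * (\<Sum>p\<in>S. residue f p)) = 0"
    by (simp add: algebra_simps)
  hence "line_integral b f - line_integral a f - 2 * pi * (\<Sum>p\<in>S. residue f p) = 0"
    by (simp only: mult_eq_0_iff) simp
  thus "line_integral b f = line_integral a f + 2 * pi * (\<Sum>p\<in>S. residue f p)"
    by (simp add: algebra_simps)
qed

text \<open>A majorant of \<open>g\<close> alone suffices: as the dependence on the parameter is
  holomorphic, Cauchy's inequality converts it into a majorant of the derivative and hence of the
  difference quotients.\<close>

lemma has_field_derivative_lebesgue_integral:
  fixes g :: "complex \<Rightarrow> real \<Rightarrow> complex"
  assumes W: "open W" "w \<in> W" and hol: "\<And>u. (\<lambda>w. g w u) holomorphic_on W"
    and meas: "\<And>w. w \<in> W \<Longrightarrow> g w \<in> borel_measurable lborel"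
    and bound: "\<And>w u. w \<in> W \<Longrightarrow> norm (g w u) \<le> h u" and h: "integrable lborel h"
  shows "((\<lambda>w. LINT u|lborel. g w u) has_field_derivative (LINT u|lborel. deriv (\<lambda>w. g w u) w)) (at w)"
proof -
  \<comment> \<open>Twice the radius is kept inside \<open>W\<close>, so that discs of radius
    \<open>r\<close> about points at distance at most \<open>r\<close> from \<open>w\<close> stay in
    \<open>W\<close>.\<close>
  obtain r where r: "r > 0" "cball w (2 * r) \<subseteq> W"
  proof -
    obtain e where "e > 0" "cball w e \<subseteq> W" using W open_contains_cball by blast
    thus ?thesis by (intro that[of "e / 2"]) auto
  qed
  have inW: "x \<in> W" if "norm (x - w) \<le> 2 * r" for x
    using r(2) that by (auto simp: dist_norm norm_minus_commute)
  have int: "integrable lborel (g x)" if "x \<in> W" for x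
  proof (rule Bochner_Integration.integrable_bound[OF h meas[OF that]])
    have "norm (g x u) \<le> norm (h u)" for u
      using bound[OF that, of u] by simp
    thus "AE u in lborel. norm (g x u) \<le> norm (h u)" by simp
  qed
  have deriv_at: "((\<lambda>w. g w u) has_field_derivative deriv (\<lambda>w. g w u) x) (at x)" if "x \<in> W" for x u
    by (rule holomorphic_derivI[OF hol W(1) that])
  have dbound: "norm (deriv (\<lambda>w. g w u) x) \<le> h u / r" if x: "norm (x - w) \<le> r" for x u
  proof -
    have sub: "cball x r \<subseteq> W"
    proof
      fix y assume "y \<in> cball x r"
      hence "norm (y - x) \<le> r" by (simp add: dist_norm norm_minus_commute)
      with x have "norm (y - w) \<le> 2 * r" using norm_triangle_ineq[of "y - x" "x - w"] by simp
      thus "y \<in> W" by (rule inW)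
    qed
    have "norm ((deriv ^^ 1) (\<lambda>w. g w u) x) \<le> fact 1 * h u / r ^ 1"
    proof (rule Cauchy_inequality)
      show "(\<lambda>w. g w u) holomorphic_on ball x r"
        using sub by (intro holomorphic_on_subset[OF hol]) auto
      show "continuous_on (cball x r) (\<lambda>w. g w u)"
        using sub by (intro holomorphic_on_imp_continuous_on holomorphic_on_subset[OF hol]) auto
      show "norm (g y u) \<le> h u" if "norm (x - y) = r" for y
        using sub that by (intro bound) (auto simp: dist_norm subset_iff)
    qed fact
    thus ?thesis by simp
  qed
  have lip: "norm (g x u - g w u) \<le> h u / r * norm (x - w)" if x: "norm (x - w) \<le> r" for x u
  proof (rule field_differentiable_bound[OF convex_cball[of w r], where f' = "deriv (\<lambda>w. g w u)"])
    fix z assume "z \<in> cball w r"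
    hence z: "norm (z - w) \<le> r" by (simp add: dist_norm norm_minus_commute)
    show "norm (deriv (\<lambda>w. g w u) z) \<le> h u / r" by (rule dbound[OF z])
    show "((\<lambda>w. g w u) has_field_derivative deriv (\<lambda>w. g w u) z) (at z within cball w r)"
      using z r by (intro DERIV_subset[OF deriv_at[OF inW]]) auto
  qed (use x r in \<open>auto simp: dist_norm norm_minus_commute\<close>)
  have qlim: "(\<lambda>n. (g (w + X n) u - g w u) / X n) \<longlonglongrightarrow> deriv (\<lambda>w. g w u) w" if "X \<longlonglongrightarrow> 0" "\<And>n. X n \<noteq> 0" for X u
    using deriv_at[OF W(2), of u] that unfolding DERIV_def tendsto_at_iff_sequentially by (auto simp: o_def)
  have key: "(\<lambda>n. (LINT u|lborel. (g (w + X n) u - g w u) / X n)) \<longlonglongrightarrow> (LINT u|lborel. deriv (\<lambda>w. g w u) w)"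
    if X: "X \<longlonglongrightarrow> 0" "\<And>n. X n \<noteq> 0" and Xr: "\<And>n. norm (X n) \<le> r" for X
  proof (rule integral_dominated_convergence[where w = "\<lambda>u. h u / r"])
    have m: "(\<lambda>u. (g (w + X n) u - g w u) / X n) \<in> borel_measurable lborel" for n
      using Xr[of n] r W by (intro borel_measurable_divide borel_measurable_diff meas inW) auto
    thus "(\<lambda>u. (g (w + X n) u - g w u) / X n) \<in> borel_measurable lborel" for n .
    show "(\<lambda>u. deriv (\<lambda>w. g w u) w) \<in> borel_measurable lborel"
      by (rule borel_measurable_LIMSEQ_metric[OF m]) (rule qlim[OF X])
    show "AE u in lborel. (\<lambda>n. (g (w + X n) u - g w u) / X n) \<longlonglongrightarrow> deriv (\<lambda>w. g w u) w"
      by (intro AE_I2 qlim X)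
    show "AE u in lborel. norm ((g (w + X n) u - g w u) / X n) \<le> h u / r" for n
      using lip[of "w + X n"] Xr[of n] X(2)[of n] by (intro AE_I2) (simp add: norm_divide pos_divide_le_eq)
  qed (use h in auto)
  show ?thesis
    unfolding DERIV_def tendsto_at_iff_sequentially o_def
  proof (intro allI impI)
    fix X :: "nat \<Rightarrow> complex" assume nz: "\<forall>i. X i \<in> UNIV - {0}" and X: "X \<longlonglongrightarrow> 0"
    have "\<forall>\<^sub>F n in sequentially. norm (X n) < r"
      using tendstoD[OF X r(1)] by (simp add: dist_norm)
    \<comment> \<open>Dominated convergence was shown for increments of norm at most
      \<open>r\<close>; an arbitrary null sequence obeys this only from \<open>N\<close> on, hence
      the shift.\<close>
    then obtain N where N: "\<And>n. n \<ge> N \<Longrightarrow> norm (X n) < r" by (auto simp: eventually_sequentially)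
    have "(\<lambda>n. (LINT u|lborel. (g (w + X (n + N)) u - g w u) / X (n + N))) \<longlonglongrightarrow> (LINT u|lborel. deriv (\<lambda>w. g w u) w)"
      by (rule key) (use nz N LIMSEQ_ignore_initial_segment[OF X] in \<open>auto intro: less_imp_le\<close>)
    also have "(\<lambda>n. (LINT u|lborel. (g (w + X (n + N)) u - g w u) / X (n + N))) =
       (\<lambda>n. ((LINT u|lborel. g (w + X (n + N)) u) - (LINT u|lborel. g w u)) / X (n + N))"
    proof
      fix n
      have "w + X (n + N) \<in> W" using N[of "n + N"] r by (intro inW) auto
      thus "(LINT u|lborel. (g (w + X (n + N)) u - g w u) / X (n + N)) =
         ((LINT u|lborel. g (w + X (n + N)) u) - (LINT u|lborel. g w u)) / X (n + N)"
        using int W(2) by simp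
    qed
    finally show "(\<lambda>n. ((LINT u|lborel. g (w + X n) u) - (LINT u|lborel. g w u)) / X n) \<longlonglongrightarrow> (LINT u|lborel. deriv (\<lambda>w. g w u) w)"
      by (rule LIMSEQ_offset)
  qed
qed

section \<open>Decay of the Gamma function on vertical strips\<close>

text \<open>In Euler's product every factor (a + k) / |a + k + iy| increases with a.\<close>

lemma norm_Gamma_ratio_le:
  assumes "0 < a" "a \<le> b"
  shows "norm (Gamma (Complex a y)) / Gamma a \<le> norm (Gamma (Complex b y)) / Gamma b"
proof -
  \<comment> \<open>The factorial and the power of n cancel in the quotient, since |n^(c + iy)| =
    n^c; only the product over k is left.\<close>
  have eq: "norm (Gamma_series (Complex c y) n) / Gamma_series c n
      = (\<Prod>k\<in>{0..<n+1}. (c + real k) / norm (Complex (c + real k) y))" if "c > 0" for c n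
  proof -
    have 1: "norm (exp (Complex c y * complex_of_real (ln (real n)))) = exp (c * ln (real n))"
      by (simp add: norm_exp_eq_Re)
    have 2: "norm (pochhammer (Complex c y) (n+1)) = (\<Prod>k\<in>{0..<n+1}. norm (Complex (c + real k) y))"
      unfolding pochhammer_prod prod_norm [symmetric]
      by (intro prod.cong refl) (simp add: complex_eq_iff Complex_eq add_ac)
    have 3: "pochhammer c (n+1) = (\<Prod>k\<in>{0..<n+1}. c + real k)"
      unfolding pochhammer_prod by simp
    have "norm (Gamma_series (Complex c y) n) = fact n * exp (c * ln (real n)) / (\<Prod>k\<in>{0..<n+1}. norm (Complex (c + real k) y))"
      unfolding Gamma_series_def norm_divide norm_mult 1 2 by simp
    moreover have "Gamma_series c n = fact n * exp (c * ln (real n)) / (\<Prod>k\<in>{0..<n+1}. c + real k)"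
      unfolding Gamma_series_def 3 by simp
    ultimately show ?thesis by (simp add: prod_dividef)
  qed
  have lim: "(\<lambda>n. norm (Gamma_series (Complex c y) n) / Gamma_series c n) \<longlonglongrightarrow> norm (Gamma (Complex c y)) / Gamma c"
    if "c > 0" for c
    using Gamma_real_pos[OF that] by (intro tendsto_intros) auto
  show ?thesis
  proof (rule LIMSEQ_le[OF lim lim])
    show "\<exists>N. \<forall>n\<ge>N. norm (Gamma_series (Complex a y) n) / Gamma_series a n \<le> norm (Gamma_series (Complex b y) n) / Gamma_series b n"
    proof (intro exI allI impI)
      fix n
      have step: "u / norm (Complex u y) \<le> v / norm (Complex v y)" if "0 < u" "u \<le> v" for u v
      proof (rule power2_le_imp_le)
        have "u\<^sup>2 * y\<^sup>2 \<le> v\<^sup>2 * y\<^sup>2" using that by (intro mult_right_mono power_mono) auto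
        hence "u\<^sup>2 * (v\<^sup>2 + y\<^sup>2) \<le> v\<^sup>2 * (u\<^sup>2 + y\<^sup>2)" by (simp add: algebra_simps)
        moreover have "u\<^sup>2 + y\<^sup>2 > 0" "v\<^sup>2 + y\<^sup>2 > 0" using that by (auto intro: add_pos_nonneg)
        ultimately have "u\<^sup>2 / (u\<^sup>2 + y\<^sup>2) \<le> v\<^sup>2 / (v\<^sup>2 + y\<^sup>2)" by (simp add: divide_simps mult_ac)
        thus "(u / norm (Complex u y))\<^sup>2 \<le> (v / norm (Complex v y))\<^sup>2"
          by (simp add: power_divide cmod_power2)
      qed (use that in auto)
      have "a > 0" "b > 0" using assms by auto
      thus "norm (Gamma_series (Complex a y) n) / Gamma_series a n \<le> norm (Gamma_series (Complex b y) n) / Gamma_series b n"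
        unfolding eq[OF \<open>a > 0\<close>] eq[OF \<open>b > 0\<close>] using assms
        by (intro prod_mono conjI step) auto
    qed
  qed (use assms in auto)
qed

text \<open>On the imaginary axis conjugation is negation, so the reflection formula for Gamma z
  times Gamma (- z) is a formula for the squared modulus.\<close>

lemma norm_Gamma_imag:
  assumes "y \<noteq> 0"
  shows "(norm (Gamma (Complex 0 y)))\<^sup>2 = pi / (y * sinh (pi * y))"
proof -
  define z where "z = Complex 0 y"
  have z: "z = \<i> * of_real y" by (simp add: z_def complex_eq_iff)
  have "of_real ((norm (Gamma z))\<^sup>2) = Gamma z * cnj (Gamma z)"
    by (rule complex_norm_square)
  also have "cnj (Gamma z) = Gamma (- z)" by (simp add: cnj_Gamma z)
  also have "Gamma z * Gamma (- z) = - of_real pi / (z * sin (of_real pi * z))"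
    by (rule Gamma_reflection_complex')
  also have "of_real pi * z = \<i> * of_real (pi * y)" by (simp add: z)
  also have "sin (\<i> * of_real (pi * y)) = \<i> * of_real (sinh (pi * y))"
    by (simp add: sin_i_times sinh_field_def exp_of_real[symmetric] exp_minus del: of_real_mult)
  also have "- of_real pi / (z * (\<i> * of_real (sinh (pi * y)))) = complex_of_real (pi / (y * sinh (pi * y)))"
    using assms by (simp add: z divide_simps)
  finally show ?thesis unfolding z_def of_real_eq_iff .
qed

lemma norm_Gamma_1_imag:
  assumes "y \<noteq> 0"
  shows "(norm (Gamma (Complex 1 y)))\<^sup>2 = pi * y / sinh (pi * y)"
proof -
  have "Gamma (Complex 0 y + 1) = Complex 0 y * Gamma (Complex 0 y)"
    using assms by (intro Gamma_plus1) (auto simp: nonpos_Ints_def complex_eq_iff)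
  also have "Complex 0 y + 1 = Complex 1 y" by (simp add: complex_eq_iff)
  finally have "(norm (Gamma (Complex 1 y)))\<^sup>2 = y\<^sup>2 * (norm (Gamma (Complex 0 y)))\<^sup>2"
    by (simp add: norm_mult power_mult_distrib cmod_power2)
  also have "\<dots> = pi * y / sinh (pi * y)"
    unfolding norm_Gamma_imag[OF assms] by (simp add: power2_eq_square)
  finally show ?thesis .
qed

lemma divide_sinh_bounds:
  fixes x :: real
  assumes "x > 0"
  shows "x / sinh x \<le> (1 + 2 * x) * exp (- x)" "x / sinh x \<ge> 2 * x * exp (- x)"
proof -
  have s: "sinh x > 0" using assms by simp
  have e: "sinh x = (exp x - exp (- x)) / 2" by (simp add: sinh_field_def)
  have "exp (2 * x) \<ge> 1 + 2 * x" by (rule exp_ge_add_one_self)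
  hence "exp (2 * x) * exp (- x) * exp (- x) \<ge> (1 + 2 * x) * exp (- x) * exp (- x)"
    by (intro mult_right_mono) auto
  moreover have "exp (2 * x) * exp (- x) * exp (- x) = 1" "exp x * exp (- x) = 1"
    by (simp_all flip: exp_add)
  moreover have "(1 + 2 * x) * exp (- x) * sinh x = ((1 + 2 * x) * (exp x * exp (- x)) - (1 + 2 * x) * exp (- x) * exp (- x)) / 2"
    unfolding e by (simp add: field_simps)
  moreover define P where "P = (1 + 2 * x) * exp (- x) * exp (- x)"
  ultimately have P: "P \<le> 1" "(1 + 2 * x) * exp (- x) * sinh x = (1 + 2 * x - P) / 2" by simp_all
  have "x \<le> (1 + 2 * x) * exp (- x) * sinh x" unfolding P(2) using P(1) by simp
  thus "x / sinh x \<le> (1 + 2 * x) * exp (- x)" using s by (simp add: field_simps)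
  have "2 * exp (- x) * sinh x = exp x * exp (- x) - exp (- x) * exp (- x)"
    unfolding e by (simp add: field_simps)
  also have "\<dots> \<le> 1" by (simp add: exp_minus)
  finally have "2 * exp (- x) * sinh x \<le> 1" .
  hence "x * (2 * exp (- x) * sinh x) \<le> x * 1" using assms by (intro mult_left_mono) auto
  thus "x / sinh x \<ge> 2 * x * exp (- x)" using s by (simp add: field_simps)
qed

lemma norm_Gamma_1_abs: "norm (Gamma (Complex 1 \<bar>y\<bar>)) = norm (Gamma (Complex 1 y))"
proof -
  have "norm (Gamma (Complex 1 (-y))) = norm (Gamma (Complex 1 y))"
  proof -
    have "Complex 1 (- y) = cnj (Complex 1 y)" by (simp add: complex_eq_iff)
    thus ?thesis by (simp only: cnj_Gamma[symmetric] complex_mod_cnj)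
  qed
  thus ?thesis by (simp add: abs_if)
qed

text \<open>The squared modulus is at most 1 + 2 pi |y| times an exponential. The number 7 exceeds 2
  pi, and as 1 + 7 |y| is at least 1 it may be replaced by its square, which leaves a bound free of
  roots.\<close>

lemma norm_Gamma_1_upper: "norm (Gamma (Complex 1 y)) \<le> (1 + 7 * \<bar>y\<bar>) * exp (- (pi * \<bar>y\<bar> / 2))"
proof (cases "y = 0")
  case True
  thus ?thesis by (simp flip: one_complex.code)
next
  case False
  show ?thesis
  proof (rule power2_le_imp_le)
    have "(norm (Gamma (Complex 1 y)))\<^sup>2 = pi * \<bar>y\<bar> / sinh (pi * \<bar>y\<bar>)"
      using norm_Gamma_1_imag[of "\<bar>y\<bar>"] False by (simp add: norm_Gamma_1_abs)
    also have "\<dots> \<le> (1 + 2 * (pi * \<bar>y\<bar>)) * exp (- (pi * \<bar>y\<bar>))"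
      using False by (intro divide_sinh_bounds) auto
    also have "1 + 2 * (pi * \<bar>y\<bar>) \<le> 1 + 7 * \<bar>y\<bar>"
      using mult_right_mono[of "2 * pi" 7 "\<bar>y\<bar>"] pi_less_4 pi_approx by (simp add: mult_ac)
    also have "1 + 7 * \<bar>y\<bar> \<le> (1 + 7 * \<bar>y\<bar>)\<^sup>2"
      by (intro self_le_power) auto
    also have "(1 + 7 * \<bar>y\<bar>)\<^sup>2 * exp (- (pi * \<bar>y\<bar>)) = ((1 + 7 * \<bar>y\<bar>) * exp (- (pi * \<bar>y\<bar> / 2)))\<^sup>2"
      by (simp add: power_mult_distrib exp_double[symmetric])
    finally show "(norm (Gamma (Complex 1 y)))\<^sup>2 \<le> ((1 + 7 * \<bar>y\<bar>) * exp (- (pi * \<bar>y\<bar> / 2)))\<^sup>2"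
      by (simp add: mult_right_mono)
  qed simp
qed

lemma norm_Gamma_1_lower:
  assumes "\<bar>y\<bar> \<ge> 1"
  shows "norm (Gamma (Complex 1 y)) \<ge> exp (- (pi * \<bar>y\<bar> / 2))"
proof (rule power2_le_imp_le)
  have "(exp (- (pi * \<bar>y\<bar> / 2)))\<^sup>2 = 1 * exp (- (pi * \<bar>y\<bar>))"
    by (simp add: exp_double[symmetric])
  also have "\<dots> \<le> 2 * (pi * \<bar>y\<bar>) * exp (- (pi * \<bar>y\<bar>))"
  proof (intro mult_right_mono)
    have "1 * 1 \<le> pi * \<bar>y\<bar>" using assms pi_gt3 by (intro mult_mono) auto
    thus "1 \<le> 2 * (pi * \<bar>y\<bar>)" by simp
  qed simp
  also have "\<dots> \<le> pi * \<bar>y\<bar> / sinh (pi * \<bar>y\<bar>)"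
    using assms by (intro divide_sinh_bounds) auto
  also have "\<dots> = (norm (Gamma (Complex 1 y)))\<^sup>2"
    using norm_Gamma_1_imag[of "\<bar>y\<bar>"] assms by (simp add: norm_Gamma_1_abs)
  finally show "(exp (- (pi * \<bar>y\<bar> / 2)))\<^sup>2 \<le> (norm (Gamma (Complex 1 y)))\<^sup>2" .
qed simp

text \<open>Induction by the functional equation from the line Re z = 1. The auxiliary statement
  keeps the final \<open>m\<close> in the base of the power, so that every step multiplies by the
  same factor.\<close>

lemma norm_Gamma_nat_upper:
  "norm (Gamma (Complex (real (Suc m)) y)) \<le> (7 * real (Suc m) * (1 + \<bar>y\<bar>)) ^ Suc m * exp (- (pi * \<bar>y\<bar> / 2))"
proof -
  have aux: "norm (Gamma (Complex (real (Suc j)) y)) \<le> (7 * real (Suc m) * (1 + \<bar>y\<bar>)) ^ Suc j * exp (- (pi * \<bar>y\<bar> / 2))"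
    if "j \<le> m" for j
    using that
  proof (induction j)
    case 0
    have "1 + 7 * \<bar>y\<bar> \<le> 7 * 1 * (1 + \<bar>y\<bar>)" by simp
    also have "\<dots> \<le> 7 * real (Suc m) * (1 + \<bar>y\<bar>)" by (intro mult_right_mono mult_left_mono) auto
    finally have "(1 + 7 * \<bar>y\<bar>) * exp (- (pi * \<bar>y\<bar> / 2)) \<le> 7 * real (Suc m) * (1 + \<bar>y\<bar>) * exp (- (pi * \<bar>y\<bar> / 2))"
      by (rule mult_right_mono) simp
    from order_trans[OF norm_Gamma_1_upper[of y] this] show ?case by simp
  next
    case (Suc j)
    have "Complex (real (Suc j)) y \<notin> \<int>\<^sub>\<le>\<^sub>0"
    proof
      assume "Complex (real (Suc j)) y \<in> \<int>\<^sub>\<le>\<^sub>0"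
      then obtain n where "Complex (real (Suc j)) y = - of_nat n" by (elim nonpos_Ints_cases')
      hence "real (Suc j) = - real n" by (simp add: complex_eq_iff)
      thus False by simp
    qed
    hence "Gamma (Complex (real (Suc j)) y + 1) = Complex (real (Suc j)) y * Gamma (Complex (real (Suc j)) y)"
      by (rule Gamma_plus1)
    also have "Complex (real (Suc j)) y + 1 = Complex (real (Suc (Suc j))) y" by (simp add: complex_eq_iff)
    finally have "norm (Gamma (Complex (real (Suc (Suc j))) y)) = norm (Complex (real (Suc j)) y) * norm (Gamma (Complex (real (Suc j)) y))"
      by (simp add: norm_mult)
    also have "\<dots> \<le> (7 * real (Suc m) * (1 + \<bar>y\<bar>)) * ((7 * real (Suc m) * (1 + \<bar>y\<bar>)) ^ Suc j * exp (- (pi * \<bar>y\<bar> / 2)))"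
    proof (intro mult_mono)
      have "norm (Complex (real (Suc j)) y) \<le> \<bar>real (Suc j)\<bar> + \<bar>y\<bar>"
        using cmod_le[of "Complex (real (Suc j)) y"] by simp
      also have "\<dots> \<le> real (Suc m) * 1 + real (Suc m) * \<bar>y\<bar>"
        using Suc.prems mult_right_mono[of 1 "real (Suc m)" "\<bar>y\<bar>"] by simp
      also have "\<dots> = 1 * (real (Suc m) * (1 + \<bar>y\<bar>))" by (simp add: algebra_simps)
      also have "\<dots> \<le> 7 * (real (Suc m) * (1 + \<bar>y\<bar>))" by (intro mult_right_mono) auto
      finally show "norm (Complex (real (Suc j)) y) \<le> 7 * real (Suc m) * (1 + \<bar>y\<bar>)" by (simp add: mult_ac)
      show "norm (Gamma (Complex (real (Suc j)) y)) \<le> (7 * real (Suc m) * (1 + \<bar>y\<bar>)) ^ Suc j * exp (- (pi * \<bar>y\<bar> / 2))"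
        using Suc by simp
    qed auto
    finally show ?case by (simp add: mult_ac)
  qed
  show ?thesis by (rule aux) simp
qed

text \<open>\<open>norm_Gamma_ratio_le\<close> moves z horizontally to the line Re z = m + 1, which
  lies to the right of the strip and where \<open>norm_Gamma_nat_upper\<close> applies; the real
  Gamma values in the ratio are bounded by compactness.\<close>

lemma norm_Gamma_strip_pos:
  assumes "0 < a"
  obtains C m where "C > 0" "\<And>z. a \<le> Re z \<Longrightarrow> Re z \<le> b \<Longrightarrow> norm (Gamma z) \<le> C * (1 + \<bar>Im z\<bar>) ^ m * exp (- (pi * \<bar>Im z\<bar> / 2))"
proof -
  obtain m :: nat where m: "b \<le> real m" using real_arch_simple by blast
  have "compact (Gamma ` {a..b} :: real set)"
  proof (rule compact_continuous_image[OF _ compact_Icc], rule continuous_on_Gamma)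
    have "x \<le> 0" if "x \<in> \<int>\<^sub>\<le>\<^sub>0" for x :: real using that by (auto elim: nonpos_Ints_cases)
    thus "{a..b} \<inter> \<int>\<^sub>\<le>\<^sub>0 = {}" using assms by fastforce
  qed
  then obtain G where "\<forall>y \<in> Gamma ` {a..b}. norm (y :: real) \<le> G"
    using compact_imp_bounded bounded_iff by blast
  hence G: "\<bar>Gamma x :: real\<bar> \<le> G" if "x \<in> {a..b}" for x using that by fastforce
  define C where "C = (\<bar>G\<bar> + 1) * (7 * real (Suc m)) ^ Suc m / fact m"
  have "norm (Gamma z) \<le> C * (1 + \<bar>Im z\<bar>) ^ Suc m * exp (- (pi * \<bar>Im z\<bar> / 2))" if z: "a \<le> Re z" "Re z \<le> b" for z
  proof -
    define y where "y = Im z"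
    define X where "X = norm (Gamma (Complex (real (Suc m)) y))"
    have pos: "Gamma (Re z) > 0" using z assms by (intro Gamma_real_pos) auto
    have "norm (Gamma (Complex (Re z) y)) / Gamma (Re z) \<le> X / Gamma (real (Suc m))"
      unfolding X_def using z assms m by (intro norm_Gamma_ratio_le) auto
    also have "Gamma (real (Suc m)) = fact m" using Gamma_fact[of m, where ?'a = real] by (simp add: add_ac)
    finally have "norm (Gamma z) \<le> Gamma (Re z) * (X / fact m)"
      using pos by (simp add: y_def field_simps)
    also have "\<dots> \<le> (\<bar>G\<bar> + 1) * (((7 * real (Suc m) * (1 + \<bar>y\<bar>)) ^ Suc m * exp (- (pi * \<bar>y\<bar> / 2))) / fact m)"
    proof (intro mult_mono divide_right_mono)
      show "Gamma (Re z) \<le> \<bar>G\<bar> + 1" using G[of "Re z"] z by auto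
      show "X \<le> (7 * real (Suc m) * (1 + \<bar>y\<bar>)) ^ Suc m * exp (- (pi * \<bar>y\<bar> / 2))"
        unfolding X_def by (rule norm_Gamma_nat_upper)
    qed (auto simp: X_def)
    also have "\<dots> = C * (1 + \<bar>Im z\<bar>) ^ Suc m * exp (- (pi * \<bar>Im z\<bar> / 2))"
      by (simp only: C_def y_def power_mult_distrib) (simp add: mult_ac)
    finally show ?thesis .
  qed
  moreover have "C > 0" unfolding C_def by (intro divide_pos_pos mult_pos_pos zero_less_power) auto
  ultimately show ?thesis using that by blast
qed

lemma Gamma_shift_down:
  assumes "Im z \<noteq> 0"
  shows "Gamma z = Gamma (z + 1) / z"
proof -
  have "z \<notin> \<int>\<^sub>\<le>\<^sub>0" using assms by (auto elim!: nonpos_Ints_cases)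
  from Gamma_plus1[OF this] show ?thesis using assms by auto
qed

text \<open>One step of the recurrence reaches real parts down to -1; |Im z| >= 1 avoids the pole at
  0 and makes the division by z harmless.\<close>

lemma norm_Gamma_strip:
  assumes "-1 < a"
  obtains C m where "C > 0" "\<And>z. a \<le> Re z \<Longrightarrow> Re z \<le> b \<Longrightarrow> \<bar>Im z\<bar> \<ge> 1 \<Longrightarrow> norm (Gamma z) \<le> C * (1 + \<bar>Im z\<bar>) ^ m * exp (- (pi * \<bar>Im z\<bar> / 2))"
proof -
  obtain C m where C: "C > 0" "\<And>z. a + 1 \<le> Re z \<Longrightarrow> Re z \<le> b + 1 \<Longrightarrow> norm (Gamma z) \<le> C * (1 + \<bar>Im z\<bar>) ^ m * exp (- (pi * \<bar>Im z\<bar> / 2))"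
    using norm_Gamma_strip_pos[of "a + 1" "b + 1"] assms by (auto simp: add.commute)
  have "norm (Gamma z) \<le> C * (1 + \<bar>Im z\<bar>) ^ m * exp (- (pi * \<bar>Im z\<bar> / 2))" if z: "a \<le> Re z" "Re z \<le> b" "\<bar>Im z\<bar> \<ge> 1" for z
  proof -
    have "1 \<le> norm z" using z(3) abs_Im_le_cmod[of z] by linarith
    have "norm (Gamma z) = norm (Gamma (z + 1)) / norm z"
      using z(3) by (subst Gamma_shift_down) (auto simp: norm_divide)
    also have "\<dots> \<le> norm (Gamma (z + 1)) / 1"
      using \<open>1 \<le> norm z\<close> by (intro divide_left_mono) auto
    also have "\<dots> \<le> C * (1 + \<bar>Im z\<bar>) ^ m * exp (- (pi * \<bar>Im z\<bar> / 2))"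
      using C(2)[of "z + 1"] z by simp
    finally show ?thesis .
  qed
  with C(1) that show ?thesis by blast
qed

section \<open>Rapid decay and moderate growth on vertical strips\<close>

lemma one_plus_power_le_exp:
  fixes x :: real assumes "x \<ge> 0"
  shows "(1 + x) ^ n \<le> real (Suc n) ^ n * exp x"
proof (cases "n = 0")
  case False
  have "1 + x \<le> real n * (1 + x / real n)" using False assms by (simp add: field_simps)
  also have "\<dots> \<le> real (Suc n) * exp (x / real n)"
    by (intro mult_mono exp_ge_add_one_self) (use assms in auto)
  finally have "(1 + x) ^ n \<le> (real (Suc n) * exp (x / real n)) ^ n"
    using assms by (intro power_mono) auto
  also have "\<dots> = real (Suc n) ^ n * exp x"
    using False by (simp add: power_mult_distrib exp_of_nat_mult[symmetric] del: of_nat_Suc)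
  finally show ?thesis .
qed (use assms in simp)

text \<open>Decay faster than every power, uniform over the strip; \<open>R\<close> leaves out a
  bounded range of heights, where the function may have poles. The class absorbs factors of moderate
  growth, so the decay of the kernels below can be checked factor by factor.\<close>

definition rapid :: "real \<Rightarrow> real \<Rightarrow> (complex \<Rightarrow> complex) \<Rightarrow> bool" where
  "rapid a b f \<longleftrightarrow> (\<forall>n. \<exists>K R. \<forall>z. a \<le> Re z \<longrightarrow> Re z \<le> b \<longrightarrow> R \<le> \<bar>Im z\<bar> \<longrightarrow> norm (f z) * (1 + \<bar>Im z\<bar>) ^ n \<le> K)"

definition moderate :: "real \<Rightarrow> real \<Rightarrow> (complex \<Rightarrow> complex) \<Rightarrow> bool" where
  "moderate a b f \<longleftrightarrow> (\<exists>n K R. \<forall>z. a \<le> Re z \<longrightarrow> Re z \<le> b \<longrightarrow> R \<le> \<bar>Im z\<bar> \<longrightarrow> norm (f z) \<le> K * (1 + \<bar>Im z\<bar>) ^ n)"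

lemma moderateI:
  "(\<And>z. a \<le> Re z \<Longrightarrow> Re z \<le> b \<Longrightarrow> R \<le> \<bar>Im z\<bar> \<Longrightarrow> norm (f z) \<le> K * (1 + \<bar>Im z\<bar>) ^ n) \<Longrightarrow> moderate a b f"
  unfolding moderate_def by blast

lemma rapid_imp_moderate: "rapid a b f \<Longrightarrow> moderate a b f"
  unfolding rapid_def moderate_def by (drule spec[of _ 0], rule exI[of _ 0]) simp

lemma rapid_mult:
  assumes "rapid a b f" "moderate a b g"
  shows "rapid a b (\<lambda>z. f z * g z)"
  unfolding rapid_def
proof
  fix n
  obtain m K1 R1 where 1: "\<And>z. a \<le> Re z \<Longrightarrow> Re z \<le> b \<Longrightarrow> R1 \<le> \<bar>Im z\<bar> \<Longrightarrow> norm (g z) \<le> K1 * (1 + \<bar>Im z\<bar>) ^ m"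
    using assms(2) unfolding moderate_def by blast
  obtain K2 R2 where 2: "\<And>z. a \<le> Re z \<Longrightarrow> Re z \<le> b \<Longrightarrow> R2 \<le> \<bar>Im z\<bar> \<Longrightarrow> norm (f z) * (1 + \<bar>Im z\<bar>) ^ (m + n) \<le> K2"
    using assms(1) unfolding rapid_def by blast
  have F: "norm (f z * g z) * (1 + \<bar>Im z\<bar>) ^ n \<le> K2 * \<bar>K1\<bar>"
    if z: "a \<le> Re z" "Re z \<le> b" "max R1 R2 \<le> \<bar>Im z\<bar>" for z
  proof -
    have "norm (f z * g z) * (1 + \<bar>Im z\<bar>) ^ n \<le> norm (f z) * (K1 * (1 + \<bar>Im z\<bar>) ^ m) * (1 + \<bar>Im z\<bar>) ^ n"
      unfolding norm_mult using z by (intro mult_right_mono mult_left_mono 1) auto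
    also have "\<dots> = (norm (f z) * (1 + \<bar>Im z\<bar>) ^ (m + n)) * K1" by (simp add: power_add)
    also have "\<dots> \<le> (norm (f z) * (1 + \<bar>Im z\<bar>) ^ (m + n)) * \<bar>K1\<bar>" by (intro mult_left_mono) auto
    also have "\<dots> \<le> K2 * \<bar>K1\<bar>" using z by (intro mult_right_mono 2) auto
    finally show ?thesis .
  qed
  show "\<exists>K R. \<forall>z. a \<le> Re z \<longrightarrow> Re z \<le> b \<longrightarrow> R \<le> \<bar>Im z\<bar> \<longrightarrow> norm (f z * g z) * (1 + \<bar>Im z\<bar>) ^ n \<le> K"
    by (rule exI[of _ "K2 * \<bar>K1\<bar>"], rule exI[of _ "max R1 R2"], intro allI impI F)
qed

lemma rapid_mult': "moderate a b f \<Longrightarrow> rapid a b g \<Longrightarrow> rapid a b (\<lambda>z. f z * g z)"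
  using rapid_mult[of a b g f] by (simp add: mult.commute)

lemma rapid_diff:
  assumes "rapid a b f" "rapid a b g"
  shows "rapid a b (\<lambda>z. f z - g z)"
  unfolding rapid_def
proof
  fix n
  obtain K1 R1 where 1: "\<And>z. a \<le> Re z \<Longrightarrow> Re z \<le> b \<Longrightarrow> R1 \<le> \<bar>Im z\<bar> \<Longrightarrow> norm (f z) * (1 + \<bar>Im z\<bar>) ^ n \<le> K1"
    using assms(1) unfolding rapid_def by blast
  obtain K2 R2 where 2: "\<And>z. a \<le> Re z \<Longrightarrow> Re z \<le> b \<Longrightarrow> R2 \<le> \<bar>Im z\<bar> \<Longrightarrow> norm (g z) * (1 + \<bar>Im z\<bar>) ^ n \<le> K2"
    using assms(2) unfolding rapid_def by blast
  have F: "norm (f z - g z) * (1 + \<bar>Im z\<bar>) ^ n \<le> K1 + K2"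
    if z: "a \<le> Re z" "Re z \<le> b" "max R1 R2 \<le> \<bar>Im z\<bar>" for z
  proof -
    have "norm (f z - g z) * (1 + \<bar>Im z\<bar>) ^ n \<le> (norm (f z) + norm (g z)) * (1 + \<bar>Im z\<bar>) ^ n"
      by (intro mult_right_mono norm_triangle_ineq4) auto
    also have "\<dots> \<le> K1 + K2" unfolding ring_distribs using z by (intro add_mono 1 2) auto
    finally show ?thesis .
  qed
  show "\<exists>K R. \<forall>z. a \<le> Re z \<longrightarrow> Re z \<le> b \<longrightarrow> R \<le> \<bar>Im z\<bar> \<longrightarrow> norm (f z - g z) * (1 + \<bar>Im z\<bar>) ^ n \<le> K"
    by (rule exI[of _ "K1 + K2"], rule exI[of _ "max R1 R2"], intro allI impI F)
qed

text \<open>Reflection changes heights by Im s, which costs only a constant because 1 + |x + y| <=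
  (1 + |x|) (1 + |y|).\<close>

lemma moderate_reflect:
  assumes "moderate (Re s - b) (Re s - a) f"
  shows "moderate a b (\<lambda>z. f (s - z))"
proof -
  obtain n K R where 1: "\<And>z. Re s - b \<le> Re z \<Longrightarrow> Re z \<le> Re s - a \<Longrightarrow> R \<le> \<bar>Im z\<bar> \<Longrightarrow> norm (f z) \<le> K * (1 + \<bar>Im z\<bar>) ^ n"
    using assms unfolding moderate_def by blast
  show ?thesis
  proof (rule moderateI[where R = "R + \<bar>Im s\<bar>" and K = "\<bar>K\<bar> * (1 + \<bar>Im s\<bar>) ^ n" and n = n])
    fix z assume z: "a \<le> Re z" "Re z \<le> b" "R + \<bar>Im s\<bar> \<le> \<bar>Im z\<bar>"
    have "norm (f (s - z)) \<le> K * (1 + \<bar>Im (s - z)\<bar>) ^ n" using z by (intro 1) auto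
    also have "\<dots> \<le> \<bar>K\<bar> * ((1 + \<bar>Im s\<bar>) * (1 + \<bar>Im z\<bar>)) ^ n"
    proof (intro mult_mono power_mono)
      have "1 + \<bar>Im (s - z)\<bar> \<le> 1 + \<bar>Im s\<bar> + \<bar>Im z\<bar>"
        using abs_triangle_ineq4[of "Im s" "Im z"] by simp
      also have "\<dots> \<le> (1 + \<bar>Im s\<bar>) * (1 + \<bar>Im z\<bar>)" by (simp add: ring_distribs)
      finally show "1 + \<bar>Im (s - z)\<bar> \<le> (1 + \<bar>Im s\<bar>) * (1 + \<bar>Im z\<bar>)" .
    qed auto
    finally show "norm (f (s - z)) \<le> \<bar>K\<bar> * (1 + \<bar>Im s\<bar>) ^ n * (1 + \<bar>Im z\<bar>) ^ n"
      by (simp add: power_mult_distrib mult_ac)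
  qed
qed

lemma moderate_mult:
  assumes "moderate a b f" "moderate a b g"
  shows "moderate a b (\<lambda>z. f z * g z)"
proof -
  obtain m K1 R1 where 1: "\<And>z. a \<le> Re z \<Longrightarrow> Re z \<le> b \<Longrightarrow> R1 \<le> \<bar>Im z\<bar> \<Longrightarrow> norm (f z) \<le> K1 * (1 + \<bar>Im z\<bar>) ^ m"
    using assms(1) unfolding moderate_def by blast
  obtain n K2 R2 where 2: "\<And>z. a \<le> Re z \<Longrightarrow> Re z \<le> b \<Longrightarrow> R2 \<le> \<bar>Im z\<bar> \<Longrightarrow> norm (g z) \<le> K2 * (1 + \<bar>Im z\<bar>) ^ n"
    using assms(2) unfolding moderate_def by blast
  show ?thesis
  proof (rule moderateI[where R = "max R1 R2" and K = "K1 * K2" and n = "m + n"])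
    fix z assume z: "a \<le> Re z" "Re z \<le> b" "max R1 R2 \<le> \<bar>Im z\<bar>"
    have "norm (f z) \<le> K1 * (1 + \<bar>Im z\<bar>) ^ m" using z by (intro 1) auto
    have "norm (f z * g z) \<le> (K1 * (1 + \<bar>Im z\<bar>) ^ m) * (K2 * (1 + \<bar>Im z\<bar>) ^ n)"
      unfolding norm_mult
      by (rule mult_mono[OF 1 2]) (use z order_trans[OF norm_ge_zero \<open>norm (f z) \<le> _\<close>] in auto)
    thus "norm (f z * g z) \<le> K1 * K2 * (1 + \<bar>Im z\<bar>) ^ (m + n)" by (simp add: power_add mult_ac)
  qed
qed

text \<open>Since pi / 2 > 1, the exponential in \<open>norm_Gamma_strip\<close> is at most exp (-
  |Im z|), which is compensated exactly by the exponential that bounds the polynomial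
  factors.\<close>

lemma rapid_Gamma:
  assumes "-1 < a" shows "rapid a b Gamma"
  unfolding rapid_def
proof
  fix n
  obtain C m where C: "C > 0" "\<And>z. a \<le> Re z \<Longrightarrow> Re z \<le> b \<Longrightarrow> \<bar>Im z\<bar> \<ge> 1 \<Longrightarrow> norm (Gamma z) \<le> C * (1 + \<bar>Im z\<bar>) ^ m * exp (- (pi * \<bar>Im z\<bar> / 2))"
    using norm_Gamma_strip[OF assms, of b] by blast
  have "norm (Gamma z) * (1 + \<bar>Im z\<bar>) ^ n \<le> C * real (Suc (m + n)) ^ (m + n)"
    if z: "a \<le> Re z" "Re z \<le> b" "1 \<le> \<bar>Im z\<bar>" for z
  proof -
    have "norm (Gamma z) * (1 + \<bar>Im z\<bar>) ^ n \<le> C * (1 + \<bar>Im z\<bar>) ^ m * exp (- (pi * \<bar>Im z\<bar> / 2)) * (1 + \<bar>Im z\<bar>) ^ n"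
      using z by (intro mult_right_mono C) auto
    also have "\<dots> = C * exp (- (pi * \<bar>Im z\<bar> / 2)) * (1 + \<bar>Im z\<bar>) ^ (m + n)" by (simp add: power_add)
    also have "\<dots> \<le> C * exp (- \<bar>Im z\<bar>) * (real (Suc (m + n)) ^ (m + n) * exp \<bar>Im z\<bar>)"
    proof (intro mult_mono one_plus_power_le_exp)
      have "1 * \<bar>Im z\<bar> \<le> pi / 2 * \<bar>Im z\<bar>" using pi_gt3 by (intro mult_right_mono) auto
      thus "exp (- (pi * \<bar>Im z\<bar> / 2)) \<le> exp (- \<bar>Im z\<bar>)" by simp
    qed (use C in auto)
    also have "\<dots> = C * real (Suc (m + n)) ^ (m + n)" by (simp add: exp_minus)
    finally show ?thesis .
  qed
  thus "\<exists>K R. \<forall>z. a \<le> Re z \<longrightarrow> Re z \<le> b \<longrightarrow> R \<le> \<bar>Im z\<bar> \<longrightarrow> norm (Gamma z) * (1 + \<bar>Im z\<bar>) ^ n \<le> K" by blast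
qed

lemma rapid_imp_quadratic_decay:
  assumes "rapid a b f"
  obtains K R where "\<And>z. a \<le> Re z \<Longrightarrow> Re z \<le> b \<Longrightarrow> \<bar>Im z\<bar> \<ge> R \<Longrightarrow> norm (f z) \<le> K / (1 + (Im z)\<^sup>2)"
proof -
  obtain K R where K: "\<And>z. a \<le> Re z \<Longrightarrow> Re z \<le> b \<Longrightarrow> R \<le> \<bar>Im z\<bar> \<Longrightarrow> norm (f z) * (1 + \<bar>Im z\<bar>) ^ 2 \<le> K"
    using assms unfolding rapid_def by blast
  have "norm (f z) \<le> K / (1 + (Im z)\<^sup>2)" if z: "a \<le> Re z" "Re z \<le> b" "\<bar>Im z\<bar> \<ge> R" for z
  proof -
    have "1 + (Im z)\<^sup>2 \<le> (1 + \<bar>Im z\<bar>) ^ 2" by (simp add: power2_eq_square algebra_simps)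
    hence "norm (f z) * (1 + (Im z)\<^sup>2) \<le> norm (f z) * (1 + \<bar>Im z\<bar>) ^ 2" by (intro mult_left_mono) auto
    also have "\<dots> \<le> K" using z by (intro K) auto
    finally show ?thesis by (simp add: pos_le_divide_eq add_pos_nonneg)
  qed
  thus ?thesis using that by blast
qed

section \<open>A Mellin-Barnes integral\<close>

lemma not_nonpos_Ints_Re_pos: "Re z > 0 \<Longrightarrow> z \<notin> \<int>\<^sub>\<le>\<^sub>0"
  by (auto elim!: nonpos_Ints_cases)

lemma not_nonpos_Ints_strip:
  assumes "Re z > -1" "z \<noteq> 0"
  shows "z \<notin> \<int>\<^sub>\<le>\<^sub>0"
proof
  assume "z \<in> \<int>\<^sub>\<le>\<^sub>0"
  then obtain n where n: "z = of_int n" "n \<le> 0" by (elim nonpos_Ints_cases)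
  hence "n > -1" using assms(1) by simp
  with n assms(2) show False by simp
qed

lemma nonpos_Ints_Re_gt_D: "z \<in> \<int>\<^sub>\<le>\<^sub>0 \<Longrightarrow> Re z > -1 \<Longrightarrow> z = 0"
  using not_nonpos_Ints_strip by blast

lemma nonpos_Ints_Re_D: "z \<in> \<int>\<^sub>\<le>\<^sub>0 \<Longrightarrow> Re z \<le> 0"
  using not_nonpos_Ints_Re_pos by force

lemma line_integral_shift_rapid:
  assumes "a < b" "a' < a" "b < b'" "finite S" "\<And>p. p \<in> S \<Longrightarrow> a < Re p \<and> Re p < b"
    "f holomorphic_on {z. a' < Re z \<and> Re z < b'} - S" "rapid a b f"
  shows "line_integral b f = line_integral a f + 2 * pi * (\<Sum>p\<in>S. residue f p)"
    and "integrable lborel (\<lambda>u. f (Complex a u))" and "integrable lborel (\<lambda>u. f (Complex b u))"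
proof -
  obtain K R where "\<And>z. a \<le> Re z \<Longrightarrow> Re z \<le> b \<Longrightarrow> \<bar>Im z\<bar> \<ge> R \<Longrightarrow> norm (f z) \<le> K / (1 + (Im z)\<^sup>2)"
    using rapid_imp_quadratic_decay[OF assms(7)] by metis
  note * = line_integral_shift[OF assms(1-6) this]
  show "line_integral b f = line_integral a f + 2 * pi * (\<Sum>p\<in>S. residue f p)"
    "integrable lborel (\<lambda>u. f (Complex a u))" "integrable lborel (\<lambda>u. f (Complex b u))"
    by (rule *; assumption)+
qed

lemma integrable_line_rapid:
  assumes "f holomorphic_on A" "\<And>u. Complex c u \<in> A" "rapid c c f"
  shows "integrable lborel (\<lambda>u. f (Complex c u))"
proof -
  obtain K R where K: "\<And>z. c \<le> Re z \<Longrightarrow> Re z \<le> c \<Longrightarrow> \<bar>Im z\<bar> \<ge> R \<Longrightarrow> norm (f z) \<le> K / (1 + (Im z)\<^sup>2)"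
    using rapid_imp_quadratic_decay[OF assms(3)] by metis
  show ?thesis
    by (rule integrable_quadratic_decay[where R = R and K = K, OF continuous_on_line[OF assms(1,2)]])
       (use K[of "Complex c _"] in simp)
qed

lemma norm_le_Re_Im_bound: "a \<le> Re z \<Longrightarrow> Re z \<le> b \<Longrightarrow> norm z \<le> \<bar>a\<bar> + \<bar>b\<bar> + \<bar>Im z\<bar>"
  using cmod_le[of z] by linarith

lemma moderate_ident: "moderate a b (\<lambda>z. z)"
proof (rule moderateI[where n = 1 and R = 0])
  fix z assume "a \<le> Re z" "Re z \<le> b"
  from norm_le_Re_Im_bound[OF this] have "norm z \<le> \<bar>a\<bar> + \<bar>b\<bar> + \<bar>Im z\<bar>" .
  also have "\<dots> \<le> (\<bar>a\<bar> + \<bar>b\<bar> + 1) * (1 + \<bar>Im z\<bar>) ^ 1" by (simp add: ring_distribs)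
  finally show "norm z \<le> (\<bar>a\<bar> + \<bar>b\<bar> + 1) * (1 + \<bar>Im z\<bar>) ^ 1" .
qed

lemma moderate_const: "moderate a b (\<lambda>z. k)"
  by (rule moderateI[where n = 0 and R = 0 and K = "norm k"]) simp

lemma moderate_exp: "moderate a b (\<lambda>z. exp (- of_real v * z))"
proof (rule moderateI[where n = 0 and R = 0])
  fix z assume z: "a \<le> Re z" "Re z \<le> b"
  have "- v * Re z \<le> \<bar>v\<bar> * (\<bar>a\<bar> + \<bar>b\<bar>)"
  proof -
    have "- v * Re z \<le> \<bar>v\<bar> * \<bar>Re z\<bar>" by (metis abs_ge_self abs_minus_cancel abs_mult)
    also have "\<dots> \<le> \<bar>v\<bar> * (\<bar>a\<bar> + \<bar>b\<bar>)" using z by (intro mult_left_mono) auto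
    finally show ?thesis .
  qed
  thus "norm (exp (- of_real v * z)) \<le> exp (\<bar>v\<bar> * (\<bar>a\<bar> + \<bar>b\<bar>)) * (1 + \<bar>Im z\<bar>) ^ 0"
    by (simp add: norm_exp_eq_Re)
qed

lemma zeta_strip_bound:
  assumes "-1 < a"
  obtains K where "K > 0" "\<And>z. a \<le> Re z \<Longrightarrow> Re z \<le> b \<Longrightarrow> norm (zeta_reg z) \<le> K * (1 + \<bar>Im z\<bar>) ^ 3"
proof -
  obtain C where C: "C > 0" "\<And>s. Re s \<ge> -1 + (a + 1) \<Longrightarrow> norm (zeta_reg s) \<le> C * (1 + norm s) ^ 3"
    using zeta_reg_bound[of "a + 1"] assms by (metis add.commute diff_gt_0_iff_gt diff_minus_eq_add)
  have "norm (zeta_reg z) \<le> C * (1 + \<bar>a\<bar> + \<bar>b\<bar>) ^ 3 * (1 + \<bar>Im z\<bar>) ^ 3" if z: "a \<le> Re z" "Re z \<le> b" for z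
  proof -
    have "norm (zeta_reg z) \<le> C * (1 + norm z) ^ 3" using z by (intro C) auto
    also have "\<dots> \<le> C * ((1 + \<bar>a\<bar> + \<bar>b\<bar>) * (1 + \<bar>Im z\<bar>)) ^ 3"
    proof (intro mult_left_mono power_mono)
      have "1 + norm z \<le> 1 + \<bar>a\<bar> + \<bar>b\<bar> + \<bar>Im z\<bar>" using norm_le_Re_Im_bound[OF z] by simp
      also have "\<dots> \<le> (1 + \<bar>a\<bar> + \<bar>b\<bar>) * (1 + \<bar>Im z\<bar>)" by (simp add: ring_distribs)
      finally show "1 + norm z \<le> (1 + \<bar>a\<bar> + \<bar>b\<bar>) * (1 + \<bar>Im z\<bar>)" .
    qed (use C in auto)
    finally show ?thesis by (simp add: power_mult_distrib mult_ac)
  qed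
  moreover have "C * (1 + \<bar>a\<bar> + \<bar>b\<bar>) ^ 3 > 0" using C by (intro mult_pos_pos zero_less_power) auto
  ultimately show ?thesis using that by blast
qed

lemma moderate_zeta:
  assumes "-1 < a" shows "moderate a b zeta"
proof -
  obtain K where K: "K > 0" "\<And>z. a \<le> Re z \<Longrightarrow> Re z \<le> b \<Longrightarrow> norm (zeta_reg z) \<le> K * (1 + \<bar>Im z\<bar>) ^ 3"
    using zeta_strip_bound[OF assms, of b] by blast
  show ?thesis
  proof (rule moderateI[where n = 3 and R = 1])
    fix z assume z: "a \<le> Re z" "Re z \<le> b" "1 \<le> \<bar>Im z\<bar>"
    have 1: "norm (z - 1) \<ge> 1" using abs_Im_le_cmod[of "z - 1"] z by simp
    hence "z \<noteq> 1" by auto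
    hence "norm (zeta z) = norm (zeta_reg z) / norm (z - 1)"
      using z assms by (simp add: zeta_eq_zeta_reg norm_divide)
    also have "\<dots> \<le> norm (zeta_reg z) / 1" using 1 by (intro divide_left_mono) auto
    also have "\<dots> \<le> K * (1 + \<bar>Im z\<bar>) ^ 3" using K(2)[OF z(1,2)] by simp
    finally show "norm (zeta z) \<le> K * (1 + \<bar>Im z\<bar>) ^ 3" .
  qed
qed

text \<open>To the right of the poles the bound needs no exception near the real axis, as a majorant
  along a whole line requires. The rate pi / 2 exceeds 3/2; half a unit pays for the polynomial and
  the rate 1 remains.\<close>

lemma Gamma_exp_bound:
  assumes "0 < a"
  obtains K where "K > 0" "\<And>z. a \<le> Re z \<Longrightarrow> Re z \<le> b \<Longrightarrow> norm (Gamma z) \<le> K * exp (- \<bar>Im z\<bar>)"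
proof -
  obtain C m where C: "C > 0" "\<And>z. a \<le> Re z \<Longrightarrow> Re z \<le> b \<Longrightarrow> norm (Gamma z) \<le> C * (1 + \<bar>Im z\<bar>) ^ m * exp (- (pi * \<bar>Im z\<bar> / 2))"
    using norm_Gamma_strip_pos[OF assms, of b] by blast
  define K where "K = C * (2 ^ m * real (Suc m) ^ m)"
  have "norm (Gamma z) \<le> K * exp (- \<bar>Im z\<bar>)" if z: "a \<le> Re z" "Re z \<le> b" for z
  proof -
    define y where "y = \<bar>Im z\<bar>"
    have y: "y \<ge> 0" by (simp add: y_def)
    have "(1 + y) ^ m \<le> (2 * (1 + y / 2)) ^ m" using y by (intro power_mono) auto
    also have "\<dots> \<le> 2 ^ m * (real (Suc m) ^ m * exp (y / 2))"
      unfolding power_mult_distrib using y by (intro mult_left_mono one_plus_power_le_exp) auto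
    finally have 1: "(1 + y) ^ m \<le> 2 ^ m * (real (Suc m) ^ m * exp (y / 2))" .
    have "3 * y \<le> pi * y" using y pi_gt3 by (intro mult_right_mono) auto
    hence 2: "exp (- (pi * y / 2)) \<le> exp (- (3 * y / 2))" by simp
    have "norm (Gamma z) \<le> C * (1 + y) ^ m * exp (- (pi * y / 2))" using C(2)[OF z] by (simp add: y_def)
    also have "\<dots> \<le> C * (2 ^ m * (real (Suc m) ^ m * exp (y / 2))) * exp (- (3 * y / 2))"
      using C(1) y by (intro mult_mono mult_left_mono 1 2) auto
    also have "\<dots> = K * (exp (y / 2) * exp (- (3 * y / 2)))" by (simp add: K_def)
    also have "exp (y / 2) * exp (- (3 * y / 2)) = exp (- y)" by (simp add: exp_add[symmetric])
    finally show ?thesis by (simp add: y_def)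
  qed
  moreover have "K > 0" using C by (simp add: K_def)
  ultimately show ?thesis using that by blast
qed

lemma exp_half_le_quadratic: "exp (- \<bar>u\<bar> / 2) \<le> 36 * (1 / (1 + u\<^sup>2))" for u :: real
proof -
  have "1 + u\<^sup>2 \<le> 4 * (1 + \<bar>u\<bar> / 2) ^ 2" by (simp add: power2_eq_square algebra_simps)
  also have "(1 + \<bar>u\<bar> / 2) ^ 2 \<le> real (Suc 2) ^ 2 * exp (\<bar>u\<bar> / 2)" by (rule one_plus_power_le_exp) simp
  finally have "(1 + u\<^sup>2) * exp (- \<bar>u\<bar> / 2) \<le> 36 * exp (\<bar>u\<bar> / 2) * exp (- \<bar>u\<bar> / 2)"
    by (intro mult_right_mono) auto
  also have "\<dots> = 36" by (simp add: exp_minus)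
  finally show ?thesis by (simp add: pos_le_divide_eq add_pos_nonneg mult_ac)
qed

lemma residue_Gamma_0:
  assumes "open A" "0 \<in> A" "h holomorphic_on A"
  shows "residue (\<lambda>z. Gamma z * h z) 0 = h 0"
proof (rule residue_simple')
  let ?B = "A \<inter> {z. Re z > -1}"
  show "open ?B" using assms(1) by (intro open_Int open_halfspace_Re_gt)
  show "0 \<in> ?B" using assms(2) by simp
  show "(\<lambda>z. Gamma z * h z) holomorphic_on ?B - {0}"
    using not_nonpos_Ints_strip by (intro holomorphic_intros holomorphic_on_subset[OF assms(3)]) auto
  have "h \<midarrow>0\<rightarrow> h 0"
    using holomorphic_on_imp_continuous_on[OF assms(3)] assms(1,2) by (simp add: continuous_on_eq_continuous_at isCont_def)
  moreover have "(\<lambda>z::complex. Gamma z * z) \<midarrow>0\<rightarrow> 1" using Gamma_residues[of 0, where ?'a = complex] by simp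
  ultimately have "(\<lambda>z. (Gamma z * z) * h z) \<midarrow>0\<rightarrow> 1 * h 0" by (intro tendsto_mult)
  thus "(\<lambda>w. Gamma w * h w * (w - 0)) \<midarrow>0\<rightarrow> h 0" by (simp add: mult_ac)
qed

text \<open>The parameter v is the logarithm of the usual variable x, so that x^(-z) = exp (- v z).\<close>

definition mellin_barnes :: "complex \<Rightarrow> complex \<Rightarrow> complex \<Rightarrow> complex" where
  "mellin_barnes s v z = Gamma z * Gamma (s - z) * exp (- v * z)"

lemma holomorphic_mellin_barnes: "mellin_barnes s v holomorphic_on {z. -1 < Re z \<and> Re z < Re s} - {0}"
  unfolding mellin_barnes_def
  by (intro holomorphic_intros) (auto dest: nonpos_Ints_Re_gt_D nonpos_Ints_Re_D)

lemma rapid_mellin_barnes: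
  assumes "-1 < a" "b < Re s"
  shows "rapid a b (mellin_barnes s (of_real v))"
proof -
  have "rapid a b (\<lambda>z. Gamma z * Gamma (s - z) * exp (- of_real v * z))"
    by (rule rapid_mult[OF rapid_mult[OF rapid_Gamma moderate_reflect[OF rapid_imp_moderate[OF rapid_Gamma]]] moderate_exp])
       (use assms in auto)
  thus ?thesis by (simp add: mellin_barnes_def[abs_def])
qed

text \<open>The parameter is made complex so that the differentiation under the integral for
  holomorphic families applies.\<close>

lemma mellin_barnes_deriv:
  assumes c: "0 < c" "c < Re s"
  shows "((\<lambda>w. line_integral c (mellin_barnes s w)) has_field_derivative
      - line_integral c (\<lambda>z. z * mellin_barnes s (of_real v) z)) (at (of_real v))"
proof -
  \<comment> \<open>For |Im w| < 1/2 the factor exp (- w z) grows at most like exp (|u| / 2) along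
    the line, while the first Gamma factor alone decays like exp (- |u|).\<close>
  define W where "W = {w. Im w > - 1 / 2} \<inter> {w. Im w < 1 / 2} \<inter> ball 0 (\<bar>v\<bar> + 1)"
  obtain K1 where K1: "K1 > 0" "\<And>z. c \<le> Re z \<Longrightarrow> Re z \<le> c \<Longrightarrow> norm (Gamma z) \<le> K1 * exp (- \<bar>Im z\<bar>)"
    using Gamma_exp_bound[of c c] c by blast
  obtain K2 where K2: "K2 > 0" "\<And>z. Re s - c \<le> Re z \<Longrightarrow> Re z \<le> Re s - c \<Longrightarrow> norm (Gamma z) \<le> K2 * exp (- \<bar>Im z\<bar>)"
    using Gamma_exp_bound[of "Re s - c" "Re s - c"] c by auto
  define K where "K = K1 * K2 * exp (c * (\<bar>v\<bar> + 1))"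
  have K: "K > 0" using K1 K2 by (simp add: K_def)
  have "((\<lambda>w. LINT u|lborel. mellin_barnes s w (Complex c u)) has_field_derivative
      (LINT u|lborel. deriv (\<lambda>w. mellin_barnes s w (Complex c u)) (of_real v))) (at (of_real v))"
  proof (rule has_field_derivative_lebesgue_integral[where W = W and h = "\<lambda>u. (K * 36) * (1 / (1 + u\<^sup>2))"])
    show "open W" unfolding W_def by (intro open_Int open_halfspace_Im_gt open_halfspace_Im_lt open_ball)
    show "of_real v \<in> W" by (simp add: W_def)
    show "(\<lambda>w. mellin_barnes s w (Complex c u)) holomorphic_on W" for u
      unfolding mellin_barnes_def by (intro holomorphic_intros)
    show "(\<lambda>u. mellin_barnes s w (Complex c u)) \<in> borel_measurable lborel" for w
    proof -
      have "continuous_on UNIV (\<lambda>u. mellin_barnes s w (Complex c u))"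
        by (rule continuous_on_line[OF holomorphic_mellin_barnes]) (use c in \<open>auto simp: complex_eq_iff\<close>)
      from borel_measurable_continuous_onI[OF this] show ?thesis by simp
    qed
    show "integrable lborel (\<lambda>u::real. (K * 36) * (1 / (1 + u\<^sup>2)))"
      by (rule integrable_mult_right[OF integrable_inverse_1_plus_square])
  next
    fix w u assume w: "w \<in> W"
    have 1: "norm (Gamma (Complex c u)) \<le> K1 * exp (- \<bar>u\<bar>)" using K1(2)[of "Complex c u"] by simp
    have 2: "norm (Gamma (s - Complex c u)) \<le> K2 * 1"
    proof -
      have "norm (Gamma (s - Complex c u)) \<le> K2 * exp (- \<bar>Im s - u\<bar>)" using K2(2)[of "s - Complex c u"] by simp
      also have "\<dots> \<le> K2 * 1" using K2(1) by (intro mult_left_mono) auto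
      finally show ?thesis .
    qed
    have 3: "norm (exp (- w * Complex c u)) \<le> exp (c * (\<bar>v\<bar> + 1)) * exp (\<bar>u\<bar> / 2)"
    proof -
      have w': "norm w < \<bar>v\<bar> + 1" "\<bar>Im w\<bar> < 1 / 2" using w by (auto simp: W_def)
      have "- Re w * c \<le> (\<bar>v\<bar> + 1) * c" using abs_Re_le_cmod[of w] w' c by (intro mult_right_mono) auto
      moreover have "Im w * u \<le> \<bar>Im w\<bar> * \<bar>u\<bar>" by (metis abs_ge_self abs_mult)
      moreover have "\<bar>Im w\<bar> * \<bar>u\<bar> \<le> 1 / 2 * \<bar>u\<bar>" using w' by (intro mult_right_mono) auto
      ultimately have "- Re w * c + Im w * u \<le> c * (\<bar>v\<bar> + 1) + \<bar>u\<bar> / 2" by (simp add: mult.commute)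
      thus ?thesis by (simp add: norm_exp_eq_Re exp_add[symmetric])
    qed
    have "norm (mellin_barnes s w (Complex c u)) \<le> (K1 * exp (- \<bar>u\<bar>)) * (K2 * 1) * (exp (c * (\<bar>v\<bar> + 1)) * exp (\<bar>u\<bar> / 2))"
      unfolding mellin_barnes_def norm_mult using K1 K2 by (intro mult_mono 1 2 3) auto
    also have "\<dots> = K * (exp (- \<bar>u\<bar>) * exp (\<bar>u\<bar> / 2))" by (simp add: K_def)
    also have "exp (- \<bar>u\<bar>) * exp (\<bar>u\<bar> / 2) = exp (- \<bar>u\<bar> / 2)" by (simp add: exp_add[symmetric])
    also have "K * exp (- \<bar>u\<bar> / 2) \<le> K * (36 * (1 / (1 + u\<^sup>2)))"
      using K by (intro mult_left_mono exp_half_le_quadratic) auto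
    finally show "norm (mellin_barnes s w (Complex c u)) \<le> (K * 36) * (1 / (1 + u\<^sup>2))" by simp
  qed
  also have "(LINT u|lborel. deriv (\<lambda>w. mellin_barnes s w (Complex c u)) (of_real v)) =
      (LINT u|lborel. - (Complex c u * mellin_barnes s (of_real v) (Complex c u)))"
  proof (rule Bochner_Integration.integral_cong[OF refl])
    fix u
    have "((\<lambda>w. mellin_barnes s w (Complex c u)) has_field_derivative
       Gamma (Complex c u) * Gamma (s - Complex c u) * (exp (- of_real v * Complex c u) * (- Complex c u))) (at (of_real v))"
      unfolding mellin_barnes_def by (intro DERIV_cmult DERIV_fun_exp) (auto intro!: derivative_eq_intros)
    from DERIV_imp_deriv[OF this] show "deriv (\<lambda>w. mellin_barnes s w (Complex c u)) (of_real v) = - (Complex c u * mellin_barnes s (of_real v) (Complex c u))"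
      by (simp add: mellin_barnes_def)
  qed
  finally show ?thesis by (simp add: line_integral_def)
qed

text \<open>
  The functional equation of \<Gamma> and a shift of the line by 1 yield a differential equation in v which
  says that (1 + exp v)^s times the integral is constant. The constant comes from the residue at
  z = 0, as v tends to -\<infinity>.
\<close>

lemma mellin_barnes_integral:
  fixes s :: complex
  assumes c: "0 < c" "c < Re s"
  shows "line_integral c (mellin_barnes s (of_real v)) = 2 * pi * Gamma s * of_real (1 + exp v) powr (- s)"
proof -
  define G where "G w = line_integral c (mellin_barnes s w)" for w
  have Gs: "Gamma (s - z + 1) = (s - z) * Gamma (s - z)" if "Re z < Re s" for z
  proof -
    have "Re (s - z) > 0" using that by simp
    thus ?thesis by (intro Gamma_plus1 not_nonpos_Ints_Re_pos)
  qed
  \<comment> \<open>The factor z is absorbed into Gamma (z + 1), and the line is moved back from c +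
    1 to c without crossing a pole. Then Gamma (s + 1 - z) = (s - z) Gamma (s - z) returns the same
    two integrals.\<close>
  have ode: "line_integral c (\<lambda>z. z * mellin_barnes s (of_real v) z) * (1 + exp (of_real v)) = s * exp (of_real v) * G (of_real v)" for v
  proof -
    define Q where "Q = line_integral c (\<lambda>z. z * mellin_barnes s (of_real v) z)"
    have sh: "z * mellin_barnes s (of_real v) z = exp (of_real v) * mellin_barnes (s + 1) (of_real v) (z + 1)" if "Re z > 0" for z
    proof -
      have "Gamma (z + 1) = z * Gamma z" using that by (intro Gamma_plus1 not_nonpos_Ints_Re_pos)
      moreover have "exp (of_real v) * exp (- of_real v * (z + 1)) = exp (- of_real v * z)"
        by (simp add: exp_add[symmetric] algebra_simps)
      moreover have "s + 1 - (z + 1) = s - z" by simp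
      ultimately show ?thesis by (simp add: mellin_barnes_def mult_ac)
    qed
    have "Q = line_integral c (\<lambda>z. exp (of_real v) * mellin_barnes (s + 1) (of_real v) (z + 1))"
      unfolding Q_def line_integral_def using c by (intro Bochner_Integration.integral_cong refl sh) simp
    also have "\<dots> = exp (of_real v) * line_integral (c + 1) (mellin_barnes (s + 1) (of_real v))"
    proof -
      have "Complex c u + 1 = Complex (c + 1) u" for u by (simp add: complex_eq_iff)
      thus ?thesis by (simp add: line_integral_def)
    qed
    also have "line_integral (c + 1) (mellin_barnes (s + 1) (of_real v)) = line_integral c (mellin_barnes (s + 1) (of_real v))"
    proof -
      have "line_integral (c + 1) (mellin_barnes (s + 1) (of_real v)) = line_integral c (mellin_barnes (s + 1) (of_real v))
          + 2 * pi * (\<Sum>p\<in>{}. residue (mellin_barnes (s + 1) (of_real v)) p)"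
      proof (rule line_integral_shift_rapid(1)[where a' = 0 and b' = "Re s + 1"])
        show "mellin_barnes (s + 1) (of_real v) holomorphic_on {z. 0 < Re z \<and> Re z < Re s + 1} - {}"
          by (rule holomorphic_on_subset[OF holomorphic_mellin_barnes]) auto
      qed (use c in \<open>auto intro: rapid_mellin_barnes\<close>)
      thus ?thesis by simp
    qed
    also have "line_integral c (mellin_barnes (s + 1) (of_real v)) = s * G (of_real v) - Q"
    proof -
      have i1: "integrable lborel (\<lambda>u. mellin_barnes s (of_real v) (Complex c u))"
        by (rule integrable_line_rapid[OF holomorphic_mellin_barnes])
           (use c in \<open>auto simp: complex_eq_iff intro: rapid_mellin_barnes\<close>)
      have i2: "integrable lborel (\<lambda>u. Complex c u * mellin_barnes s (of_real v) (Complex c u))"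
        by (rule integrable_line_rapid[of "\<lambda>z. z * mellin_barnes s (of_real v) z", OF holomorphic_on_mult[OF holomorphic_on_ident holomorphic_mellin_barnes]])
           (use c in \<open>auto simp: complex_eq_iff intro!: rapid_mult' moderate_ident rapid_mellin_barnes\<close>)
      have "line_integral c (mellin_barnes (s + 1) (of_real v)) =
         (LINT u|lborel. s * mellin_barnes s (of_real v) (Complex c u) - Complex c u * mellin_barnes s (of_real v) (Complex c u))"
        unfolding line_integral_def
      proof (rule Bochner_Integration.integral_cong[OF refl])
        fix u
        have e1: "s + 1 - Complex c u = s - Complex c u + 1" by simp
        have e2: "Gamma (s - Complex c u + 1) = (s - Complex c u) * Gamma (s - Complex c u)"
          using c by (intro Gs) simp
        show "mellin_barnes (s + 1) (of_real v) (Complex c u) = s * mellin_barnes s (of_real v) (Complex c u) - Complex c u * mellin_barnes s (of_real v) (Complex c u)"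
          unfolding mellin_barnes_def e1 e2 by (simp add: algebra_simps)
      qed
      also have "\<dots> = s * G (of_real v) - Q"
        unfolding G_def Q_def line_integral_def using i1 i2 by simp
      finally show ?thesis .
    qed
    finally have "Q = exp (of_real v) * (s * G (of_real v) - Q)" .
    hence "Q * (1 + exp (of_real v)) = s * exp (of_real v) * G (of_real v)" by (simp add: algebra_simps)
    thus ?thesis by (simp only: Q_def)
  qed
  define \<phi> where "\<phi> w = G w * (1 + exp w) powr s" for w
  have zero: "(\<phi> has_field_derivative 0) (at (of_real v))" for v
  proof -
    define e where "e = complex_of_real (exp v)"
    have e: "exp (of_real v) = e" by (simp add: e_def exp_of_real)
    have "1 + e = complex_of_real (1 + exp v)" by (simp add: e_def)
    also have "\<dots> \<notin> \<real>\<^sub>\<le>\<^sub>0" unfolding nonpos_Reals_of_real_iff using exp_gt_zero[of v] by linarith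
    finally have ne: "1 + e \<notin> \<real>\<^sub>\<le>\<^sub>0" .
    hence nz: "1 + e \<noteq> 0" by auto
    have d1: "((\<lambda>w. (1 + exp w) powr s) has_field_derivative (s * (1 + e) powr (s - 1) * e)) (at (of_real v))"
    proof (rule DERIV_chain2[of "\<lambda>x. x powr s"])
      show "((\<lambda>x. x powr s) has_field_derivative s * (1 + e) powr (s - 1)) (at (1 + exp (of_real v)))"
        unfolding e by (rule has_field_derivative_powr[OF ne])
      show "((\<lambda>w. 1 + exp w) has_field_derivative e) (at (of_real v))"
        by (auto intro!: derivative_eq_intros simp: e)
    qed
    define Q where "Q = line_integral c (\<lambda>z. z * mellin_barnes s (of_real v) z)"
    have d2: "(G has_field_derivative - Q) (at (of_real v))"
      unfolding G_def Q_def by (rule mellin_barnes_deriv[OF c])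
    have "(\<phi> has_field_derivative - Q * (1 + exp (of_real v)) powr s + s * (1 + e) powr (s - 1) * e * G (of_real v)) (at (of_real v))"
      unfolding \<phi>_def by (rule DERIV_mult[OF d2 d1])
    also have "(1 + exp (of_real v)) powr s = (1 + e) powr (s - 1) * (1 + e)"
      using nz unfolding e by (simp add: powr_diff)
    also have "- Q * ((1 + e) powr (s - 1) * (1 + e)) + s * (1 + e) powr (s - 1) * e * G (of_real v)
       = (1 + e) powr (s - 1) * (s * e * G (of_real v) - Q * (1 + e))" by (simp add: algebra_simps)
    also have "\<dots> = 0" using ode[of v] unfolding e Q_def[symmetric] by simp
    finally show ?thesis .
  qed
  have "\<exists>k. \<forall>v. \<phi> (of_real v) = k"
  proof -
    have "((\<lambda>v. \<phi> (of_real v)) has_vector_derivative 0) (at v within UNIV)" for v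
      by (rule has_vector_derivative_real_field[OF zero])
    hence "((\<lambda>v. \<phi> (of_real v)) has_derivative (\<lambda>_. 0)) (at v within UNIV)" for v
      by (simp add: has_vector_derivative_def)
    thus ?thesis using has_derivative_zero_constant[of UNIV "\<lambda>v. \<phi> (of_real v)"] by simp
  qed
  then obtain k where k: "\<And>v. \<phi> (of_real v) = k" by blast
  \<comment> \<open>On Re z = -1/2 the factor exp (- v z) has modulus exp (v / 2), so the integral
    over that line vanishes as v tends to -\<infinity>.\<close>
  define B where "B = (LINT u|lborel. norm (mellin_barnes s 0 (Complex (-1/2) u)))"
  have s0: "Re s > 0" using c by simp
  have G_bound: "norm (G (of_real v) - 2 * pi * Gamma s) \<le> exp (v / 2) * B" for v
  proof -
    have sh: "line_integral c (mellin_barnes s (of_real v)) = line_integral (-1/2) (mellin_barnes s (of_real v))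
       + 2 * pi * (\<Sum>p\<in>{0}. residue (mellin_barnes s (of_real v)) p)" for v
    proof (rule line_integral_shift_rapid(1)[where a' = "-1" and b' = "Re s"])
    qed (use c in \<open>auto intro!: rapid_mellin_barnes holomorphic_mellin_barnes\<close>)
    have "residue (mellin_barnes s (of_real v)) 0 = Gamma (s - 0) * exp (- of_real v * 0)"
      unfolding mellin_barnes_def mult.assoc
    proof (rule residue_Gamma_0[where A = "{z. Re z < Re s}"])
      show "open {z. Re z < Re s}" by (rule open_halfspace_Re_lt)
      show "(\<lambda>z. Gamma (s - z) * exp (- of_real v * z)) holomorphic_on {z. Re z < Re s}"
        by (intro holomorphic_intros) (auto dest: nonpos_Ints_Re_D)
    qed (use s0 in auto)
    hence "G (of_real v) - 2 * pi * Gamma s = line_integral (-1/2) (mellin_barnes s (of_real v))"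
      using sh[of v] by (simp add: G_def)
    also have "norm \<dots> \<le> (LINT u|lborel. norm (mellin_barnes s (of_real v) (Complex (-1/2) u)))"
      unfolding line_integral_def by (rule integral_norm_bound)
    also have "\<dots> = (LINT u|lborel. exp (v / 2) * norm (mellin_barnes s 0 (Complex (-1/2) u)))"
      by (intro Bochner_Integration.integral_cong refl) (simp add: mellin_barnes_def norm_mult norm_exp_eq_Re)
    also have "\<dots> = exp (v / 2) * B" by (simp add: B_def)
    finally show ?thesis .
  qed
  have G_lim: "((\<lambda>v. G (of_real v)) \<longlongrightarrow> 2 * pi * Gamma s) at_bot"
  proof (rule Lim_transform[OF tendsto_const Lim_null_comparison])
    show "\<forall>\<^sub>F v in at_bot. norm (G (of_real v) - 2 * pi * Gamma s) \<le> exp (v / 2) * B" using G_bound by simp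
    have "((\<lambda>v::real. exp (v / 2)) \<longlongrightarrow> 0) at_bot" by real_asymp
    from tendsto_mult_left_zero[OF this] show "((\<lambda>v. exp (v / 2) * B) \<longlongrightarrow> 0) at_bot" .
  qed
  have "((\<lambda>v. G (of_real v) * of_real (1 + exp v) powr s) \<longlongrightarrow> 2 * pi * Gamma s * of_real (1 + 0) powr s) at_bot"
    by (intro tendsto_intros G_lim exp_at_bot) auto
  moreover have "(\<lambda>v. G (of_real v) * of_real (1 + exp v) powr s) = (\<lambda>v. k)"
    using k by (simp add: \<phi>_def exp_of_real)
  ultimately have "k = 2 * pi * Gamma s" by (simp add: tendsto_const_iff)
  moreover have "G (of_real v) * of_real (1 + exp v) powr s = k" using k[of v] by (simp add: \<phi>_def exp_of_real)
  moreover have "complex_of_real (1 + exp v) \<noteq> 0" unfolding of_real_eq_0_iff using exp_gt_zero[of v] by linarith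
  ultimately show ?thesis unfolding G_def[symmetric]
    by (simp add: powr_minus divide_simps)
qed

section \<open>The mean square of zeta for large real part\<close>

text \<open>The factors \<open>p i\<close> have summable uniform bounds, so multiples of the
  integrable \<open>H\<close> dominate. In this form a Dirichlet series is interchanged with an
  integral along a line.\<close>

lemma sums_integral_mult:
  fixes H :: "real \<Rightarrow> complex" and p :: "nat \<Rightarrow> real \<Rightarrow> complex"
  assumes H: "integrable lborel H" and p: "\<And>i. p i \<in> borel_measurable lborel"
    and b: "\<And>i u. norm (p i u) \<le> b i" "summable b" and q: "\<And>u. (\<lambda>i. p i u) sums q u"
  shows "(\<lambda>i. LINT u|lborel. H u * p i u) sums (LINT u|lborel. H u * q u)"
proof -
  have meas: "(\<lambda>u. H u * p i u) \<in> borel_measurable lborel" for i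
    using borel_measurable_integrable[OF H] p by (intro borel_measurable_times)
  have le: "norm (H u * p i u) \<le> norm (H u) * b i" for i u
    unfolding norm_mult by (intro mult_left_mono b) auto
  have int: "integrable lborel (\<lambda>u. H u * p i u)" for i
  proof (rule Bochner_Integration.integrable_bound[OF integrable_mult_left[OF integrable_norm[OF H], of "b i"] meas])
    show "AE u in lborel. norm (H u * p i u) \<le> norm (norm (H u) * b i)"
      by (intro AE_I2 order_trans[OF le]) simp
  qed
  have "(\<lambda>i. LINT u|lborel. H u * p i u) sums (LINT u|lborel. (\<Sum>i. H u * p i u))"
  proof (rule sums_integral[OF int])
    show "AE u in lborel. summable (\<lambda>i. norm (H u * p i u))"
    proof (rule AE_I2)
      fix u
      show "summable (\<lambda>i. norm (H u * p i u))"
        by (rule summable_comparison_test'[OF summable_mult[OF b(2), of "norm (H u)"], of 0]) (simp add: le)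
    qed
    show "summable (\<lambda>i. LINT u|lborel. norm (H u * p i u))"
    proof (rule summable_comparison_test'[OF summable_mult[OF b(2), of "LINT u|lborel. norm (H u)"], of 0])
      fix i
      have "(LINT u|lborel. norm (H u * p i u)) \<le> (LINT u|lborel. norm (H u) * b i)"
        using int H le by (intro integral_mono integrable_norm integrable_mult_left)
      thus "norm (LINT u|lborel. norm (H u * p i u)) \<le> (LINT u|lborel. norm (H u)) * b i" by simp
    qed
  qed
  also have "(\<lambda>u. (\<Sum>i. H u * p i u)) = (\<lambda>u. H u * q u)"
    using sums_unique[OF sums_mult[OF q]] by (intro ext) simp
  finally show ?thesis .
qed

text \<open>
  The partial sums of the three series add up to A B_N + B A_N - A_N B_N, so no absolute convergence
  is needed.
\<close>

lemma sums_triangle_product: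
  fixes a b :: "nat \<Rightarrow> complex"
  assumes a: "a sums A" and b: "b sums B" and ab: "(\<lambda>n. a n * b n) sums Z"
    and D: "(\<lambda>n. b n * (A - (\<Sum>k<Suc n. a k))) sums D" and E: "(\<lambda>n. a n * (B - (\<Sum>k<Suc n. b k))) sums E"
  shows "D + E + Z = A * B"
proof -
  have fin: "(\<Sum>n<N. b n * (A - (\<Sum>k<Suc n. a k))) + (\<Sum>n<N. a n * (B - (\<Sum>k<Suc n. b k))) + (\<Sum>n<N. a n * b n)
     = A * (\<Sum>n<N. b n) + B * (\<Sum>n<N. a n) - (\<Sum>n<N. a n) * (\<Sum>n<N. b n)" for N
  proof (induction N)
    case (Suc N)
    define X where "X = (\<Sum>n<N. a n)"
    define Y where "Y = (\<Sum>n<N. b n)"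
    have "(\<Sum>n<Suc N. b n * (A - (\<Sum>k<Suc n. a k))) + (\<Sum>n<Suc N. a n * (B - (\<Sum>k<Suc n. b k))) + (\<Sum>n<Suc N. a n * b n)
      = (A * Y + B * X - X * Y) + b N * (A - (X + a N)) + a N * (B - (Y + b N)) + a N * b N"
      using Suc unfolding X_def Y_def by (simp add: algebra_simps)
    thus ?case unfolding sum.lessThan_Suc X_def[symmetric] Y_def[symmetric] by (simp add: algebra_simps)
  qed simp
  have "(\<lambda>N. (\<Sum>n<N. b n * (A - (\<Sum>k<Suc n. a k))) + (\<Sum>n<N. a n * (B - (\<Sum>k<Suc n. b k))) + (\<Sum>n<N. a n * b n)) \<longlonglongrightarrow> D + E + Z"
    using D E ab unfolding sums_def by (intro tendsto_add)
  moreover have "(\<lambda>N. A * (\<Sum>n<N. b n) + B * (\<Sum>n<N. a n) - (\<Sum>n<N. a n) * (\<Sum>n<N. b n)) \<longlonglongrightarrow> A * B + B * A - A * B"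
    using a b unfolding sums_def by (intro tendsto_intros)
  ultimately have "D + E + Z = A * B + B * A - A * B" unfolding fin by (rule LIMSEQ_unique)
  thus ?thesis by (simp add: mult.commute)
qed

text \<open>For \<open>w = cnj s\<close> and Re z = Re s the last argument is the conjugate of z, so
  the two zeta factors multiply to |zeta z|^2. The factor 1 / Gamma s is kept out of the
  kernel.\<close>

definition zeta_kernel :: "complex \<Rightarrow> complex \<Rightarrow> complex \<Rightarrow> complex" where
  "zeta_kernel s w z = Gamma z * Gamma (s - z) * zeta z * zeta (s + w - z)"

text \<open>The two upper bounds on \<open>b\<close> keep s - z and s + w - z in the half-plane of
  real part greater than -1, where the estimates for Gamma and zeta hold.\<close>

lemma rapid_zeta_kernel:
  assumes "-1 < a" "b < Re s + 1" "b < Re (s + w) + 1"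
  shows "rapid a b (zeta_kernel s w)"
proof -
  have "rapid a b (\<lambda>z. Gamma z * Gamma (s - z) * zeta z * zeta (s + w - z))"
    by (rule rapid_mult[OF rapid_mult[OF rapid_mult[OF rapid_Gamma moderate_reflect[OF rapid_imp_moderate[OF rapid_Gamma]]]
         moderate_zeta] moderate_reflect[OF moderate_zeta]])
       (use assms in auto)
  thus ?thesis by (simp add: zeta_kernel_def[abs_def])
qed

lemma holomorphic_zeta_kernel:
  "zeta_kernel s w holomorphic_on {z. -1 < Re z \<and> Re z < Re s} - {0, 1, s + w - 1}"
  unfolding zeta_kernel_def
  by (intro holomorphic_intros) (auto dest: nonpos_Ints_Re_gt_D nonpos_Ints_Re_D simp: algebra_simps)

lemma norm_Suc_cpowr: "norm (of_nat (Suc n) powr z :: complex) = real (Suc n) powr (Re z)"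
  using norm_powr_real_powr[of "of_nat (Suc n)" z] by (simp del: of_nat_Suc)

lemma Suc_cpowr_eq_exp: "(of_nat (Suc n) :: complex) powr z = exp (z * of_real (ln (real (Suc n))))"
proof -
  have "Ln (of_nat (Suc n) :: complex) = of_real (ln (real (Suc n)))"
    using Ln_of_real[of "real (Suc n)"] by (simp del: of_nat_Suc)
  thus ?thesis by (simp add: powr_def del: of_nat_Suc)
qed

text \<open>Up to a constant this is the Mellin-Barnes integrand for x = (m + 1) / (n + 1), and 1 +
  x = (n + m + 2) / (n + 1); \<open>Suc (m + Suc n)\<close> is the numerator n + m + 2.\<close>

lemma zeta_kernel_term:
  fixes s w :: complex
  assumes "0 < c" "c < Re s"
  shows "line_integral c (\<lambda>z. Gamma z * Gamma (s - z) * of_nat (Suc n) powr (- (s + w - z)) * of_nat (Suc m) powr (- z))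
    = 2 * pi * Gamma s * (of_nat (Suc n) powr (- w) * of_nat (Suc (m + Suc n)) powr (- s))"
proof -
  define v where "v = ln (real (Suc m)) - ln (real (Suc n))"
  have "Gamma z * Gamma (s - z) * of_nat (Suc n) powr (- (s + w - z)) * of_nat (Suc m) powr (- z)
      = of_nat (Suc n) powr (- (s + w)) * mellin_barnes s (of_real v) z" for z
    unfolding Suc_cpowr_eq_exp mellin_barnes_def v_def by (simp add: exp_add[symmetric] algebra_simps)
  hence "line_integral c (\<lambda>z. Gamma z * Gamma (s - z) * of_nat (Suc n) powr (- (s + w - z)) * of_nat (Suc m) powr (- z))
     = of_nat (Suc n) powr (- (s + w)) * line_integral c (mellin_barnes s (of_real v))"
    by (simp add: line_integral_def)
  also have "line_integral c (mellin_barnes s (of_real v)) = 2 * pi * Gamma s * of_real (1 + exp v) powr (- s)"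
    by (rule mellin_barnes_integral[OF assms])
  also have "1 + exp v = real (Suc (m + Suc n)) / real (Suc n)"
    by (simp add: v_def exp_diff field_simps)
  also have "complex_of_real \<dots> powr (- s) = of_nat (Suc (m + Suc n)) powr (- s) * of_nat (Suc n) powr s"
  proof -
    define x y where "x = real (Suc (m + Suc n))" and "y = real (Suc n)"
    have xy: "x > 0" "y > 0" by (auto simp: x_def y_def)
    have "Ln (complex_of_real (x / y)) = of_real (ln x - ln y)"
      using xy by (simp add: Ln_of_real ln_div del: of_real_divide of_real_diff)
    hence "complex_of_real (x / y) powr (- s) = exp (- s * of_real (ln x - ln y))"
      using xy by (simp add: powr_def del: of_real_divide of_real_diff)
    also have "\<dots> = exp (- s * of_real (ln x)) * exp (s * of_real (ln y))"
      by (simp add: exp_add[symmetric] algebra_simps)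
    finally show ?thesis unfolding Suc_cpowr_eq_exp x_def y_def .
  qed
  also have "of_nat (Suc n) powr (- (s + w)) * (2 * pi * Gamma s * (of_nat (Suc (m + Suc n)) powr (- s) * of_nat (Suc n) powr s))
     = 2 * pi * Gamma s * (of_nat (Suc (m + Suc n)) powr (- s) * (of_nat (Suc n) powr (- (s + w)) * of_nat (Suc n) powr s))"
    by (simp only: mult_ac)
  also have "of_nat (Suc n) powr (- (s + w)) * of_nat (Suc n) powr s = of_nat (Suc n) powr (- w :: complex)"
    unfolding Suc_cpowr_eq_exp by (simp add: exp_add[symmetric] algebra_simps)
  finally show ?thesis by (simp only: mult_ac)
qed

text \<open>On Re z = 3/2 both z and s + w - z lie in the domain of absolute convergence. For each
  n, the expansion of zeta z produces a tail of the series for zeta s; the expansion of zeta (s + w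
  - z) provides the sum over n.\<close>

lemma zeta_kernel_dirichlet:
  fixes s w :: complex
  assumes s: "Re s > 2" and w: "Re w > 2"
  shows "(\<lambda>n. 2 * pi * Gamma s * (of_nat (Suc n) powr (- w) * (zeta s - (\<Sum>k<Suc n. of_nat (Suc k) powr (- s)))))
    sums line_integral (3/2) (zeta_kernel s w)"
proof -
  define z where "z u = Complex (3/2) u" for u
  have cz: "continuous_on UNIV z" unfolding z_def Complex_eq by (intro continuous_intros)
  have cont: "continuous_on UNIV (\<lambda>u. (of_nat (Suc n) :: complex) powr (h + k * z u))" for n h k
    unfolding Suc_cpowr_eq_exp by (intro continuous_intros cz)
  have meas: "(\<lambda>u. (of_nat (Suc n) :: complex) powr (h + k * z u)) \<in> borel_measurable lborel" for n h k
    using borel_measurable_continuous_onI[OF cont] by simp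
  have rGG: "rapid (3/2) (3/2) (\<lambda>z. Gamma z * Gamma (s - z))"
    by (rule rapid_mult[OF rapid_Gamma moderate_reflect[OF rapid_imp_moderate[OF rapid_Gamma]]]) (use s in auto)
  define A where "A = {z. 1 < Re z \<and> Re z < Re s}"
  have inA: "Complex (3/2) u \<in> A" for u using s by (simp add: A_def)
  have hGG: "(\<lambda>z. Gamma z * Gamma (s - z)) holomorphic_on A"
    unfolding A_def by (intro holomorphic_intros) (auto dest: nonpos_Ints_Re_D)
  have inner: "2 * pi * Gamma s * (of_nat (Suc n) powr (- w) * (zeta s - (\<Sum>k<Suc n. of_nat (Suc k) powr (- s))))
      = line_integral (3/2) (\<lambda>z. Gamma z * Gamma (s - z) * zeta z * of_nat (Suc n) powr (- (s + w - z)))" for n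
  proof -
    define H where "H u = Gamma (z u) * Gamma (s - z u) * of_nat (Suc n) powr (- (s + w - z u))" for u
    have "(\<lambda>m. LINT u|lborel. H u * of_nat (Suc m) powr (- z u)) sums (LINT u|lborel. H u * zeta (z u))"
    proof (rule sums_integral_mult[where b = "\<lambda>m. real (Suc m) powr (- (3/2))"])
      have "moderate (3/2) (3/2) (\<lambda>z. of_nat (Suc n) powr (- (s + w - z)))"
      proof (rule moderateI[where n = 0 and R = 0 and K = "real (Suc n) powr (- Re (s + w) + 3 / 2)"])
        fix z assume "3 / 2 \<le> Re z" "Re z \<le> 3 / 2"
        hence "Re (- (s + w - z)) = - Re (s + w) + 3 / 2" by simp
        thus "norm (of_nat (Suc n) powr (- (s + w - z)) :: complex) \<le> real (Suc n) powr (- Re (s + w) + 3 / 2) * (1 + \<bar>Im z\<bar>) ^ 0"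
          by (simp only: norm_Suc_cpowr) simp
      qed
      moreover have "(\<lambda>z. Gamma z * Gamma (s - z) * of_nat (Suc n) powr (- (s + w - z))) holomorphic_on A"
        unfolding Suc_cpowr_eq_exp by (intro holomorphic_intros hGG)
      ultimately show "integrable lborel H"
        unfolding H_def z_def
        by (intro integrable_line_rapid[of "\<lambda>z. Gamma z * Gamma (s - z) * of_nat (Suc n) powr (- (s + w - z))" A] rapid_mult rGG inA)
      show "(\<lambda>u. of_nat (Suc m) powr (- z u) :: complex) \<in> borel_measurable lborel" for m
        using meas[of m 0 "-1"] by simp
      show "norm (of_nat (Suc m) powr (- z u) :: complex) \<le> real (Suc m) powr (- (3/2))" for m u
        by (simp add: norm_Suc_cpowr z_def del: of_nat_Suc)
      show "summable (\<lambda>m. real (Suc m) powr (- (3/2)))" by (rule summable_Suc_powr) simp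
      show "(\<lambda>m. of_nat (Suc m) powr (- z u)) sums zeta (z u)" for u by (rule zeta_sums) (simp add: z_def)
    qed
    also have "(\<lambda>m. LINT u|lborel. H u * of_nat (Suc m) powr (- z u)) =
       (\<lambda>m. 2 * pi * Gamma s * (of_nat (Suc n) powr (- w) * of_nat (Suc (m + Suc n)) powr (- s)))"
      using zeta_kernel_term[of "3/2" s n w] s unfolding line_integral_def H_def z_def by (intro ext) simp
    finally have 1: "(\<lambda>m. 2 * pi * Gamma s * (of_nat (Suc n) powr (- w) * of_nat (Suc (m + Suc n)) powr (- s))) sums (LINT u|lborel. H u * zeta (z u))" .
    have "(\<lambda>m. of_nat (Suc (m + Suc n)) powr (- s)) sums (zeta s - (\<Sum>k<Suc n. of_nat (Suc k) powr (- s)))"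
      by (rule sums_split_initial_segment[of "\<lambda>k. of_nat (Suc k) powr (- s)"]) (use zeta_sums[of s] s in auto)
    hence "(\<lambda>m. 2 * pi * Gamma s * (of_nat (Suc n) powr (- w) * of_nat (Suc (m + Suc n)) powr (- s))) sums
      (2 * pi * Gamma s * (of_nat (Suc n) powr (- w) * (zeta s - (\<Sum>k<Suc n. of_nat (Suc k) powr (- s)))))"
      by (intro sums_mult)
    from sums_unique2[OF this 1] show ?thesis
      by (simp add: line_integral_def H_def z_def mult_ac)
  qed
  define H where "H u = Gamma (z u) * Gamma (s - z u) * zeta (z u)" for u
  have "(\<lambda>n. LINT u|lborel. H u * of_nat (Suc n) powr (- (s + w - z u))) sums (LINT u|lborel. H u * zeta (s + w - z u))"
  proof (rule sums_integral_mult[where b = "\<lambda>n. real (Suc n) powr (- (Re (s + w) - 3 / 2))"])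
    have "moderate (3/2) (3/2) zeta" by (rule moderate_zeta) simp
    moreover have "(\<lambda>z. Gamma z * Gamma (s - z) * zeta z) holomorphic_on A"
      by (intro holomorphic_on_mult hGG holomorphic_on_subset[OF holomorphic_zeta]) (auto simp: A_def)
    ultimately show "integrable lborel H"
      unfolding H_def z_def
      by (intro integrable_line_rapid[of "\<lambda>z. Gamma z * Gamma (s - z) * zeta z" A] rapid_mult rGG inA)
    show "(\<lambda>u. of_nat (Suc m) powr (- (s + w - z u)) :: complex) \<in> borel_measurable lborel" for m
      using meas[of m "- (s + w)" 1] by (simp add: algebra_simps)
    show "norm (of_nat (Suc m) powr (- (s + w - z u)) :: complex) \<le> real (Suc m) powr (- (Re (s + w) - 3 / 2))" for m u
      by (simp add: norm_Suc_cpowr z_def del: of_nat_Suc)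
    show "summable (\<lambda>m. real (Suc m) powr (- (Re (s + w) - 3 / 2)))" using s w by (intro summable_Suc_powr) simp
    show "(\<lambda>m. of_nat (Suc m) powr (- (s + w - z u))) sums zeta (s + w - z u)" for u
      using s w by (intro zeta_sums) (simp add: z_def)
  qed
  thus ?thesis unfolding inner by (simp add: line_integral_def H_def z_def zeta_kernel_def[abs_def])
qed

lemma residue_zeta_1:
  assumes "open A" "1 \<in> A" "h holomorphic_on A"
  shows "residue (\<lambda>z. h z * zeta z) 1 = h 1"
proof -
  let ?B = "A \<inter> {z. Re z > -1}"
  have B: "open ?B" "1 \<in> ?B" using assms by (auto intro: open_Int open_halfspace_Re_gt)
  have "residue (\<lambda>z. h z * zeta z) 1 = residue (\<lambda>z. (h z * zeta_reg z) / (z - 1)) 1"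
  proof (rule residue_cong[OF _ refl])
    have "\<forall>\<^sub>F z in at 1. z \<in> ?B - {1}" by (rule eventually_at_in_open[OF B])
    thus "\<forall>\<^sub>F z in at 1. h z * zeta z = (h z * zeta_reg z) / (z - 1)"
      by eventually_elim (simp add: zeta_eq_zeta_reg)
  qed
  also have "\<dots> = h 1 * zeta_reg 1"
    by (rule residue_simple[OF B]) (intro holomorphic_intros holomorphic_on_subset[OF assms(3)] holomorphic_on_subset[OF holomorphic_zeta_reg], auto)
  finally show ?thesis by (simp add: zeta_reg_1)
qed

text \<open>Real parts above 2 put the poles at s and s + w - 1 to the right of the strip, so only
  those at 0 and 1 are crossed. The factor 1/2 is - zeta 0.\<close>

lemma zeta_kernel_shift:
  fixes s w :: complex
  assumes c: "-1 < c" "c < 0" and s: "Re s > 2" and w: "Re w > 2"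
  shows "line_integral (3/2) (zeta_kernel s w) = line_integral c (zeta_kernel s w)
     + 2 * pi * (Gamma (s - 1) * zeta (s + w - 1) - Gamma s * zeta (s + w) / 2)"
proof -
  define X where "X = {z. Re z < 2}"
  have oX: "open X" unfolding X_def by (rule open_halfspace_Re_lt)
  have "line_integral (3/2) (zeta_kernel s w) = line_integral c (zeta_kernel s w)
     + 2 * pi * (\<Sum>p\<in>{0,1}. residue (zeta_kernel s w) p)"
  proof (rule line_integral_shift_rapid(1)[where a' = "-1" and b' = 2])
    show "zeta_kernel s w holomorphic_on {z. -1 < Re z \<and> Re z < 2} - {0, 1}"
      by (rule holomorphic_on_subset[OF holomorphic_zeta_kernel]) (use s w in auto)
  qed (use c s w in \<open>auto intro!: rapid_zeta_kernel\<close>)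
  also have "(\<Sum>p\<in>{0,1}. residue (zeta_kernel s w) p) = residue (zeta_kernel s w) 0 + residue (zeta_kernel s w) 1" by simp
  also have "residue (zeta_kernel s w) 0 = Gamma (s - 0) * zeta 0 * zeta (s + w - 0)"
    unfolding zeta_kernel_def mult.assoc
  proof (rule residue_Gamma_0[where A = "{z. Re z < 1}"])
    show "(\<lambda>z. Gamma (s - z) * (zeta z * zeta (s + w - z))) holomorphic_on {z. Re z < 1}"
      using s w by (intro holomorphic_intros) (auto dest: nonpos_Ints_Re_D simp: complex_eq_iff)
  qed (auto intro: open_halfspace_Re_lt)
  also have "residue (zeta_kernel s w) 1 = residue (\<lambda>z. (Gamma z * Gamma (s - z) * zeta (s + w - z)) * zeta z) 1"
    by (simp add: zeta_kernel_def[abs_def] mult_ac)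
  also have "\<dots> = Gamma 1 * Gamma (s - 1) * zeta (s + w - 1)"
  proof (rule residue_zeta_1[where A = "{z. Re z > 0} \<inter> X"])
    show "(\<lambda>z. Gamma z * Gamma (s - z) * zeta (s + w - z)) holomorphic_on {z. Re z > 0} \<inter> X"
      using s w by (intro holomorphic_intros) (auto dest: nonpos_Ints_Re_D simp: complex_eq_iff X_def)
  qed (use oX in \<open>auto intro: open_Int open_halfspace_Re_gt simp: X_def\<close>)
  finally show ?thesis by (simp add: zeta_0 algebra_simps)
qed

text \<open>\<open>rGamma\<close> takes the place of a division by Gamma because it is entire, which
  suits the continuation in s.\<close>

definition zeta_mean :: "real \<Rightarrow> complex \<Rightarrow> complex \<Rightarrow> complex" where
  "zeta_mean c s w = rGamma s * line_integral c (zeta_kernel s w) / (2 * pi)"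

text \<open>Each of the two triangular sums contributes - zeta (s + w) / 2 from the residue at 0,
  and together they cancel the diagonal. The residues at 1 leave Gamma (s - 1) / Gamma s = 1 / (s -
  1) and its counterpart in w.\<close>

lemma zeta_mean_identity_large:
  fixes s w :: complex
  assumes c: "-1 < c" "c < 0" and s: "Re s > 2" and w: "Re w > 2"
  shows "zeta_mean c s w + zeta_mean c w s = zeta s * zeta w - zeta (s + w - 1) * (1 / (s - 1) + 1 / (w - 1))"
proof -
  have half: "(\<lambda>n. of_nat (Suc n) powr (- w) * (zeta s - (\<Sum>k<Suc n. of_nat (Suc k) powr (- s)))) sums
      (zeta_mean c s w + zeta (s + w - 1) / (s - 1) - zeta (s + w) / 2)" if s: "Re s > 2" and w: "Re w > 2" for s w :: complex
  proof -
    have G: "Gamma s = (s - 1) * Gamma (s - 1)"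
      using Gamma_plus1[of "s - 1"] s by (simp add: not_nonpos_Ints_Re_pos)
    have nz: "Gamma s \<noteq> 0" "s - 1 \<noteq> 0" using s by (auto simp: Gamma_eq_zero_iff dest: nonpos_Ints_Re_D)
    have "(\<lambda>n. rGamma s / (2 * pi) * (2 * pi * Gamma s * (of_nat (Suc n) powr (- w) * (zeta s - (\<Sum>k<Suc n. of_nat (Suc k) powr (- s))))))
      sums (rGamma s / (2 * pi) * line_integral (3/2) (zeta_kernel s w))"
      by (rule sums_mult[OF zeta_kernel_dirichlet[OF s w]])
    also have "(\<lambda>n. rGamma s / (2 * pi) * (2 * pi * Gamma s * (of_nat (Suc n) powr (- w) * (zeta s - (\<Sum>k<Suc n. of_nat (Suc k) powr (- s))))))
      = (\<lambda>n. of_nat (Suc n) powr (- w) * (zeta s - (\<Sum>k<Suc n. of_nat (Suc k) powr (- s))))"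
      using nz by (intro ext) (simp add: rGamma_inverse_Gamma field_simps)
    also have "rGamma s / (2 * pi) * line_integral (3/2) (zeta_kernel s w) =
       zeta_mean c s w + rGamma s * (Gamma (s - 1) * zeta (s + w - 1) - Gamma s * zeta (s + w) / 2)"
      unfolding zeta_kernel_shift[OF c s w] zeta_mean_def by (simp add: ring_distribs)
    also have "rGamma s * (Gamma (s - 1) * zeta (s + w - 1) - Gamma s * zeta (s + w) / 2)
       = zeta (s + w - 1) / (s - 1) - zeta (s + w) / 2"
    proof -
      have "rGamma s * Gamma s = 1" using nz by (simp add: rGamma_inverse_Gamma)
      moreover have "rGamma s * Gamma (s - 1) = 1 / (s - 1)"
      proof -
        have "Gamma (s - 1) \<noteq> 0" using nz G by auto
        thus ?thesis unfolding rGamma_inverse_Gamma G using nz(2) by (simp add: divide_simps)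
      qed
      ultimately show ?thesis by (simp add: right_diff_distrib mult.assoc[symmetric])
    qed
    finally show ?thesis by (simp add: add_diff_eq)
  qed
  have "(zeta_mean c s w + zeta (s + w - 1) / (s - 1) - zeta (s + w) / 2) + (zeta_mean c w s + zeta (w + s - 1) / (w - 1) - zeta (w + s) / 2) + zeta (s + w)
     = zeta s * zeta w"
  proof (rule sums_triangle_product[OF _ _ _ half[OF s w] half[OF w s]])
    show "(\<lambda>n. of_nat (Suc n) powr (- s)) sums zeta s" "(\<lambda>n. of_nat (Suc n) powr (- w)) sums zeta w"
      by (rule zeta_sums, use s w in simp)+
    have "(\<lambda>n. of_nat (Suc n) powr (- (s + w))) sums zeta (s + w)" using s w by (intro zeta_sums) auto
    thus "(\<lambda>n. of_nat (Suc n) powr (- s) * of_nat (Suc n) powr (- w)) sums zeta (s + w)"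
      unfolding Suc_cpowr_eq_exp by (simp add: exp_add[symmetric] algebra_simps)
  qed
  thus ?thesis by (simp add: algebra_simps)
qed

section \<open>Analytic continuation in the real part\<close>

text \<open>\<open>1 < 2 * a - c\<close> keeps the argument 2 \<sigma> - z of the second zeta factor
  to the right of its pole along the whole line. Bounding Re \<sigma> and Im \<sigma> makes the
  majorants uniform; the limit 4 leaves room for a part with Re \<sigma> > 2, where the identity is
  already known.\<close>

lemma holomorphic_zeta_mean:
  assumes c: "-1 < c" "c < 0" and a: "0 < a" "1 < 2 * a - c"
  shows "(\<lambda>\<sigma>. zeta_mean c (\<sigma> + \<i> * of_real t) (\<sigma> - \<i> * of_real t)) holomorphic_on
     {\<sigma>. a < Re \<sigma>} \<inter> {\<sigma>. Re \<sigma> < 4} \<inter> {\<sigma>. - 1 < Im \<sigma>} \<inter> {\<sigma>. Im \<sigma> < 1}"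
proof -
  define W where "W = {\<sigma>. a < Re \<sigma>} \<inter> {\<sigma>. Re \<sigma> < 4} \<inter> {\<sigma>. - 1 < Im \<sigma>} \<inter> {\<sigma>. Im \<sigma> < 1}"
  have oW: "open W" unfolding W_def
    by (intro open_Int open_halfspace_Re_gt open_halfspace_Re_lt open_halfspace_Im_gt open_halfspace_Im_lt)
  have W: "a < Re \<sigma>" "Re \<sigma> < 4" "\<bar>Im \<sigma>\<bar> < 1" if "\<sigma> \<in> W" for \<sigma> using that by (auto simp: W_def)
  define g where "g \<sigma> u = zeta_kernel (\<sigma> + \<i> * of_real t) (\<sigma> - \<i> * of_real t) (Complex c u)" for \<sigma> u
  have g_eq: "g \<sigma> u = Gamma (Complex c u) * Gamma (\<sigma> + \<i> * of_real t - Complex c u) * zeta (Complex c u) * zeta (2 * \<sigma> - Complex c u)" for \<sigma> u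
    by (simp add: g_def zeta_kernel_def)
  obtain K1 where K1: "K1 > 0" "\<And>z. a - c \<le> Re z \<Longrightarrow> Re z \<le> 4 - c \<Longrightarrow> norm (Gamma z) \<le> K1 * exp (- \<bar>Im z\<bar>)"
    using Gamma_exp_bound[of "a - c" "4 - c"] a c by auto
  obtain K2 where K2: "K2 > 0" "\<And>z. 2 * a - c \<le> Re z \<Longrightarrow> Re z \<le> 8 - c \<Longrightarrow> norm (zeta_reg z) \<le> K2 * (1 + \<bar>Im z\<bar>) ^ 3"
    using zeta_strip_bound[of "2 * a - c" "8 - c"] a by auto
  define d where "d = 2 * a - c - 1"
  have d: "d > 0" using a by (simp add: d_def)
  \<comment> \<open>The majorant in u: the two factors independent of \<sigma>, times a cube that
    dominates the growth of zeta (2 \<sigma> - z). On the line the cube is (1 + iu)^3; it is written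
    holomorphically in z so that integrability follows from \<open>rapid\<close>.\<close>
  define F where "F z = Gamma z * zeta z * (z - of_real c + 1) ^ 3" for z
  define K where "K = K1 * (K2 * (3 * 2) ^ 3 / d)"
  have K: "K > 0" using K1 K2 d by (simp add: K_def)
  have F_int: "integrable lborel (\<lambda>u. F (Complex c u))"
  proof (rule integrable_line_rapid[where A = "{z. -1 < Re z \<and> Re z < 0}"])
    show "F holomorphic_on {z. -1 < Re z \<and> Re z < 0}"
      unfolding F_def by (intro holomorphic_intros) (auto dest: nonpos_Ints_Re_gt_D)
    have "moderate c c (\<lambda>z. z - of_real c + 1)"
    proof (rule moderateI[where n = 1 and R = 0 and K = 1])
      fix z assume "c \<le> Re z" "Re z \<le> c"
      thus "norm (z - of_real c + 1) \<le> 1 * (1 + \<bar>Im z\<bar>) ^ 1" using cmod_le[of "z - of_real c + 1"] by simp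
    qed
    hence "moderate c c (\<lambda>z. (z - of_real c + 1) ^ 3)"
      unfolding power3_eq_cube by (intro moderate_mult)
    thus "rapid c c F" unfolding F_def using c by (intro rapid_mult rapid_Gamma moderate_zeta) auto
  qed (use c in auto)
  have "((\<lambda>\<sigma>. LINT u|lborel. g \<sigma> u) has_field_derivative (LINT u|lborel. deriv (\<lambda>\<sigma>. g \<sigma> u) \<sigma>)) (at \<sigma>)" if \<sigma>: "\<sigma> \<in> W" for \<sigma>
  proof (rule has_field_derivative_lebesgue_integral[OF oW \<sigma>, where h = "\<lambda>u. K * norm (F (Complex c u))"])
    show "integrable lborel (\<lambda>u. K * norm (F (Complex c u)))"
      by (intro integrable_mult_right integrable_norm F_int)
    show "(\<lambda>\<sigma>. g \<sigma> u) holomorphic_on W" for u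
    proof -
      have "Re (\<sigma> + \<i> * of_real t - Complex c u) > 0" "Re (2 * \<sigma> - Complex c u) > 1" if "\<sigma> \<in> W" for \<sigma>
        using W[OF that] a c by auto
      hence "\<And>\<sigma>. \<sigma> \<in> W \<Longrightarrow> \<sigma> + \<i> * of_real t - Complex c u \<notin> \<int>\<^sub>\<le>\<^sub>0" "\<And>\<sigma>. \<sigma> \<in> W \<Longrightarrow> 2 * \<sigma> - Complex c u \<noteq> 1"
        using not_nonpos_Ints_Re_pos by (blast, metis one_complex.sel(1) less_irrefl)
      thus ?thesis unfolding g_eq by (intro holomorphic_intros)
    qed
    show "g \<sigma> \<in> borel_measurable lborel" if "\<sigma> \<in> W" for \<sigma>
    proof -
      have "continuous_on UNIV (\<lambda>u. g \<sigma> u)"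
        unfolding g_def using c W[OF that] a
        by (intro continuous_on_line[OF holomorphic_zeta_kernel]) (auto simp: complex_eq_iff)
      from borel_measurable_continuous_onI[OF this] show ?thesis by simp
    qed
  next
    fix \<sigma> u assume \<sigma>: "\<sigma> \<in> W"
    note W = W[OF \<sigma>]
    have 1: "norm (Gamma (\<sigma> + \<i> * of_real t - Complex c u)) \<le> K1"
    proof -
      have "norm (Gamma (\<sigma> + \<i> * of_real t - Complex c u)) \<le> K1 * exp (- \<bar>Im (\<sigma> + \<i> * of_real t - Complex c u)\<bar>)"
        using W by (intro K1) auto
      also have "\<dots> \<le> K1 * 1" using K1(1) by (intro mult_left_mono) auto
      finally show ?thesis by simp
    qed
    have y: "1 + \<bar>u\<bar> \<le> 2 * norm (Complex c u - of_real c + 1)"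
      using abs_Re_le_cmod[of "Complex c u - of_real c + 1"] abs_Im_le_cmod[of "Complex c u - of_real c + 1"] by simp
    have 2: "norm (zeta (2 * \<sigma> - Complex c u)) \<le> K2 * (3 * 2) ^ 3 / d * norm (Complex c u - of_real c + 1) ^ 3"
    proof -
      define z where "z = 2 * \<sigma> - Complex c u"
      have z: "2 * a - c \<le> Re z" "Re z \<le> 8 - c" "\<bar>Im z\<bar> \<le> 2 + \<bar>u\<bar>" using W by (auto simp: z_def)
      have zd: "norm (z - 1) \<ge> d" using abs_Re_le_cmod[of "z - 1"] z by (simp add: d_def)
      have "z \<noteq> 1" using zd d by auto
      hence "norm (zeta z) = norm (zeta_reg z) / norm (z - 1)"
        using z a by (simp add: zeta_eq_zeta_reg norm_divide)
      also have "\<dots> \<le> norm (zeta_reg z) / d"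
        using zd d by (intro divide_left_mono) (auto intro!: mult_pos_pos)
      also have "\<dots> \<le> (K2 * (1 + \<bar>Im z\<bar>) ^ 3) / d"
        using d z by (intro divide_right_mono K2) auto
      also have "(1 + \<bar>Im z\<bar>) ^ 3 \<le> ((3 * 2) * norm (Complex c u - of_real c + 1)) ^ 3"
        using z y by (intro power_mono) auto
      finally show ?thesis using K2(1) d by (simp add: z_def power_mult_distrib mult_ac divide_right_mono mult_left_mono)
    qed
    have "norm (g \<sigma> u) \<le> norm (Gamma (Complex c u)) * K1 * norm (zeta (Complex c u)) * (K2 * (3 * 2) ^ 3 / d * norm (Complex c u - of_real c + 1) ^ 3)"
      unfolding g_eq norm_mult using K1(1) by (intro mult_mono 1 2 order_refl) auto
    also have "\<dots> = K * norm (F (Complex c u))" by (simp add: K_def F_def norm_mult norm_power)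
    finally show "norm (g \<sigma> u) \<le> K * norm (F (Complex c u))" .
  qed
  hence "(\<lambda>\<sigma>. LINT u|lborel. g \<sigma> u) holomorphic_on W"
    unfolding holomorphic_on_open[OF oW] by blast
  hence "(\<lambda>\<sigma>. rGamma (\<sigma> + \<i> * of_real t) * (LINT u|lborel. g \<sigma> u) / (2 * pi)) holomorphic_on W"
    by (intro holomorphic_intros) auto
  thus ?thesis by (simp add: zeta_mean_def line_integral_def g_def W_def)
qed

lemma zeta_mean_identity:
  fixes \<sigma> t c :: real
  assumes \<sigma>: "0 < \<sigma>" "\<sigma> < 1" and t: "t \<ge> 1" and c: "-1 < c" "c < 0" "c < 2 * \<sigma> - 1"
  shows "zeta_mean c (Complex \<sigma> t) (Complex \<sigma> (-t)) + zeta_mean c (Complex \<sigma> (-t)) (Complex \<sigma> t)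
    = zeta (Complex \<sigma> t) * zeta (Complex \<sigma> (-t)) - zeta (2 * of_real \<sigma> - 1) * (1 / (Complex \<sigma> t - 1) + 1 / (Complex \<sigma> (-t) - 1))"
proof -
  \<comment> \<open>The midpoint between \<sigma> and (1 + c) / 2, the lower limit imposed by 1 < 2
    a - c; the latter is the smaller one because c < 2 \<sigma> - 1.\<close>
  define a where "a = ((1 + c) / 2 + \<sigma>) / 2"
  have a: "0 < a" "1 < 2 * a - c" "a < \<sigma>" using \<sigma> c by (auto simp: a_def field_simps)
  define W where "W = {\<sigma>. a < Re \<sigma>} \<inter> {\<sigma>. Re \<sigma> < 4} \<inter> {\<sigma>. - 1 < Im \<sigma>} \<inter> {\<sigma>. Im \<sigma> < 1}"
  have oW: "open W" unfolding W_def
    by (intro open_Int open_halfspace_Re_gt open_halfspace_Re_lt open_halfspace_Im_gt open_halfspace_Im_lt)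
  have cW: "connected W" unfolding W_def
    by (intro convex_connected convex_Int convex_halfspace_Re_gt convex_halfspace_Re_lt convex_halfspace_Im_gt convex_halfspace_Im_lt)
  let ?s = "\<lambda>\<sigma>. \<sigma> + \<i> * complex_of_real t" and ?w = "\<lambda>\<sigma>. \<sigma> - \<i> * complex_of_real t"
  let ?L = "\<lambda>\<sigma>. zeta_mean c (?s \<sigma>) (?w \<sigma>) + zeta_mean c (?w \<sigma>) (?s \<sigma>)"
  let ?R = "\<lambda>\<sigma>. zeta (?s \<sigma>) * zeta (?w \<sigma>) - zeta (2 * \<sigma> - 1) * (1 / (?s \<sigma> - 1) + 1 / (?w \<sigma> - 1))"
  have "?L (of_real \<sigma>) = ?R (of_real \<sigma>)"
  \<comment> \<open>At 1 the factor zeta (2 \<sigma> - 1) has its pole, so that point is taken out.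
    The arguments \<sigma> + it and \<sigma> - it never reach 1, since |Im \<sigma>| < 1 <=
    t.\<close>
  proof (rule analytic_continuation_open[where s = "W \<inter> {\<sigma>. 2 < Re \<sigma>}" and s' = "W - {1}" and f = ?L and g = ?R])
    show "open (W \<inter> {\<sigma>. 2 < Re \<sigma>})" by (intro open_Int oW open_halfspace_Re_gt)
    show "open (W - {1})" by (intro open_Diff oW) auto
    have "3 \<in> W \<inter> {\<sigma>. 2 < Re \<sigma>}" using a \<sigma> by (simp add: W_def)
    thus "W \<inter> {\<sigma>. 2 < Re \<sigma>} \<noteq> {}" by blast
    show "connected (W - {1})" by (rule connected_open_delete[OF oW cW]) simp
    show "W \<inter> {\<sigma>. 2 < Re \<sigma>} \<subseteq> W - {1}" by auto
    have 1: "(\<lambda>\<sigma>. zeta_mean c (?s \<sigma>) (?w \<sigma>)) holomorphic_on W - {1}"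
      using holomorphic_zeta_mean[OF c(1,2) a(1,2), of t] unfolding W_def[symmetric] by (rule holomorphic_on_subset) auto
    have 2: "(\<lambda>\<sigma>. zeta_mean c (?w \<sigma>) (?s \<sigma>)) holomorphic_on W - {1}"
      using holomorphic_zeta_mean[OF c(1,2) a(1,2), of "-t"] unfolding W_def[symmetric]
      by (simp add: holomorphic_on_subset[OF _ Diff_subset])
    show "?L holomorphic_on W - {1}" by (intro holomorphic_on_add 1 2)
    have "?s \<sigma> \<noteq> 1" "?w \<sigma> \<noteq> 1" "2 * \<sigma> - 1 \<noteq> 1" if "\<sigma> \<in> W - {1}" for \<sigma>
      using that t by (auto simp: W_def complex_eq_iff)
    thus "?R holomorphic_on W - {1}" by (intro holomorphic_intros) auto
    show "of_real \<sigma> \<in> W - {1}" using \<sigma> a by (simp add: W_def)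
    show "?L z = ?R z" if "z \<in> W \<inter> {\<sigma>. 2 < Re \<sigma>}" for z
    proof -
      have "?s z + ?w z - 1 = 2 * z - 1" by simp
      moreover have "?L z = zeta (?s z) * zeta (?w z) - zeta (?s z + ?w z - 1) * (1 / (?s z - 1) + 1 / (?w z - 1))"
        by (rule zeta_mean_identity_large) (use c that in auto)
      ultimately show ?thesis by (simp only:)
    qed
  qed
  moreover have "of_real \<sigma> + \<i> * complex_of_real t = Complex \<sigma> t" "of_real \<sigma> - \<i> * complex_of_real t = Complex \<sigma> (-t)"
    by (auto simp: complex_eq_iff)
  ultimately show ?thesis by (simp only:)
qed

lemma cnj_zeta_kernel:
  assumes "-1 < Re z" "Re z < Re (s + w) + 1" "z \<noteq> 1" "s + w - z \<noteq> 1"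
  shows "cnj (zeta_kernel s w z) = zeta_kernel (cnj s) (cnj w) (cnj z)"
  using cnj_zeta[of z] cnj_zeta[of "s + w - z"] assms by (simp add: zeta_kernel_def cnj_Gamma)

lemma integral_cnj_lborel: "cnj (LINT u|lborel. f u) = (LINT u|lborel. cnj (f u))"
  by (rule Bochner_Integration.integral_cnj[symmetric])

text \<open>Conjugation exchanges s and w and reverses the line. The sum of the two means in
  \<open>zeta_mean_identity\<close> is thus twice the real part of one of them.\<close>

lemma cnj_zeta_mean:
  fixes \<sigma> t c :: real
  assumes c: "-1 < c" "c < 0" "c < 2 * \<sigma> - 1"
  shows "cnj (zeta_mean c (Complex \<sigma> t) (Complex \<sigma> (-t))) = zeta_mean c (Complex \<sigma> (-t)) (Complex \<sigma> t)"
proof -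
  have cs: "cnj (Complex \<sigma> t) = Complex \<sigma> (-t)" "cnj (Complex \<sigma> (-t)) = Complex \<sigma> t" by (auto simp: complex_eq_iff)
  have "cnj (line_integral c (zeta_kernel (Complex \<sigma> t) (Complex \<sigma> (-t)))) =
      (LINT u|lborel. cnj (zeta_kernel (Complex \<sigma> t) (Complex \<sigma> (-t)) (Complex c u)))"
    unfolding line_integral_def by (rule integral_cnj_lborel)
  also have "\<dots> = (LINT u|lborel. zeta_kernel (Complex \<sigma> (-t)) (Complex \<sigma> t) (Complex c (-u)))"
  proof (rule Bochner_Integration.integral_cong[OF refl])
    fix u
    have "cnj (Complex c u) = Complex c (-u)" by (simp add: complex_eq_iff)
    moreover have "cnj (zeta_kernel (Complex \<sigma> t) (Complex \<sigma> (-t)) (Complex c u)) = zeta_kernel (cnj (Complex \<sigma> t)) (cnj (Complex \<sigma> (-t))) (cnj (Complex c u))"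
      by (rule cnj_zeta_kernel) (use c in \<open>auto simp: complex_eq_iff\<close>)
    ultimately show "cnj (zeta_kernel (Complex \<sigma> t) (Complex \<sigma> (-t)) (Complex c u)) = zeta_kernel (Complex \<sigma> (-t)) (Complex \<sigma> t) (Complex c (-u))"
      by (simp only: cs)
  qed
  also have "\<dots> = line_integral c (zeta_kernel (Complex \<sigma> (-t)) (Complex \<sigma> t))"
    unfolding line_integral_def
    using lborel_integral_real_affine[of "-1" "\<lambda>u. zeta_kernel (Complex \<sigma> (-t)) (Complex \<sigma> t) (Complex c u)" 0] by simp
  finally show ?thesis by (simp add: zeta_mean_def cnj_rGamma cs)
qed

section \<open>The Gaussian pole\<close>

lemma rapid_reflect:
  assumes "rapid (Re s - b) (Re s - a) f"
  shows "rapid a b (\<lambda>z. f (s - z))"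
  unfolding rapid_def
proof
  fix n
  obtain K R where 1: "\<And>z. Re s - b \<le> Re z \<Longrightarrow> Re z \<le> Re s - a \<Longrightarrow> R \<le> \<bar>Im z\<bar> \<Longrightarrow> norm (f z) * (1 + \<bar>Im z\<bar>) ^ n \<le> K"
    using assms unfolding rapid_def by blast
  have F: "norm (f (s - z)) * (1 + \<bar>Im z\<bar>) ^ n \<le> K * (1 + \<bar>Im s\<bar>) ^ n"
    if z: "a \<le> Re z" "Re z \<le> b" "R + \<bar>Im s\<bar> \<le> \<bar>Im z\<bar>" for z
  proof -
    have "1 + \<bar>Im z\<bar> \<le> 1 + \<bar>Im s\<bar> + \<bar>Im (s - z)\<bar>" by simp
    also have "\<dots> \<le> (1 + \<bar>Im s\<bar>) * (1 + \<bar>Im (s - z)\<bar>)" by (simp add: ring_distribs)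
    finally have "norm (f (s - z)) * (1 + \<bar>Im z\<bar>) ^ n \<le> norm (f (s - z)) * ((1 + \<bar>Im s\<bar>) * (1 + \<bar>Im (s - z)\<bar>)) ^ n"
      by (intro mult_left_mono power_mono) auto
    also have "\<dots> = (norm (f (s - z)) * (1 + \<bar>Im (s - z)\<bar>) ^ n) * (1 + \<bar>Im s\<bar>) ^ n"
      by (simp only: power_mult_distrib mult_ac)
    also have "\<dots> \<le> K * (1 + \<bar>Im s\<bar>) ^ n" using z by (intro mult_right_mono 1) auto
    finally show ?thesis .
  qed
  show "\<exists>K R. \<forall>z. a \<le> Re z \<longrightarrow> Re z \<le> b \<longrightarrow> R \<le> \<bar>Im z\<bar> \<longrightarrow> norm (f (s - z)) * (1 + \<bar>Im z\<bar>) ^ n \<le> K"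
    by (rule exI[of _ "K * (1 + \<bar>Im s\<bar>) ^ n"], rule exI[of _ "R + \<bar>Im s\<bar>"], intro allI impI F)
qed

lemma rapid_gauss: "rapid a b (\<lambda>z. exp (z\<^sup>2))"
  unfolding rapid_def
proof
  fix n
  have F: "norm (exp (z\<^sup>2)) * (1 + \<bar>Im z\<bar>) ^ n \<le> exp ((\<bar>a\<bar> + \<bar>b\<bar>)\<^sup>2) * real (Suc n) ^ n" if z: "a \<le> Re z" "Re z \<le> b" "1 \<le> \<bar>Im z\<bar>" for z
  proof -
    have "\<bar>Re z\<bar> \<le> \<bar>a\<bar> + \<bar>b\<bar>" using z by auto
    hence "(Re z)\<^sup>2 \<le> (\<bar>a\<bar> + \<bar>b\<bar>)\<^sup>2" using power_mono[of "\<bar>Re z\<bar>" "\<bar>a\<bar> + \<bar>b\<bar>" 2] by simp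
    moreover have "(Im z)\<^sup>2 \<ge> \<bar>Im z\<bar>" using z(3) self_le_power[of "\<bar>Im z\<bar>" 2] by simp
    moreover have "Re (z\<^sup>2) = (Re z)\<^sup>2 - (Im z)\<^sup>2" by (simp add: power2_eq_square)
    ultimately have "Re (z\<^sup>2) \<le> (\<bar>a\<bar> + \<bar>b\<bar>)\<^sup>2 + - \<bar>Im z\<bar>" by simp
    hence "norm (exp (z\<^sup>2)) \<le> exp ((\<bar>a\<bar> + \<bar>b\<bar>)\<^sup>2) * exp (- \<bar>Im z\<bar>)"
      unfolding norm_exp_eq_Re exp_add[symmetric] by simp
    hence "norm (exp (z\<^sup>2)) * (1 + \<bar>Im z\<bar>) ^ n \<le> (exp ((\<bar>a\<bar> + \<bar>b\<bar>)\<^sup>2) * exp (- \<bar>Im z\<bar>)) * (real (Suc n) ^ n * exp \<bar>Im z\<bar>)"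
      by (intro mult_mono one_plus_power_le_exp) auto
    also have "\<dots> = exp ((\<bar>a\<bar> + \<bar>b\<bar>)\<^sup>2) * real (Suc n) ^ n * (exp (- \<bar>Im z\<bar>) * exp \<bar>Im z\<bar>)" by (simp only: mult_ac)
    also have "exp (- \<bar>Im z\<bar>) * exp \<bar>Im z\<bar> = 1" by (simp add: exp_add[symmetric])
    finally show ?thesis by simp
  qed
  show "\<exists>K R. \<forall>z. a \<le> Re z \<longrightarrow> Re z \<le> b \<longrightarrow> R \<le> \<bar>Im z\<bar> \<longrightarrow> norm (exp (z\<^sup>2)) * (1 + \<bar>Im z\<bar>) ^ n \<le> K"
    by (rule exI[of _ "exp ((\<bar>a\<bar> + \<bar>b\<bar>)\<^sup>2) * real (Suc n) ^ n"], rule exI[of _ 1], intro allI impI F)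
qed

lemma moderate_inverse: "moderate a b (\<lambda>z. 1 / z)"
proof (rule moderateI[where n = 0 and R = 1 and K = 1])
  fix z assume "1 \<le> \<bar>Im z\<bar>"
  hence "1 \<le> norm z" using abs_Im_le_cmod[of z] by linarith
  thus "norm (1 / z) \<le> 1 * (1 + \<bar>Im z\<bar>) ^ 0" by (simp add: norm_divide divide_le_eq)
qed

text \<open>
  Subtracting a multiple of \<open>gauss_pole (s - z)\<close> cancels the pole of the integrand at z = s. This
  function is odd about s, hence purely imaginary on the line through s.
\<close>

definition gauss_pole :: "complex \<Rightarrow> complex" where
  "gauss_pole z = exp (z\<^sup>2) / z"

lemma rapid_gauss_pole: "rapid a b gauss_pole"
proof -
  have "rapid a b (\<lambda>z. exp (z\<^sup>2) * (1 / z))" by (rule rapid_mult[OF rapid_gauss moderate_inverse])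
  thus ?thesis by (simp add: gauss_pole_def[abs_def])
qed

lemma holomorphic_gauss_pole: "gauss_pole holomorphic_on - {0}"
  unfolding gauss_pole_def by (intro holomorphic_intros) auto

text \<open>Half of a residue contribution: the integrals at \<open>e\<close> and \<open>-e\<close>
  differ by 2 pi, and oddness makes them opposite.\<close>

lemma line_integral_gauss_pole:
  assumes "e > 0"
  shows "line_integral e gauss_pole = pi"
proof -
  have "line_integral e gauss_pole = line_integral (-e) gauss_pole + 2 * pi * (\<Sum>p\<in>{0}. residue gauss_pole p)"
  proof (rule line_integral_shift_rapid(1)[where a' = "-e-1" and b' = "e+1"])
    show "gauss_pole holomorphic_on {z. -e-1 < Re z \<and> Re z < e+1} - {0}"
      by (rule holomorphic_on_subset[OF holomorphic_gauss_pole]) auto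
  qed (use assms rapid_gauss_pole in auto)
  also have "(\<Sum>p\<in>{0}. residue gauss_pole p) = 1"
  proof -
    have "residue (\<lambda>z. exp (z\<^sup>2) / (z - 0)) 0 = exp (0\<^sup>2)"
      by (rule residue_simple[of UNIV]) (auto intro!: holomorphic_intros)
    thus ?thesis by (simp add: gauss_pole_def[abs_def])
  qed
  also have "line_integral (-e) gauss_pole = - line_integral e gauss_pole"
  proof -
    have "line_integral (-e) gauss_pole = (LINT u|lborel. gauss_pole (Complex (-e) (-u)))"
      unfolding line_integral_def using lborel_integral_real_affine[of "-1" "\<lambda>u. gauss_pole (Complex (-e) u)" 0] by simp
    also have "\<dots> = (LINT u|lborel. - gauss_pole (Complex e u))"
    proof (rule Bochner_Integration.integral_cong[OF refl])
      fix u
      have "Complex (-e) (-u) = - Complex e u" by (simp add: complex_eq_iff)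
      thus "gauss_pole (Complex (-e) (-u)) = - gauss_pole (Complex e u)" by (simp add: gauss_pole_def)
    qed
    finally show ?thesis by (simp add: line_integral_def)
  qed
  finally show ?thesis by simp
qed

lemma line_integral_gauss_pole_shifted:
  assumes "c < Re s"
  shows "line_integral c (\<lambda>z. gauss_pole (s - z)) = pi"
proof -
  have "line_integral c (\<lambda>z. gauss_pole (s - z)) = (LINT u|lborel. gauss_pole (Complex (Re s - c) (Im s + (-1) * u)))"
  proof -
    have "s - Complex c u = Complex (Re s - c) (Im s + (-1) * u)" for u by (simp add: complex_eq_iff)
    thus ?thesis by (simp add: line_integral_def)
  qed
  also have "\<dots> = line_integral (Re s - c) gauss_pole"
    unfolding line_integral_def
    using lborel_integral_real_affine[of "-1" "\<lambda>u. gauss_pole (Complex (Re s - c) u)" "Im s"] by simp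
  also have "\<dots> = pi" using assms by (intro line_integral_gauss_pole) simp
  finally show ?thesis .
qed

section \<open>The exact formula\<close>

lemma rapid_cong:
  assumes "rapid a b f" "\<And>z. \<bar>Im z\<bar> \<ge> T \<Longrightarrow> a \<le> Re z \<Longrightarrow> Re z \<le> b \<Longrightarrow> g z = f z"
  shows "rapid a b g"
  unfolding rapid_def
proof
  fix n
  obtain K R where 1: "\<And>z. a \<le> Re z \<Longrightarrow> Re z \<le> b \<Longrightarrow> R \<le> \<bar>Im z\<bar> \<Longrightarrow> norm (f z) * (1 + \<bar>Im z\<bar>) ^ n \<le> K"
    using assms(1) unfolding rapid_def by blast
  have F: "norm (g z) * (1 + \<bar>Im z\<bar>) ^ n \<le> K" if "a \<le> Re z" "Re z \<le> b" "max R T \<le> \<bar>Im z\<bar>" for z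
    using 1[of z] assms(2)[of z] that by simp
  show "\<exists>K R. \<forall>z. a \<le> Re z \<longrightarrow> Re z \<le> b \<longrightarrow> R \<le> \<bar>Im z\<bar> \<longrightarrow> norm (g z) * (1 + \<bar>Im z\<bar>) ^ n \<le> K"
    by (rule exI[of _ K], rule exI[of _ "max R T"], intro allI impI F)
qed

text \<open>\<open>g\<close> is the integrand in the variable u = t \<tau> with the singularity at u
  = t removed. Phrasing the result with an absolutely integrable function makes tail estimates
  available; the principal value is recovered later from continuity.\<close>

lemma exact_formula:
  fixes \<sigma> t :: real
  assumes \<sigma>: "0 < \<sigma>" "\<sigma> < 1" and t: "t \<ge> 1"
  defines "s \<equiv> Complex \<sigma> t"
  obtains g :: "real \<Rightarrow> real" where "continuous_on UNIV g" "integrable lborel g"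
    "\<And>u. u \<noteq> t \<Longrightarrow> g u = zeta_integrand \<sigma> t (u / t)"
    "(LINT u|lborel. g u) / pi = - Re (zeta (2 * of_real \<sigma> - 1) * (1 / (s - 1) + 1 / (cnj s - 1)))
       + 2 * Re ((\<Sum>p\<in>{0, of_real (2 * \<sigma> - 1)}. residue (zeta_kernel s (cnj s)) p) / Gamma s)"
proof -
  \<comment> \<open>Lies between -1 and min 0 (2 \<sigma> - 1) for every \<sigma> in (0, 1), since 2
    \<sigma> - 1 - c = 3 \<sigma> / 2.\<close>
  define c where "c = -1 + \<sigma> / 2"
  have c: "-1 < c" "c < 0" "c < 2 * \<sigma> - 1" "c < \<sigma>" using \<sigma> by (auto simp: c_def)
  define w where "w = Complex \<sigma> (-t)"
  have ws: "cnj s = w" by (simp add: s_def w_def complex_eq_iff)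
  define p0 where "p0 = complex_of_real (2 * \<sigma> - 1)"
  have sw: "s + w - 1 = p0" by (simp add: s_def w_def p0_def complex_eq_iff)
  have Res: "Re s = \<sigma>" "Im s = t" "Re w = \<sigma>" by (auto simp: s_def w_def)
  have Gs: "Gamma s \<noteq> 0" unfolding Gamma_eq_zero_iff using \<sigma> by (intro not_nonpos_Ints_Re_pos) (simp add: Res)
  \<comment> \<open>Raising the argument of the second Gamma factor by 1 multiplies the kernel by s
    - z, so \<open>P\<close> is holomorphic at s and \<open>P s\<close> is minus the residue of the
    kernel there. \<open>Q\<close> subtracts the same multiple of a Gaussian and vanishes at
    s.\<close>
  define P where "P z = Gamma z * Gamma (s + 1 - z) * zeta z * zeta (s + w - z)" for z
  define Q where "Q z = P z - P s * exp ((s - z)\<^sup>2)" for z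
  define B where "B = {z. -1 < Re z \<and> Re z < 1} - {0, p0}"
  have B_eq: "B = {z. Re z > -1} \<inter> {z. Re z < 1} - {0, p0}" by (auto simp: B_def)
  have oB: "open B" unfolding B_eq by (intro open_Diff open_Int open_halfspace_Re_gt open_halfspace_Re_lt) auto
  have sB: "s \<in> B" using \<sigma> t by (auto simp: B_def s_def p0_def complex_eq_iff)
  have hP: "P holomorphic_on B"
  proof -
    have "z \<notin> \<int>\<^sub>\<le>\<^sub>0" "s + 1 - z \<notin> \<int>\<^sub>\<le>\<^sub>0" "z \<noteq> 1" "s + w - z \<noteq> 1" if "z \<in> B" for z
    proof -
      show "z \<notin> \<int>\<^sub>\<le>\<^sub>0" using that by (intro not_nonpos_Ints_strip) (auto simp: B_def)
      show "s + 1 - z \<notin> \<int>\<^sub>\<le>\<^sub>0" using that \<sigma> by (intro not_nonpos_Ints_Re_pos) (auto simp: B_def Res)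
      show "z \<noteq> 1" using that by (auto simp: B_def)
      show "s + w - z \<noteq> 1"
      proof
        assume "s + w - z = 1"
        hence "z = s + w - 1" by (simp add: algebra_simps)
        with sw that show False by (simp add: B_def)
      qed
    qed
    thus ?thesis unfolding P_def by (intro holomorphic_intros) auto
  qed
  have hQ: "Q holomorphic_on B" unfolding Q_def by (intro holomorphic_intros hP)
  have Qs: "Q s = 0" by (simp add: Q_def)
  \<comment> \<open>The difference quotient of \<open>Q\<close> with its removable singularity
    filled in; the sign turns z - s into s - z. Away from s it is the kernel minus the Gaussian
    pole.\<close>
  define G where "G z = - (if z = s then deriv Q s else (Q z - Q s) / (z - s))" for z
  have hG: "G holomorphic_on B"
    unfolding G_def by (intro holomorphic_on_minus pole_lemma_open hQ oB)
  have Ps: "P s = Gamma s * zeta s * zeta w" by (simp add: P_def)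
  have G_eq: "G z = zeta_kernel s w z - P s * gauss_pole (s - z)" if z: "z \<noteq> s" "Re z < 1" for z
  proof -
    have "s - z \<notin> \<int>\<^sub>\<le>\<^sub>0" using z \<sigma> by (intro not_nonpos_Ints_strip) (auto simp: Res)
    from Gamma_plus1[OF this] have "Gamma (s + 1 - z) = (s - z) * Gamma (s - z)" by (simp add: algebra_simps)
    hence "P z = (s - z) * zeta_kernel s w z" by (simp add: P_def zeta_kernel_def)
    moreover have "exp ((s - z)\<^sup>2) = (s - z) * gauss_pole (s - z)" using z by (simp add: gauss_pole_def)
    ultimately have "Q z = (s - z) * (zeta_kernel s w z - P s * gauss_pole (s - z))"
      unfolding Q_def by (simp only: right_diff_distrib mult_ac)
    moreover have "G z = Q z / (s - z)" using z by (simp add: G_def Qs minus_divide_right)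
    ultimately show ?thesis using z by simp
  qed
  have rG: "rapid c \<sigma> G"
  proof (rule rapid_cong[where T = "t + 1"])
    show "rapid c \<sigma> (\<lambda>z. zeta_kernel s w z - P s * gauss_pole (s - z))"
      by (intro rapid_diff rapid_mult' moderate_const rapid_reflect rapid_gauss_pole rapid_zeta_kernel)
         (use c \<sigma> in \<open>auto simp: Res\<close>)
    show "G z = zeta_kernel s w z - P s * gauss_pole (s - z)" if "t + 1 \<le> \<bar>Im z\<bar>" "Re z \<le> \<sigma>" for z
      using that t \<sigma> by (intro G_eq) (auto simp: s_def)
  qed
  have p0: "c < Re p0" "Re p0 < \<sigma>" "Im p0 = 0" using c \<sigma> by (auto simp: p0_def)
  have hG': "G holomorphic_on {z. -1 < Re z \<and> Re z < 1} - {0, p0}" using hG by (simp only: B_def)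
  have sp: "c < Re p \<and> Re p < \<sigma>" if "p \<in> {0, p0}" for p using that c \<sigma> p0 by auto
  have res: "residue G p = residue (zeta_kernel s w) p" if p: "p \<in> {0, p0}" for p
  proof -
    \<comment> \<open>A neighbourhood of \<open>p\<close> that avoids the other pole and, through Im
      z < t, the point s. The Gaussian pole is holomorphic on it and leaves the residue
      unchanged.\<close>
    define N where "N = {z. Re z > -1} \<inter> {z. Re z < \<sigma>} \<inter> {z. Im z < t} - ({0, p0} - {p})"
    have N: "open N" unfolding N_def
      by (intro open_Diff open_Int open_halfspace_Re_gt open_halfspace_Re_lt open_halfspace_Im_lt finite_imp_closed) auto
    have pN: "p \<in> N" using p p0 c \<sigma> t by (auto simp: N_def)
    have gp: "(\<lambda>z. P s * gauss_pole (s - z)) holomorphic_on N"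
      by (intro holomorphic_intros holomorphic_on_compose_gen[OF _ holomorphic_gauss_pole, unfolded o_def])
         (auto simp: N_def s_def)
    have zk: "zeta_kernel s w holomorphic_on N - {p}"
      by (rule holomorphic_on_subset[OF holomorphic_zeta_kernel]) (use sw \<sigma> in \<open>auto simp: N_def Res\<close>)
    have "residue G p = residue (\<lambda>z. zeta_kernel s w z - P s * gauss_pole (s - z)) p"
    proof (rule residue_cong[OF _ refl])
      have "\<forall>\<^sub>F z in at p. z \<in> N - {p}" by (rule eventually_at_in_open[OF N pN])
      thus "\<forall>\<^sub>F z in at p. G z = zeta_kernel s w z - P s * gauss_pole (s - z)"
        by eventually_elim (rule G_eq, use \<sigma> in \<open>auto simp: N_def s_def\<close>)
    qed
    also have "\<dots> = residue (zeta_kernel s w) p - residue (\<lambda>z. P s * gauss_pole (s - z)) p"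
      by (rule residue_diff[OF N pN zk]) (rule holomorphic_on_subset[OF gp], auto)
    also have "residue (\<lambda>z. P s * gauss_pole (s - z)) p = 0" by (rule residue_holo[OF N pN gp])
    finally show ?thesis by simp
  qed
  have Lc: "line_integral c G = line_integral c (zeta_kernel s w) - P s * pi"
  proof -
    have i1: "integrable lborel (\<lambda>u. zeta_kernel s w (Complex c u))"
      by (rule integrable_line_rapid[OF holomorphic_zeta_kernel])
         (use c \<sigma> sw p0 in \<open>auto simp: Res complex_eq_iff intro!: rapid_zeta_kernel\<close>)
    have i2: "integrable lborel (\<lambda>u. gauss_pole (s - Complex c u))"
    proof (rule integrable_line_rapid[where A = "{z. Re z < \<sigma>}"])
      show "(\<lambda>z. gauss_pole (s - z)) holomorphic_on {z. Re z < \<sigma>}"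
        by (intro holomorphic_intros holomorphic_on_compose_gen[OF _ holomorphic_gauss_pole, unfolded o_def])
           (auto simp: s_def)
      show "rapid c c (\<lambda>z. gauss_pole (s - z))" by (rule rapid_reflect[OF rapid_gauss_pole])
    qed (use c in auto)
    have "line_integral c G = (LINT u|lborel. zeta_kernel s w (Complex c u) - P s * gauss_pole (s - Complex c u))"
      unfolding line_integral_def
      by (intro Bochner_Integration.integral_cong refl G_eq) (use c \<sigma> in \<open>auto simp: s_def\<close>)
    also have "\<dots> = line_integral c (zeta_kernel s w) - P s * line_integral c (\<lambda>z. gauss_pole (s - z))"
      using i1 i2 by (simp add: line_integral_def)
    also have "line_integral c (\<lambda>z. gauss_pole (s - z)) = pi"
      by (rule line_integral_gauss_pole_shifted) (use c in \<open>simp add: Res\<close>)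
    finally show ?thesis .
  qed
  define S where "S = (\<Sum>p\<in>{0, p0}. residue (zeta_kernel s w) p)"
  have L: "line_integral \<sigma> G = line_integral c (zeta_kernel s w) - P s * pi + 2 * pi * S"
  proof -
    have "line_integral \<sigma> G = line_integral c G + 2 * pi * (\<Sum>p\<in>{0, p0}. residue G p)"
      by (rule line_integral_shift_rapid(1)[OF c(4,1) \<sigma>(2) _ sp hG' rG]) auto
    also have "(\<Sum>p\<in>{0, p0}. residue G p) = S" unfolding S_def by (rule sum.cong[OF refl res])
    finally show ?thesis by (simp only: Lc)
  qed
  define g where "g u = Re (G (Complex \<sigma> u) / Gamma s)" for u
  have line: "Complex \<sigma> u \<in> B" for u using \<sigma> by (auto simp: B_def p0_def complex_eq_iff)
  have intG: "integrable lborel (\<lambda>u. G (Complex \<sigma> u))"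
    by (rule line_integral_shift_rapid(3)[OF c(4,1) \<sigma>(2) _ sp hG' rG]) auto
  have zzw: "zeta s * zeta w = of_real ((norm (zeta s))\<^sup>2)"
  proof -
    have "zeta w = cnj (zeta s)" unfolding ws[symmetric]
      using \<sigma> by (intro cnj_zeta[symmetric]) (auto simp: s_def complex_eq_iff)
    thus ?thesis by (simp only: complex_norm_square)
  qed
  show ?thesis
  proof (rule that)
    show "continuous_on UNIV g" unfolding g_def
      by (intro continuous_intros continuous_on_line[OF hG line]) (simp add: Gs)
    show ig: "integrable lborel g" unfolding g_def using intG by (intro integrable_Re) simp
    show "g u = zeta_integrand \<sigma> t (u / t)" if "u \<noteq> t" for u
    proof -
      define z where "z = Complex \<sigma> u"
      have zs: "z \<noteq> s" using that by (simp add: z_def s_def)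
      have "G z / Gamma s = zeta_kernel s w z / Gamma s - (zeta s * zeta w) * gauss_pole (s - z)"
        using G_eq[OF zs] \<sigma> Gs by (simp add: z_def Ps diff_divide_distrib)
      moreover have "Re ((zeta s * zeta w) * gauss_pole (s - z)) = 0"
      proof -
        have "s - z = \<i> * of_real (t - u)" by (simp add: s_def z_def complex_eq_iff)
        hence "gauss_pole (s - z) = of_real (exp (- ((t - u)\<^sup>2))) / (\<i> * of_real (t - u))"
          by (simp add: gauss_pole_def power_mult_distrib exp_of_real[symmetric])
        also have "\<dots> = - \<i> * of_real (exp (- ((t - u)\<^sup>2)) / (t - u))"
          using that by (simp add: field_simps)
        finally show ?thesis unfolding zzw by simp
      qed
      moreover have "zeta_kernel s w z / Gamma s = Gamma (s - z) / Gamma s * Gamma z * of_real ((norm (zeta z))\<^sup>2)"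
      proof -
        have "s + w - z = cnj z" by (simp add: s_def w_def z_def complex_eq_iff)
        moreover have "zeta (cnj z) = cnj (zeta z)" using \<sigma> by (intro cnj_zeta[symmetric]) (auto simp: z_def complex_eq_iff)
        ultimately show ?thesis unfolding zeta_kernel_def complex_norm_square by simp
      qed
      ultimately have "g u = Re (Gamma (s - z) / Gamma s * Gamma z * of_real ((norm (zeta z))\<^sup>2))"
        unfolding g_def z_def[symmetric] by simp
      also have "\<dots> = Re (Gamma (s - z) / Gamma s * Gamma z) * (norm (zeta z))\<^sup>2"
      proof -
        have "Re (x * of_real r) = Re x * r" for x r by simp
        thus ?thesis .
      qed
      also have "\<dots> = zeta_integrand \<sigma> t (u / t)"
      proof -
        have "\<i> * of_real t - \<i> * of_real (u / t) * of_real t = s - z" "of_real \<sigma> + \<i> * of_real t = s"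
          "of_real \<sigma> + \<i> * of_real (u / t) * of_real t = z"
          using t by (auto simp: s_def z_def complex_eq_iff)
        thus ?thesis unfolding zeta_integrand_def by (simp only:)
      qed
      finally show ?thesis .
    qed
    have "(LINT u|lborel. g u) = Re (line_integral \<sigma> G / Gamma s)"
      unfolding g_def line_integral_def using intG by (simp add: integral_Re[symmetric])
    also have "\<dots> = pi * (2 * Re (zeta_mean c s w) - Re (zeta s * zeta w) + 2 * Re (S / Gamma s))"
    proof -
      have "line_integral \<sigma> G / Gamma s = of_real pi * (2 * zeta_mean c s w - zeta s * zeta w + 2 * (S / Gamma s))"
        unfolding L Ps zeta_mean_def using Gs by (simp add: rGamma_inverse_Gamma field_simps)
      moreover have "Re (of_real pi * (2 * m - z + 2 * Y)) = pi * (2 * Re m - Re z + 2 * Re Y)" for m z Y by simp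
      ultimately show ?thesis by (simp only:)
    qed
    also have "2 * Re (zeta_mean c s w) = Re (zeta_mean c s w + zeta_mean c w s)"
      using cnj_zeta_mean[OF c(1-3), of t] unfolding s_def[symmetric] w_def[symmetric] by (metis complex_add_cnj Re_complex_of_real)
    also have "zeta_mean c s w + zeta_mean c w s = zeta s * zeta w - zeta (2 * of_real \<sigma> - 1) * (1 / (s - 1) + 1 / (w - 1))"
      unfolding s_def w_def by (rule zeta_mean_identity[OF \<sigma> t c(1-3)])
    finally show "(LINT u|lborel. g u) / pi = - Re (zeta (2 * of_real \<sigma> - 1) * (1 / (s - 1) + 1 / (cnj s - 1)))
       + 2 * Re ((\<Sum>p\<in>{0, of_real (2 * \<sigma> - 1)}. residue (zeta_kernel s (cnj s)) p) / Gamma s)"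
      unfolding ws p0_def[symmetric] S_def by simp
  qed
qed

section \<open>Residues of the kernel at 0 and 2 \<sigma> - 1\<close>

lemma residue_zeta_kernel_0:
  fixes \<sigma> t :: real
  assumes \<sigma>: "0 < \<sigma>" "\<sigma> < 1" "\<sigma> \<noteq> 1 / 2"
  shows "residue (zeta_kernel (Complex \<sigma> t) (Complex \<sigma> (-t))) 0 = - Gamma (Complex \<sigma> t) * zeta (of_real (2 * \<sigma>)) / 2"
proof -
  let ?s = "Complex \<sigma> t" and ?w = "Complex \<sigma> (-t)"
  define p0 where "p0 = complex_of_real (2 * \<sigma> - 1)"
  have "residue (zeta_kernel ?s ?w) 0 = Gamma (?s - 0) * zeta 0 * zeta (?s + ?w - 0)"
    unfolding zeta_kernel_def mult.assoc
  proof (rule residue_Gamma_0[where A = "{z. Re z < \<sigma>} - {p0}"])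
    show "(\<lambda>z. Gamma (?s - z) * (zeta z * zeta (?s + ?w - z))) holomorphic_on {z. Re z < \<sigma>} - {p0}"
      using \<sigma> by (intro holomorphic_intros) (auto dest: nonpos_Ints_Re_D simp: complex_eq_iff p0_def)
    show "open ({z. Re z < \<sigma>} - {p0})" by (intro open_Diff open_halfspace_Re_lt) auto
    show "0 \<in> {z. Re z < \<sigma>} - {p0}" using \<sigma> by (auto simp: p0_def complex_eq_iff)
  qed
  also have "?s + ?w - 0 = of_real (2 * \<sigma>)" by (simp add: complex_eq_iff)
  finally show ?thesis by (simp add: zeta_0)
qed

text \<open>At 2 \<sigma> - 1 the argument s + w - z passes through the pole of zeta with slope -1,
  which is where the minus sign comes from.\<close>

lemma residue_zeta_kernel_1:
  fixes \<sigma> t :: real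
  assumes \<sigma>: "0 < \<sigma>" "\<sigma> < 1" "\<sigma> \<noteq> 1 / 2"
  defines "p0 \<equiv> complex_of_real (2 * \<sigma> - 1)"
  shows "residue (zeta_kernel (Complex \<sigma> t) (Complex \<sigma> (-t))) p0 = - Gamma p0 * Gamma (Complex (1 - \<sigma>) t) * zeta p0"
proof -
  let ?s = "Complex \<sigma> t" and ?w = "Complex \<sigma> (-t)"
  have sw: "?s + ?w - 1 = p0" by (simp add: p0_def complex_eq_iff)
  define A where "A = {z. Re z > -1} \<inter> {z. Re z < \<sigma>} - {0}"
  have A: "open A" "p0 \<in> A" unfolding A_def
    using \<sigma> by (auto intro!: open_Diff open_Int open_halfspace_Re_gt open_halfspace_Re_lt simp: p0_def complex_eq_iff)
  define X where "X z = - (Gamma z * Gamma (?s - z) * zeta z * zeta_reg (?s + ?w - z))" for z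
  have "residue (zeta_kernel ?s ?w) p0 = residue (\<lambda>z. X z / (z - p0)) p0"
  proof (rule residue_cong[OF _ refl])
    have "\<forall>\<^sub>F z in at p0. z \<in> A - {p0}" by (rule eventually_at_in_open[OF A])
    thus "\<forall>\<^sub>F z in at p0. zeta_kernel ?s ?w z = X z / (z - p0)"
    proof eventually_elim
      case (elim z)
      have d: "?s + ?w - z - 1 = - (z - p0)" unfolding sw[symmetric] by simp
      have "?s + ?w - z \<noteq> 1"
      proof
        assume "?s + ?w - z = 1"
        hence "z - p0 = 0" using d by simp
        with elim show False by simp
      qed
      hence "zeta (?s + ?w - z) = zeta_reg (?s + ?w - z) / (- (z - p0))"
        using elim \<sigma> unfolding d[symmetric] by (intro zeta_eq_zeta_reg) (auto simp: A_def)
      thus ?case unfolding zeta_kernel_def X_def by (simp only: times_divide_eq_right divide_minus_right minus_divide_left mult_minus_right)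
    qed
  qed
  also have "\<dots> = X p0"
  proof (rule residue_simple[OF A])
    have "z \<notin> \<int>\<^sub>\<le>\<^sub>0" "?s - z \<notin> \<int>\<^sub>\<le>\<^sub>0" "z \<noteq> 1" "Re (?s + ?w - z) > -1" if "z \<in> A" for z
      using that \<sigma> by (auto simp: A_def dest: nonpos_Ints_Re_gt_D nonpos_Ints_Re_D)
    thus "X holomorphic_on A" unfolding X_def by (intro holomorphic_intros) auto
  qed
  also have "X p0 = - Gamma p0 * Gamma (Complex (1 - \<sigma>) t) * zeta p0"
  proof -
    have "?s + ?w - p0 = 1" "?s - p0 = Complex (1 - \<sigma>) t" by (auto simp: p0_def complex_eq_iff)
    thus ?thesis unfolding X_def by (simp only: zeta_reg_1) simp
  qed
  finally show ?thesis .
qed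

text \<open>The poles of Gamma z and zeta (1 - z) merge at 0, and the residue is the derivative at 0
  of \<open>X\<close>, which is z^2 times the kernel. With \<open>X 0\<close> equal to Gamma s / 2,
  its logarithmic derivative collects - \<gamma> from Gamma (z + 1), - Digamma s, the quotient ln (2
  pi) of derivative and value of zeta at 0, and another - \<gamma> from
  \<open>zeta_reg\<close>.\<close>

lemma residue_zeta_kernel_half:
  fixes t :: real
  defines "s \<equiv> Complex (1/2) t"
  shows "residue (zeta_kernel s (Complex (1/2) (-t))) 0 = - Gamma s * (Digamma s + 2 * euler_mascheroni - of_real (ln (2 * pi))) / 2"
proof -
  let ?w = "Complex (1/2) (-t)"
  have sw: "s + ?w = 1" by (simp add: s_def complex_eq_iff)
  define A where "A = {z. Re z > -1/2} \<inter> {z. Re z < 1/2}"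
  have A: "open A" "0 \<in> A" unfolding A_def
    by (intro open_Int open_halfspace_Re_gt open_halfspace_Re_lt, simp)
  define X where "X z = - (Gamma (z + 1) * Gamma (s - z) * (zeta z * zeta_reg (1 - z)))" for z
  have "residue (zeta_kernel s ?w) 0 = residue (\<lambda>z. X z / z ^ Suc 1) 0"
  proof (rule residue_cong[OF _ refl])
    have "\<forall>\<^sub>F z in at 0. z \<in> A - {0}" by (rule eventually_at_in_open[OF A])
    thus "\<forall>\<^sub>F z in at 0. zeta_kernel s ?w z = X z / z ^ Suc 1"
    proof eventually_elim
      case (elim z)
      have "zeta (1 - z) = zeta_reg (1 - z) / (1 - z - 1)"
        using elim by (intro zeta_eq_zeta_reg) (auto simp: A_def)
      hence "zeta (1 - z) = - zeta_reg (1 - z) / z" by simp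
      moreover have "Gamma (z + 1) = z * Gamma z"
        using elim by (intro Gamma_plus1 not_nonpos_Ints_strip) (auto simp: A_def)
      moreover have "z \<noteq> 0" using elim by simp
      ultimately show ?case unfolding zeta_kernel_def X_def sw by (simp add: power2_eq_square)
    qed
  qed
  also have "\<dots> = (deriv ^^ 1) X 0 / fact 1"
  proof (rule residue_holomorphic_over_power'[OF A])
    have "z + 1 \<notin> \<int>\<^sub>\<le>\<^sub>0" "s - z \<notin> \<int>\<^sub>\<le>\<^sub>0" "z \<noteq> 1" "Re (1 - z) > -1" if "z \<in> A" for z
      using that by (auto simp: A_def s_def dest: nonpos_Ints_Re_D)
    thus "X holomorphic_on A" unfolding X_def by (intro holomorphic_intros) auto
  qed
  also have "(deriv ^^ 1) X 0 / fact 1 = deriv X 0" by simp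
  also have "deriv X 0 = - Gamma s * (Digamma s + 2 * euler_mascheroni - of_real (ln (2 * pi))) / 2"
  proof (rule DERIV_imp_deriv)
    have 1: "((\<lambda>z::complex. Gamma (z + 1)) has_field_derivative - euler_mascheroni) (at 0)"
    proof -
      have "(Gamma has_field_derivative Gamma 1 * Digamma 1) (at (1::complex))" by (rule has_field_derivative_Gamma) simp
      hence "(Gamma has_field_derivative - euler_mascheroni) (at (0 + 1 :: complex))" by (simp add: Digamma_1)
      thus ?thesis unfolding DERIV_shift .
    qed
    have 2: "((\<lambda>z. Gamma (s - z)) has_field_derivative (Gamma s * Digamma s) * (- 1)) (at 0)"
    proof (rule DERIV_chain2[of Gamma])
      have "s \<notin> \<int>\<^sub>\<le>\<^sub>0" by (rule not_nonpos_Ints_Re_pos) (simp add: s_def)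
      thus "(Gamma has_field_derivative Gamma s * Digamma s) (at (s - 0))" by (simp add: has_field_derivative_Gamma)
      show "((\<lambda>z. s - z) has_field_derivative - 1) (at 0)" by (auto intro!: derivative_eq_intros)
    qed
    have 3: "((\<lambda>z. zeta_reg (1 - z)) has_field_derivative of_real euler_mascheroni * (- 1)) (at 0)"
    proof (rule DERIV_chain2[of zeta_reg])
      show "(zeta_reg has_field_derivative of_real euler_mascheroni) (at (1 - 0))" using zeta_reg_deriv_1 by simp
      show "((\<lambda>z. 1 - z) has_field_derivative - 1) (at (0::complex))" by (auto intro!: derivative_eq_intros)
    qed
    have "(X has_field_derivative - ((- euler_mascheroni * Gamma (s - 0) + (Gamma s * Digamma s) * (- 1) * Gamma (0 + 1)) * (zeta 0 * zeta_reg (1 - 0))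
       + ((- of_real (ln (2 * pi)) / 2) * zeta_reg (1 - 0) + of_real euler_mascheroni * (- 1) * zeta 0) * (Gamma (0 + 1) * Gamma (s - 0)))) (at 0)"
      unfolding X_def by (intro DERIV_minus DERIV_mult 1 2 3 zeta_deriv_0)
    also have "- ((- euler_mascheroni * Gamma (s - 0) + (Gamma s * Digamma s) * (- 1) * Gamma (0 + 1)) * (zeta 0 * zeta_reg (1 - 0))
       + ((- of_real (ln (2 * pi)) / 2) * zeta_reg (1 - 0) + of_real euler_mascheroni * (- 1) * zeta 0) * (Gamma (0 + 1) * Gamma (s - 0)))
      = - Gamma s * (Digamma s + 2 * euler_mascheroni - of_real (ln (2 * pi))) / 2"
      by (simp add: zeta_0 zeta_reg_1 field_simps)
    finally show "(X has_field_derivative - Gamma s * (Digamma s + 2 * euler_mascheroni - of_real (ln (2 * pi))) / 2) (at 0)" .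
  qed
  finally show ?thesis .
qed

section \<open>Asymptotics of the Gamma quotient and of the digamma function\<close>

text \<open>For x = y + k one has y^2 + k^2 >= x^2 / 2 >= (x^2 - 1/4) / 2, and the reciprocals of
  x^2 - 1/4 telescope.\<close>

lemma sum_inverse_squares_shifted:
  fixes y :: real
  assumes "y \<ge> 1"
  shows "(\<Sum>k<n. 1 / (y\<^sup>2 + (real k)\<^sup>2)) \<le> 4 / y"
proof -
  have step: "1 / (y\<^sup>2 + (real k)\<^sup>2) \<le> 2 / (y + real k - 1 / 2) - 2 / (y + real (Suc k) - 1 / 2)" for k
  proof -
    define x where "x = y + real k"
    have x: "x \<ge> 1" using assms by (simp add: x_def)
    have pos: "(x - 1 / 2) * (x + 1 / 2) > 0" using x by (intro mult_pos_pos) auto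
    have "x\<^sup>2 \<le> 2 * (y\<^sup>2 + (real k)\<^sup>2)"
      using sum_squares_bound[of y "real k"] by (simp add: x_def power2_sum)
    moreover have "(x - 1 / 2) * (x + 1 / 2) \<le> x\<^sup>2" by (simp add: power2_eq_square algebra_simps)
    ultimately have le: "(x - 1 / 2) * (x + 1 / 2) / 2 \<le> y\<^sup>2 + (real k)\<^sup>2" by simp
    have "1 / (y\<^sup>2 + (real k)\<^sup>2) \<le> 1 / ((x - 1 / 2) * (x + 1 / 2) / 2)"
      using le pos by (intro divide_left_mono) auto
    also have "\<dots> = 2 / (x - 1 / 2) - 2 / (x + 1 / 2)" using x by (simp add: divide_simps)
    also have "x + 1 / 2 = y + real (Suc k) - 1 / 2" by (simp add: x_def)
    finally show ?thesis by (simp only: x_def)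
  qed
  have "(\<Sum>k<n. 1 / (y\<^sup>2 + (real k)\<^sup>2)) \<le> (\<Sum>k<n. 2 / (y + real k - 1 / 2) - 2 / (y + real (Suc k) - 1 / 2))"
    by (intro sum_mono step)
  also have "\<dots> = 2 / (y + real 0 - 1 / 2) - 2 / (y + real n - 1 / 2)"
    by (rule sum_lessThan_telescope')
  also have "\<dots> \<le> 2 / (y - 1 / 2)" using assms by simp
  also have "\<dots> \<le> 2 / (y / 2)" using assms by (intro divide_left_mono mult_pos_pos) auto
  finally show ?thesis by simp
qed

text \<open>The trapezoid rule for 1 / (z + x) on every unit interval; the half weight of the first
  end point produces 1 / (2 z). Since Re z >= 0, |z + k + x|^3 is at least y (y^2 + k^2) with y =
  |Im z|, and these errors add up to the bound.\<close>

lemma Digamma_asymp: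
  assumes re: "Re z \<ge> 0" and im: "\<bar>Im z\<bar> \<ge> 1"
  shows "norm (Digamma z - (Ln z - 1 / (2 * z))) \<le> 1 / (Im z)\<^sup>2"
proof -
  define y where "y = \<bar>Im z\<bar>"
  have y: "y \<ge> 1" using im by (simp add: y_def)
  have nr: "z + of_real x \<notin> \<real>\<^sub>\<le>\<^sub>0" "z + of_real x \<noteq> 0" for x
    using im by (auto simp: complex_nonpos_Reals_iff complex_eq_iff)
  define I where "I k = (1 / (z + of_nat k) + 1 / (z + of_nat (Suc k))) / 2 - (Ln (z + of_nat (Suc k)) - Ln (z + of_nat k))" for k :: nat
  have I_bound: "norm (I k) \<le> 1 / (4 * y) * (1 / (y\<^sup>2 + (real k)\<^sup>2))" for k
  proof -
    let ?F = "\<lambda>x. Ln (z + of_real (real k + x))" and ?f = "\<lambda>x. 1 / (z + of_real (real k + x))"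
    let ?f'' = "\<lambda>x. 2 / (z + of_real (real k + x)) ^ 3"
    have D: "((\<lambda>x. h (z + of_real (real k + x))) has_vector_derivative h') (at x within {0..1})"
      if "(h has_field_derivative h') (at (z + of_real (real k + x)))" for h h' and x :: real
    proof -
      have "((\<lambda>x. z + complex_of_real (real k + x)) has_vector_derivative 1) (at x within {0..1})"
        by (auto intro!: derivative_eq_intros has_vector_derivative_of_real[where D = 1, simplified] simp: has_vector_derivative_def scaleR_conv_of_real)
      from field_vector_diff_chain_within[OF this has_field_derivative_at_within[OF that]]
      show ?thesis by (simp add: o_def)
    qed
    have tr: "((\<lambda>x. of_real (x * (1 - x) / 2) * ?f'' x) has_integral ((?f 0 + ?f 1) / 2 - (?F 1 - ?F 0))) {0..1}"
    proof (rule trapezoid_rule_has_integral)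
      fix x :: real
      show "(?F has_vector_derivative ?f x) (at x within {0..1})"
        by (rule D[of Ln], unfold inverse_eq_divide[symmetric], rule has_field_derivative_Ln[OF nr(1)])
      show "(?f has_vector_derivative - 1 / (z + of_real (real k + x)) ^ 2) (at x within {0..1})"
      proof (rule D[of "\<lambda>z. 1 / z"])
        define q where "q = z + of_real (real k + x)"
        have q: "q \<noteq> 0" unfolding q_def by (rule nr)
        have "((\<lambda>z. 1 / z) has_field_derivative - 1 / q ^ 2) (at q)"
          using q by (auto intro!: derivative_eq_intros simp: power2_eq_square)
        thus "((\<lambda>z. 1 / z) has_field_derivative - 1 / (z + of_real (real k + x)) ^ 2) (at (z + of_real (real k + x)))"
          unfolding q_def .
      qed
      show "((\<lambda>x. - 1 / (z + of_real (real k + x)) ^ 2) has_vector_derivative ?f'' x) (at x within {0..1})"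
      proof (rule D[of "\<lambda>z. - 1 / z ^ 2"])
        define q where "q = z + of_real (real k + x)"
        have q: "q \<noteq> 0" unfolding q_def by (rule nr)
        have "((\<lambda>z. - 1 / z ^ 2) has_field_derivative (2 * q) / (q ^ 2 * q ^ 2)) (at q)"
          using q by (auto intro!: derivative_eq_intros)
        also have "(2 * q) / (q ^ 2 * q ^ 2) = 2 / q ^ 3" using q by (simp add: divide_simps power3_eq_cube power2_eq_square)
        finally show "((\<lambda>z. - 1 / z ^ 2) has_field_derivative 2 / (z + of_real (real k + x)) ^ 3) (at (z + of_real (real k + x)))"
          unfolding q_def .
      qed
    qed
    have "norm (integral {0..1} (\<lambda>x. of_real (x * (1 - x) / 2) * ?f'' x)) \<le> integral {0..1} (\<lambda>x::real. 1 / (4 * y) * (1 / (y\<^sup>2 + (real k)\<^sup>2)))"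
    proof (rule integral_norm_bound_integral[OF has_integral_integrable[OF tr] integrable_const_ivl])
      fix x :: real assume "x \<in> {0..1}"
      hence x: "0 \<le> x" "x \<le> 1" by auto
      define q where "q = z + of_real (real k + x)"
      have q1: "norm q \<ge> y" using abs_Im_le_cmod[of q] by (simp add: q_def y_def)
      have q2: "(norm q)\<^sup>2 \<ge> y\<^sup>2 + (real k)\<^sup>2"
      proof -
        have "(real k)\<^sup>2 \<le> (Re z + (real k + x))\<^sup>2" using re x by (intro power_mono) auto
        thus ?thesis by (simp add: cmod_power2 q_def y_def)
      qed
      have pos: "y\<^sup>2 + (real k)\<^sup>2 > 0" using y by (intro add_pos_nonneg) auto
      have "x * (1 - x) / 2 \<le> 1 / 8"
        using zero_le_power2[of "x - 1 / 2"] by (simp add: power2_eq_square algebra_simps)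
      moreover have "0 \<le> x * (1 - x) / 2" using x by simp
      ultimately have "norm (complex_of_real (x * (1 - x) / 2)) \<le> 1 / 8" unfolding norm_of_real by (simp only: abs_of_nonneg)
      moreover have "norm (2 / q ^ 3) \<le> 2 / (y * (y\<^sup>2 + (real k)\<^sup>2))"
      proof -
        have "y * (y\<^sup>2 + (real k)\<^sup>2) \<le> norm q * (norm q)\<^sup>2" using q1 q2 y pos by (intro mult_mono) auto
        also have "\<dots> = norm (q ^ 3)" by (simp add: norm_mult power3_eq_cube power2_eq_square)
        finally show ?thesis unfolding norm_divide using y pos by (intro divide_mono) auto
      qed
      ultimately have "norm (complex_of_real (x * (1 - x) / 2) * (2 / q ^ 3)) \<le> 1 / 8 * (2 / (y * (y\<^sup>2 + (real k)\<^sup>2)))"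
        unfolding norm_mult by (intro mult_mono) auto
      thus "norm (complex_of_real (x * (1 - x) / 2) * (2 / (z + of_real (real k + x)) ^ 3)) \<le> 1 / (4 * y) * (1 / (y\<^sup>2 + (real k)\<^sup>2))"
        by (simp add: q_def)
    qed
    moreover have "integral {0..1} (\<lambda>x. of_real (x * (1 - x) / 2) * ?f'' x) = (?f 0 + ?f 1) / 2 - (?F 1 - ?F 0)"
      by (rule integral_unique[OF tr])
    moreover have "(?f 0 + ?f 1) / 2 - (?F 1 - ?F 0) = I k" by (simp add: I_def add_ac)
    ultimately show ?thesis by simp
  qed
  have sumI: "(\<Sum>k<n. I k) = (\<Sum>k<n. inverse (z + of_nat k)) + 1 / (2 * (z + of_nat n)) - 1 / (2 * z) - Ln (z + of_nat n) + Ln z" for n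
  proof (induction n)
    case (Suc n)
    have half: "1 / (2 * a) = 1 / a / 2" "(a + b) / 2 = a - a / 2 + b / 2" for a b :: complex
      by (simp_all add: field_simps)
    show ?case unfolding sum.lessThan_Suc Suc unfolding I_def inverse_eq_divide half by simp
  qed simp
  have bound: "norm (\<Sum>k<n. I k) \<le> 1 / (Im z)\<^sup>2" for n
  proof -
    have "norm (\<Sum>k<n. I k) \<le> (\<Sum>k<n. 1 / (4 * y) * (1 / (y\<^sup>2 + (real k)\<^sup>2)))"
      by (rule sum_norm_le) (rule I_bound)
    also have "\<dots> = 1 / (4 * y) * (\<Sum>k<n. 1 / (y\<^sup>2 + (real k)\<^sup>2))" by (simp add: sum_distrib_left)
    also have "\<dots> \<le> 1 / (4 * y) * (4 / y)" using y by (intro mult_left_mono sum_inverse_squares_shifted) auto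
    also have "\<dots> = 1 / (Im z)\<^sup>2" using y by (simp add: y_def power2_eq_square)
    finally show ?thesis .
  qed
  \<comment> \<open>Reconciles the ln n in the limit formula for Digamma with the Ln (z + n) that
    the telescoped trapezoid sums produce.\<close>
  have l1: "(\<lambda>n. Ln (z + of_nat n) - of_real (ln (real n))) \<longlonglongrightarrow> 0"
  proof (rule Lim_transform_eventually)
    have "(\<lambda>n. 1 + z * of_real (1 / real n)) \<longlonglongrightarrow> 1 + z * of_real 0"
      by (intro tendsto_intros)
    hence "(\<lambda>n. Ln (1 + z * of_real (1 / real n))) \<longlonglongrightarrow> Ln 1" by (intro tendsto_Ln) auto
    thus "(\<lambda>n. Ln (1 + z * of_real (1 / real n))) \<longlonglongrightarrow> 0" by simp
    show "\<forall>\<^sub>F n in sequentially. Ln (1 + z * of_real (1 / real n)) = Ln (z + of_nat n) - of_real (ln (real n))"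
      using eventually_gt_at_top[of 0]
    proof eventually_elim
      case (elim n)
      have "1 + z * of_real (1 / real n) = (z + of_nat n) / of_real (real n)" using elim by (simp add: field_simps)
      also have "Ln \<dots> = Ln (z + of_nat n) - of_real (ln (real n))"
        using elim nr(2)[of "real n"] by (subst Ln_divide_of_real) (auto simp: Ln_of_real)
      finally show ?case .
    qed
  qed
  have l2: "(\<lambda>n. 1 / (2 * (z + of_nat n))) \<longlonglongrightarrow> 0"
    by (intro tendsto_divide_0[OF tendsto_const] tendsto_mult_filterlim_at_infinity[of _ 2] tendsto_add_filterlim_at_infinity[OF tendsto_const] tendsto_of_nat tendsto_const) auto
  have "z \<noteq> 0" using im by auto
  note Dg = Digamma_LIMSEQ[OF this]
  have "(\<lambda>n. - (of_real (ln (real n)) - (\<Sum>k<n. inverse (z + of_nat k))) + 1 / (2 * (z + of_nat n)) - 1 / (2 * z) - (Ln (z + of_nat n) - of_real (ln (real n))) + Ln z)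
     \<longlonglongrightarrow> - Digamma z + 0 - 1 / (2 * z) - 0 + Ln z"
    by (intro tendsto_intros l1 l2 Dg)
  also have "(\<lambda>n. - (of_real (ln (real n)) - (\<Sum>k<n. inverse (z + of_nat k))) + 1 / (2 * (z + of_nat n)) - 1 / (2 * z) - (Ln (z + of_nat n) - of_real (ln (real n))) + Ln z)
     = (\<lambda>n. \<Sum>k<n. I k)" unfolding sumI by (intro ext) simp
  finally have lim: "(\<lambda>n. \<Sum>k<n. I k) \<longlonglongrightarrow> - Digamma z + 0 - 1 / (2 * z) - 0 + Ln z" .
  have "norm (- Digamma z + 0 - 1 / (2 * z) - 0 + Ln z) \<le> 1 / (Im z)\<^sup>2"
    by (rule Lim_bounded[OF tendsto_norm[OF lim], of 0]) (simp add: bound)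
  also have "- Digamma z + 0 - 1 / (2 * z) - 0 + Ln z = - (Digamma z - (Ln z - 1 / (2 * z)))" by simp
  finally show ?thesis by (simp only: norm_minus_cancel)
qed

text \<open>Taking real parts is essential: Ln z has imaginary part near pi / 2, and 1 / (2 z) is of
  size 1 / t but nearly imaginary, with real part of size 1 / t^2. This is why A needs no error of
  order 1 / t at \<sigma> = 1/2.\<close>

lemma Re_Digamma_half_line:
  assumes t: "t \<ge> 1"
  shows "\<bar>Re (Digamma (Complex (1/2) t)) - ln t\<bar> \<le> 2 / t\<^sup>2"
proof -
  let ?z = "Complex (1/2) t"
  have "norm (Digamma ?z - (Ln ?z - 1 / (2 * ?z))) \<le> 1 / t\<^sup>2" using Digamma_asymp[of ?z] t by simp
  hence 1: "\<bar>Re (Digamma ?z) - (Re (Ln ?z) - Re (1 / (2 * ?z)))\<bar> \<le> 1 / t\<^sup>2"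
    using abs_Re_le_cmod[of "Digamma ?z - (Ln ?z - 1 / (2 * ?z))"] by simp
  have nz: "(norm ?z)\<^sup>2 = t\<^sup>2 + 1 / 4" by (simp add: cmod_power2) (simp add: power2_eq_square)
  have z0: "?z \<noteq> 0" by (simp add: complex_eq_iff)
  have t2: "t\<^sup>2 > 0" using t by simp
  have "2 * Re (Ln ?z) = ln ((norm ?z)\<^sup>2)" using z0 by (simp add: ln_realpow)
  also have "(norm ?z)\<^sup>2 = t\<^sup>2 * (1 + 1 / (4 * t\<^sup>2))" unfolding nz using t2 by (simp add: field_simps)
  also have "ln (t\<^sup>2 * (1 + 1 / (4 * t\<^sup>2))) = 2 * ln t + ln (1 + 1 / (4 * t\<^sup>2))"
    using t t2 by (subst ln_mult_pos) (auto simp: ln_realpow add_pos_nonneg)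
  finally have "Re (Ln ?z) = ln t + ln (1 + 1 / (4 * t\<^sup>2)) / 2" by simp
  moreover have "0 \<le> ln (1 + 1 / (4 * t\<^sup>2))" using t2 by simp
  moreover have "ln (1 + 1 / (4 * t\<^sup>2)) \<le> 1 / (4 * t\<^sup>2)" using t2 by (intro ln_add_one_self_le_self) simp
  moreover have "0 \<le> 1 / (4 * t\<^sup>2)" by simp
  ultimately have 2: "ln t \<le> Re (Ln ?z)" "Re (Ln ?z) \<le> ln t + 1 / (4 * t\<^sup>2)"
    by linarith+
  have "Re (1 / (2 * ?z)) = 1 / (4 * (t\<^sup>2 + 1 / 4))"
  proof -
    have "Re (1 / (2 * ?z)) = Re (2 * ?z) / (norm (2 * ?z))\<^sup>2" by (simp add: Re_divide cmod_power2) (simp add: power2_eq_square)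
    also have "(norm (2 * ?z))\<^sup>2 = 4 * (norm ?z)\<^sup>2" by (simp add: norm_mult power_mult_distrib)
    finally show ?thesis unfolding nz by simp
  qed
  hence 3: "0 \<le> Re (1 / (2 * ?z))" "Re (1 / (2 * ?z)) \<le> 1 / (4 * t\<^sup>2)"
    using t2 by (auto intro!: divide_left_mono mult_pos_pos add_pos_pos)
  have "2 * (1 / (4 * t\<^sup>2)) \<le> 1 / t\<^sup>2" using t2 by (simp add: field_simps)
  moreover have "2 / t\<^sup>2 = 1 / t\<^sup>2 + 1 / t\<^sup>2" by simp
  ultimately show ?thesis using 1 2 3 by linarith
qed

text \<open>With the constant L = Ln (it), the function ln_Gamma z - z L has derivative Digamma z -
  L = O(1 / t) on the horizontal segment between \<sigma> + it and 1 - \<sigma> + it. The quotient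
  is therefore (it)^(1 - 2 \<sigma>) up to a factor 1 + O(1 / t).\<close>

lemma Gamma_ratio_asymp:
  assumes \<sigma>: "0 < \<sigma>" "\<sigma> < 1" and t: "t \<ge> 2"
  shows "\<bar>Re (Gamma (Complex (1 - \<sigma>) t) / Gamma (Complex \<sigma> t)) - t powr (1 - 2 * \<sigma>) * sin (pi * \<sigma>)\<bar>
    \<le> 4 * exp 2 * t powr (1 - 2 * \<sigma>) / t"
proof -
  define L where "L = Ln (\<i> * of_real t)"
  have L: "L = of_real (ln t) + \<i> * of_real (pi / 2)"
    using t Ln_times_of_real[of t \<i>] by (simp add: L_def mult.commute Ln_of_real)
  \<comment> \<open>The horizontal segment at height t, written as an intersection of half-planes to
    obtain convexity.\<close>
  define S where "S = {z. Re z > 0} \<inter> {z. Re z < 1} \<inter> {z. Im z \<ge> t} \<inter> {z. Im z \<le> t}"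
  have S: "convex S" unfolding S_def
    by (intro convex_Int convex_halfspace_Re_gt convex_halfspace_Re_lt convex_halfspace_Im_ge convex_halfspace_Im_le)
  define \<Lambda> where "\<Lambda> z = ln_Gamma z - z * L" for z
  have "norm (\<Lambda> (Complex (1 - \<sigma>) t) - \<Lambda> (Complex \<sigma> t)) \<le> 4 / t * norm (Complex (1 - \<sigma>) t - Complex \<sigma> t)"
  proof (rule field_differentiable_bound[OF S, where f' = "\<lambda>z. Digamma z - L"])
    fix z assume "z \<in> S"
    hence z: "0 < Re z" "Re z < 1" "Im z = t" by (auto simp: S_def)
    have "z \<notin> \<real>\<^sub>\<le>\<^sub>0" using z t by (auto simp: complex_nonpos_Reals_iff)
    thus "(\<Lambda> has_field_derivative Digamma z - L) (at z within S)"
      unfolding \<Lambda>_def by (auto intro!: derivative_eq_intros)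
    have z0: "z \<noteq> 0" using z by auto
    have nz: "norm z \<ge> t" using abs_Im_le_cmod[of z] z t by simp
    have 1: "norm (Digamma z - (Ln z - 1 / (2 * z))) \<le> 1 / t\<^sup>2" using Digamma_asymp[of z] z t by simp
    have "1 / t\<^sup>2 \<le> 1 / (2 * t)" using t by (simp add: field_simps power2_eq_square)
    have 2: "norm (1 / (2 * z)) \<le> 1 / (2 * t)"
      using nz t z0 by (simp add: norm_divide norm_mult divide_left_mono)
    have 3: "norm (Ln z - L) \<le> 2 * (1 / t)"
    proof -
      \<comment> \<open>z = it (1 + x), where 1 + x has real part 1, so that the principal
        logarithms simply add.\<close>
      define x where "x = - \<i> * of_real (Re z / t)"
      have nx: "norm x < 1 / t" using z t by (simp add: x_def norm_mult norm_divide divide_strict_right_mono)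
      also have "1 / t \<le> 1 / 2" using t by simp
      finally have nx': "norm x < 1 / 2" .
      have zx: "z = of_real t * (\<i> * (1 + x))" using t z by (simp add: x_def complex_eq_iff)
      have re: "Re (1 + x) = 1" by (simp add: x_def)
      have "Ln z = of_real (ln t) + Ln (\<i> * (1 + x))"
      proof -
        have "1 + x \<noteq> 0" using re by (metis zero_complex.sel(1) zero_neq_one)
        thus ?thesis unfolding zx using t by (subst Ln_times_of_real) (auto simp: Ln_of_real)
      qed
      also have "Ln (\<i> * (1 + x)) = \<i> * of_real pi / 2 + Ln (1 + x)"
      proof -
        have "1 + x \<noteq> 0" using re by (metis zero_complex.sel(1) zero_neq_one)
        have "\<bar>Im (Ln (1 + x))\<bar> < pi / 2" using Re_Ln_pos_lt[OF \<open>1 + x \<noteq> 0\<close>] re by simp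
        thus ?thesis using \<open>1 + x \<noteq> 0\<close> by (subst Ln_times_simple) (auto simp: abs_less_iff)
      qed
      finally have "Ln z - L = Ln (1 + x)" by (simp add: L)
      moreover have "norm (Ln (1 + x)) \<le> 2 * norm x" by (rule norm_Ln_le) (use nx' in simp)
      ultimately show ?thesis using nx by simp
    qed
    have "Digamma z - L = (Digamma z - (Ln z - 1 / (2 * z))) - 1 / (2 * z) + (Ln z - L)" by simp
    also have "norm \<dots> \<le> norm (Digamma z - (Ln z - 1 / (2 * z))) + norm (1 / (2 * z)) + norm (Ln z - L)"
    proof -
      have "norm (a - b + c) \<le> norm a + norm b + norm c" for a b c :: complex
        using norm_triangle_ineq[of "a - b" c] norm_triangle_ineq4[of a b] by simp
      thus ?thesis .
    qed
    also have "\<dots> \<le> 1 / (2 * t) + 1 / (2 * t) + 2 * (1 / t)" using 1 2 3 \<open>1 / t\<^sup>2 \<le> 1 / (2 * t)\<close> by linarith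
    also have "\<dots> \<le> 4 / t" using t by (simp add: field_simps)
    finally show "norm (Digamma z - L) \<le> 4 / t" .
  qed (use \<sigma> in \<open>auto simp: S_def\<close>)
  also have "Complex (1 - \<sigma>) t - Complex \<sigma> t = of_real (1 - 2 * \<sigma>)" by (simp add: complex_eq_iff)
  also have "4 / t * norm (complex_of_real (1 - 2 * \<sigma>)) \<le> 4 / t * 1"
    using \<sigma> t unfolding norm_of_real by (intro mult_left_mono) auto
  finally have \<Lambda>: "norm (\<Lambda> (Complex (1 - \<sigma>) t) - \<Lambda> (Complex \<sigma> t)) \<le> 4 / t" by simp
  define \<delta> where "\<delta> = \<Lambda> (Complex (1 - \<sigma>) t) - \<Lambda> (Complex \<sigma> t)"
  \<comment> \<open>The power (it)^(1 - 2 \<sigma>); its argument (1 - 2 \<sigma>) pi / 2 turns into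
    sin (pi \<sigma>) in the real part.\<close>
  define X where "X = exp (of_real (1 - 2 * \<sigma>) * L)"
  have ex: "Gamma z = exp (ln_Gamma z)" if "Im z = t" for z
    using that t by (intro Gamma_complex_altdef[THEN trans]) (auto simp: complex_nonpos_Reals_iff elim!: nonpos_Ints_cases)
  have ratio: "Gamma (Complex (1 - \<sigma>) t) / Gamma (Complex \<sigma> t) = X * exp \<delta>"
  proof -
    have "Complex (1 - \<sigma>) t - Complex \<sigma> t = of_real (1 - 2 * \<sigma>)" by (simp add: complex_eq_iff)
    moreover have "ln_Gamma (Complex (1 - \<sigma>) t) - ln_Gamma (Complex \<sigma> t) = (Complex (1 - \<sigma>) t - Complex \<sigma> t) * L + \<delta>"
      unfolding \<delta>_def \<Lambda>_def by (simp add: algebra_simps)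
    ultimately have "ln_Gamma (Complex (1 - \<sigma>) t) - ln_Gamma (Complex \<sigma> t) = of_real (1 - 2 * \<sigma>) * L + \<delta>"
      by (simp only:)
    thus ?thesis by (simp add: ex exp_diff[symmetric] exp_add[symmetric] X_def)
  qed
  have "X = of_real (exp ((1 - 2 * \<sigma>) * ln t)) * exp (\<i> * of_real ((1 - 2 * \<sigma>) * (pi / 2)))"
  proof -
    have "of_real (1 - 2 * \<sigma>) * L = of_real ((1 - 2 * \<sigma>) * ln t) + \<i> * of_real ((1 - 2 * \<sigma>) * (pi / 2))"
      by (simp add: L complex_eq_iff)
    thus ?thesis unfolding X_def by (simp only: exp_add exp_of_real)
  qed
  also have "exp ((1 - 2 * \<sigma>) * ln t) = t powr (1 - 2 * \<sigma>)" using t by (simp add: powr_def)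
  finally have X: "X = of_real (t powr (1 - 2 * \<sigma>)) * cis ((1 - 2 * \<sigma>) * (pi / 2))"
    by (simp add: cis_conv_exp)
  have "Re X = t powr (1 - 2 * \<sigma>) * cos (pi / 2 - pi * \<sigma>)"
    unfolding X by (simp add: algebra_simps)
  also have "cos (pi / 2 - pi * \<sigma>) = sin (pi * \<sigma>)" by (simp add: cos_diff)
  finally have ReX: "Re X = t powr (1 - 2 * \<sigma>) * sin (pi * \<sigma>)" .
  have nX: "norm X = t powr (1 - 2 * \<sigma>)" unfolding X norm_mult by simp
  have \<delta>: "norm \<delta> \<le> 4 / t" using \<Lambda> by (simp only: \<delta>_def)
  have "norm (exp \<delta> - 1) \<le> 4 * exp 2 / t"
  proof -
    have "4 / t \<le> 2" using t by (simp add: divide_le_eq)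
    hence "norm \<delta> \<le> 2" using \<delta> by linarith
    \<comment> \<open>Mean value bound for exp on the disc of radius 2; t >= 2 places \<delta> in it
      and accounts for exp 2 in the constant.\<close>
    have "norm (exp \<delta> - exp 0) \<le> exp 2 * norm (\<delta> - 0)"
    proof (rule field_differentiable_bound[OF convex_cball[of 0 2], where f' = exp])
      fix z :: complex assume "z \<in> cball 0 2"
      thus "norm (exp z) \<le> exp 2" using complex_Re_le_cmod[of z] by (simp add: norm_exp_eq_Re)
    qed (use \<open>norm \<delta> \<le> 2\<close> in \<open>auto intro!: derivative_eq_intros\<close>)
    also have "\<dots> \<le> exp 2 * (4 / t)" using \<delta> by (intro mult_left_mono) auto
    finally show ?thesis by (simp add: mult.commute)
  qed
  have "norm (X * exp \<delta> - X) \<le> t powr (1 - 2 * \<sigma>) * (4 * exp 2 / t)"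
  proof -
    have "X * exp \<delta> - X = X * (exp \<delta> - 1)" by (simp add: algebra_simps)
    thus ?thesis using \<open>norm (exp \<delta> - 1) \<le> _\<close> unfolding nX[symmetric] by (simp only: norm_mult mult_left_mono norm_ge_zero)
  qed
  hence "\<bar>Re (X * exp \<delta>) - Re X\<bar> \<le> t powr (1 - 2 * \<sigma>) * (4 * exp 2 / t)"
    using abs_Re_le_cmod[of "X * exp \<delta> - X"] by simp
  thus ?thesis unfolding ratio ReX by (simp add: mult_ac)
qed

section \<open>Tails and principal values\<close>

text \<open>The exponent is 0 for u between 0 and t and falls at the rate pi with the distance from
  [0, t]. The seventh power consists of one factor from Gamma and six from the square of
  zeta.\<close>

lemma zeta_integrand_bound:
  assumes \<sigma>: "0 < \<sigma>" "\<sigma> < 1"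
  obtains C where "C > 0" "\<And>t u. t \<ge> 1 \<Longrightarrow> \<bar>u\<bar> \<ge> 1 \<Longrightarrow> \<bar>t - u\<bar> \<ge> 1 \<Longrightarrow>
     \<bar>zeta_integrand \<sigma> t (u / t)\<bar> \<le> C * (1 + t) * ((1 + \<bar>t - u\<bar>) * (1 + \<bar>u\<bar>) ^ 7) * exp (- (pi / 2 * (\<bar>t - u\<bar> + \<bar>u\<bar> - t)))"
proof -
  obtain K where K: "K > 0" "\<And>z. \<sigma> \<le> Re z \<Longrightarrow> Re z \<le> \<sigma> \<Longrightarrow> norm (zeta_reg z) \<le> K * (1 + \<bar>Im z\<bar>) ^ 3"
    using zeta_strip_bound[of \<sigma> \<sigma>] \<sigma> by auto
  define G0 where "G0 = Gamma \<sigma>"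
  define G1 where "G1 = Gamma (\<sigma> + 1)"
  have G: "G0 > 0" "G1 > 0" using \<sigma> by (auto simp: G0_def G1_def intro!: Gamma_real_pos)
  define C where "C = 49 * G0 / G1 * K\<^sup>2"
  have seven: "1 + 7 * \<bar>y\<bar> \<le> 7 * (1 + \<bar>y\<bar>)" for y :: real by simp
  have "\<bar>zeta_integrand \<sigma> t (u / t)\<bar> \<le> C * (1 + t) * ((1 + \<bar>t - u\<bar>) * (1 + \<bar>u\<bar>) ^ 7) * exp (- (pi / 2 * (\<bar>t - u\<bar> + \<bar>u\<bar> - t)))"
    if t: "t \<ge> 1" and u: "\<bar>u\<bar> \<ge> 1" "\<bar>t - u\<bar> \<ge> 1" for t u
  proof -
    define e where "e x = exp (- (pi * \<bar>x\<bar> / 2))" for x :: real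
    have e: "e x > 0" for x by (simp add: e_def)
    have 1: "norm (Gamma (Complex 0 (t - u))) \<le> 7 * (1 + \<bar>t - u\<bar>) * e (t - u)"
    proof -
      have "Gamma (Complex 0 (t - u)) = Gamma (Complex 1 (t - u)) / Complex 0 (t - u)"
      proof -
        have "Complex 0 (t - u) + 1 = Complex 1 (t - u)" by (simp add: complex_eq_iff)
        moreover have "Gamma (Complex 0 (t - u)) = Gamma (Complex 0 (t - u) + 1) / Complex 0 (t - u)"
          by (rule Gamma_shift_down) (use u(2) in auto)
        ultimately show ?thesis by (simp only:)
      qed
      hence "norm (Gamma (Complex 0 (t - u))) = norm (Gamma (Complex 1 (t - u))) / norm (Complex 0 (t - u))"
        by (simp add: norm_divide)
      also have "\<dots> \<le> norm (Gamma (Complex 1 (t - u))) / 1"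
        using u(2) by (intro divide_left_mono) (auto simp: cmod_def)
      also have "\<dots> \<le> (1 + 7 * \<bar>t - u\<bar>) * e (t - u)" using norm_Gamma_1_upper[of "t - u"] by (simp add: e_def)
      also have "\<dots> \<le> 7 * (1 + \<bar>t - u\<bar>) * e (t - u)" using e seven by (intro mult_right_mono) (auto intro: less_imp_le)
      finally show ?thesis .
    qed
    have 2: "norm (Gamma (Complex \<sigma> u)) \<le> G0 * (7 * (1 + \<bar>u\<bar>) * e u)"
    proof -
      have "norm (Gamma (Complex \<sigma> u)) / Gamma \<sigma> \<le> norm (Gamma (Complex 1 u)) / Gamma 1"
        using \<sigma> by (intro norm_Gamma_ratio_le) auto
      hence "norm (Gamma (Complex \<sigma> u)) \<le> G0 * norm (Gamma (Complex 1 u))"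
        using G by (simp add: G0_def field_simps)
      also have "\<dots> \<le> G0 * ((1 + 7 * \<bar>u\<bar>) * e u)" using norm_Gamma_1_upper[of u] G by (intro mult_left_mono) (auto simp: e_def)
      also have "\<dots> \<le> G0 * (7 * (1 + \<bar>u\<bar>) * e u)" using e seven G by (intro mult_left_mono mult_right_mono) (auto intro: less_imp_le)
      finally show ?thesis .
    qed
    \<comment> \<open>A lower bound for |Gamma (\<sigma> + it)| is reached through Gamma (\<sigma> +
      1 + it), because the comparison in the real part has to start from the line Re z = 1, where a
      lower bound is known.\<close>
    have 3: "1 / norm (Gamma (Complex \<sigma> t)) \<le> (1 + t) / G1 * exp (pi * t / 2)"
    proof -
      have "norm (Gamma (Complex 1 t)) / Gamma 1 \<le> norm (Gamma (Complex (\<sigma> + 1) t)) / Gamma (\<sigma> + 1)"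
        using \<sigma> by (intro norm_Gamma_ratio_le) auto
      hence "G1 * norm (Gamma (Complex 1 t)) \<le> norm (Gamma (Complex (\<sigma> + 1) t))"
        using G by (simp add: G1_def field_simps)
      moreover have "G1 * exp (- (pi * t / 2)) \<le> G1 * norm (Gamma (Complex 1 t))"
        using norm_Gamma_1_lower[of t] t G by (intro mult_left_mono) auto
      moreover have "Gamma (Complex \<sigma> t) = Gamma (Complex (\<sigma> + 1) t) / Complex \<sigma> t"
      proof -
        have "Complex \<sigma> t + 1 = Complex (\<sigma> + 1) t" by (simp add: complex_eq_iff)
        moreover have "Gamma (Complex \<sigma> t) = Gamma (Complex \<sigma> t + 1) / Complex \<sigma> t"
          by (rule Gamma_shift_down) (use t in auto)
        ultimately show ?thesis by (simp only:)
      qed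
      hence "norm (Gamma (Complex (\<sigma> + 1) t)) = norm (Gamma (Complex \<sigma> t)) * norm (Complex \<sigma> t)"
      proof -
        assume e: "Gamma (Complex \<sigma> t) = Gamma (Complex (\<sigma> + 1) t) / Complex \<sigma> t"
        have "Complex \<sigma> t \<noteq> 0" using t by (simp add: complex_eq_iff)
        thus ?thesis unfolding e by (simp add: norm_divide)
      qed
      moreover have "norm (Gamma (Complex \<sigma> t)) * norm (Complex \<sigma> t) \<le> norm (Gamma (Complex \<sigma> t)) * (1 + t)"
        using cmod_le[of "Complex \<sigma> t"] \<sigma> t by (intro mult_left_mono) auto
      ultimately have le: "G1 * exp (- (pi * t / 2)) \<le> norm (Gamma (Complex \<sigma> t)) * (1 + t)" by linarith
      have p: "G1 * exp (- (pi * t / 2)) > 0" using G by simp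
      have n0: "norm (Gamma (Complex \<sigma> t)) > 0" 
      proof (rule ccontr)
        assume "\<not> norm (Gamma (Complex \<sigma> t)) > 0"
        hence "norm (Gamma (Complex \<sigma> t)) = 0" by simp
        with le p show False by simp
      qed
      have "1 / norm (Gamma (Complex \<sigma> t)) \<le> (1 + t) / (G1 * exp (- (pi * t / 2)))"
        using le p n0 by (simp add: field_simps)
      also have "\<dots> = (1 + t) / G1 * exp (pi * t / 2)" by (simp add: exp_minus field_simps)
      finally show ?thesis .
    qed
    have 4: "(norm (zeta (Complex \<sigma> u)))\<^sup>2 \<le> (K * (1 + \<bar>u\<bar>) ^ 3)\<^sup>2"
    proof (intro power_mono)
      have n: "1 \<le> norm (Complex \<sigma> u - 1)" using abs_Im_le_cmod[of "Complex \<sigma> u - 1"] u by simp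
      hence "Complex \<sigma> u \<noteq> 1" by auto
      hence "norm (zeta (Complex \<sigma> u)) = norm (zeta_reg (Complex \<sigma> u)) / norm (Complex \<sigma> u - 1)"
        using \<sigma> by (simp add: zeta_eq_zeta_reg norm_divide)
      also have "\<dots> \<le> norm (zeta_reg (Complex \<sigma> u)) / 1" using n by (intro divide_left_mono) auto
      also have "\<dots> \<le> K * (1 + \<bar>u\<bar>) ^ 3" using K(2)[of "Complex \<sigma> u"] by simp
      finally show "norm (zeta (Complex \<sigma> u)) \<le> K * (1 + \<bar>u\<bar>) ^ 3" .
    qed simp
    have args: "\<i> * of_real t - \<i> * of_real (u / t) * of_real t = Complex 0 (t - u)" "of_real \<sigma> + \<i> * of_real t = Complex \<sigma> t"
          "of_real \<sigma> + \<i> * of_real (u / t) * of_real t = Complex \<sigma> u"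
      using t by (auto simp: complex_eq_iff)
    have "\<bar>zeta_integrand \<sigma> t (u / t)\<bar> \<le> norm (Gamma (Complex 0 (t - u)) / Gamma (Complex \<sigma> t) * Gamma (Complex \<sigma> u)) * (norm (zeta (Complex \<sigma> u)))\<^sup>2"
      unfolding zeta_integrand_def args abs_mult using abs_Re_le_cmod by (intro mult_mono) auto
    also have "\<dots> = norm (Gamma (Complex 0 (t - u))) * norm (Gamma (Complex \<sigma> u)) * (1 / norm (Gamma (Complex \<sigma> t))) * (norm (zeta (Complex \<sigma> u)))\<^sup>2"
      by (simp add: norm_mult norm_divide)
    also have "\<dots> \<le> (7 * (1 + \<bar>t - u\<bar>) * e (t - u)) * (G0 * (7 * (1 + \<bar>u\<bar>) * e u)) * ((1 + t) / G1 * exp (pi * t / 2)) * (K * (1 + \<bar>u\<bar>) ^ 3)\<^sup>2"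
      using e G t by (intro mult_mono 1 2 3 4 mult_nonneg_nonneg) (auto intro: less_imp_le)
    also have "\<dots> = C * (1 + t) * ((1 + \<bar>t - u\<bar>) * ((1 + \<bar>u\<bar>) * ((1 + \<bar>u\<bar>) ^ 3)\<^sup>2)) * (e (t - u) * e u * exp (pi * t / 2))"
      by (simp add: C_def power_mult_distrib) (simp add: algebra_simps)
    also have "(1 + \<bar>u\<bar>) * ((1 + \<bar>u\<bar>) ^ 3)\<^sup>2 = (1 + \<bar>u\<bar>) ^ 7" by (simp add: power_mult[symmetric] flip: power_Suc)
    also have "e (t - u) * e u * exp (pi * t / 2) = exp (- (pi / 2 * (\<bar>t - u\<bar> + \<bar>u\<bar> - t)))"
      unfolding e_def exp_add[symmetric] by (simp add: algebra_simps)
    finally show ?thesis .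
  qed
  moreover have "C > 0" using G K by (simp add: C_def)
  ultimately show ?thesis using that by blast
qed

text \<open>At distance v from [0, t] the exponential is at most exp (- 3 v). A factor exp v is
  spent on the polynomial; of the remaining exp (- 2 v), one half gives exp (- D) and the other an
  integrable function.\<close>

lemma zeta_integrand_tail_bound:
  assumes \<sigma>: "0 < \<sigma>" "\<sigma> < 1"
  obtains C where "C > 0" "\<And>t u D. t \<ge> 1 \<Longrightarrow> D \<ge> 1 \<Longrightarrow> u \<le> - D \<or> u \<ge> t + D \<Longrightarrow>
     \<bar>zeta_integrand \<sigma> t (u / t)\<bar> \<le> C * (1 + t) ^ 9 * exp (- D) * (1 / (1 + u\<^sup>2) + 1 / (1 + (u - t)\<^sup>2))"
proof -
  obtain C where C: "C > 0" "\<And>t u. t \<ge> 1 \<Longrightarrow> \<bar>u\<bar> \<ge> 1 \<Longrightarrow> \<bar>t - u\<bar> \<ge> 1 \<Longrightarrow>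
     \<bar>zeta_integrand \<sigma> t (u / t)\<bar> \<le> C * (1 + t) * ((1 + \<bar>t - u\<bar>) * (1 + \<bar>u\<bar>) ^ 7) * exp (- (pi / 2 * (\<bar>t - u\<bar> + \<bar>u\<bar> - t)))"
    using zeta_integrand_bound[OF \<sigma>] by blast
  define C' where "C' = C * 9 ^ 8 * 36"
  have "\<bar>zeta_integrand \<sigma> t (u / t)\<bar> \<le> C' * (1 + t) ^ 9 * exp (- D) * (1 / (1 + u\<^sup>2) + 1 / (1 + (u - t)\<^sup>2))"
    if t: "t \<ge> 1" and D: "D \<ge> 1" and u: "u \<le> - D \<or> u \<ge> t + D" for t u D
  proof -
    \<comment> \<open>The distance of u from [0, t]. It equals |u| or |u - t|, so 1 / (1 + v^2) is
      one of the two summands in the bound.\<close>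
    define v where "v = (if u \<le> - D then - u else u - t)"
    have v: "v \<ge> D" "\<bar>t - u\<bar> + \<bar>u\<bar> - t = 2 * v" "\<bar>t - u\<bar> \<le> t + v" "\<bar>u\<bar> \<le> t + v" "\<bar>u\<bar> \<ge> 1" "\<bar>t - u\<bar> \<ge> 1"
      using u D t by (auto simp: v_def)
    have a: "1 + (t + v) \<le> (1 + t) * (1 + v)" using t v D by (simp add: ring_distribs)
    have "(1 + \<bar>t - u\<bar>) * (1 + \<bar>u\<bar>) ^ 7 \<le> (1 + (t + v)) * (1 + (t + v)) ^ 7"
      using v t D by (intro mult_mono power_mono) auto
    also have "\<dots> = (1 + (t + v)) ^ 8" by (simp flip: power_Suc)
    also have "\<dots> \<le> ((1 + t) * (1 + v)) ^ 8" using a t v D by (intro power_mono) auto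
    also have "\<dots> = (1 + t) ^ 8 * (1 + v) ^ 8" by (rule power_mult_distrib)
    also have "\<dots> \<le> (1 + t) ^ 8 * (real (Suc 8) ^ 8 * exp v)"
      using t v D by (intro mult_left_mono one_plus_power_le_exp) auto
    finally have b: "(1 + \<bar>t - u\<bar>) * (1 + \<bar>u\<bar>) ^ 7 \<le> (1 + t) ^ 8 * (9 ^ 8 * exp v)" by simp
    have c: "exp (- (pi / 2 * (\<bar>t - u\<bar> + \<bar>u\<bar> - t))) \<le> exp (- (3 * v))"
      unfolding v(2) using mult_right_mono[of 3 pi v] pi_gt3 v D by simp
    have "\<bar>zeta_integrand \<sigma> t (u / t)\<bar> \<le> C * (1 + t) * ((1 + \<bar>t - u\<bar>) * (1 + \<bar>u\<bar>) ^ 7) * exp (- (pi / 2 * (\<bar>t - u\<bar> + \<bar>u\<bar> - t)))"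
      by (rule C(2)[OF t v(5) v(6)])
    also have "\<dots> \<le> C * (1 + t) * ((1 + t) ^ 8 * (9 ^ 8 * exp v)) * exp (- (3 * v))"
      using C(1) t by (intro mult_mono[OF mult_left_mono[OF b] c]) auto
    also have "\<dots> = C * 9 ^ 8 * ((1 + t) * (1 + t) ^ 8) * (exp v * exp (- (3 * v)))" by simp
    also have "(1 + t) * (1 + t) ^ 8 = (1 + t) ^ 9" by (simp flip: power_Suc)
    also have "exp v * exp (- (3 * v)) = exp (- v) * exp (- v)" by (simp add: exp_add[symmetric])
    also have "\<dots> \<le> exp (- D) * (36 * (1 / (1 + u\<^sup>2) + 1 / (1 + (u - t)\<^sup>2)))"
    proof (intro mult_mono)
      have v0: "v \<ge> 0" using v D by simp
      have "exp (- v) \<le> exp (- \<bar>v\<bar> / 2)" using v0 by simp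
      also have "\<dots> \<le> 36 * (1 / (1 + v\<^sup>2))" by (rule exp_half_le_quadratic)
      also have "1 / (1 + v\<^sup>2) \<le> 1 / (1 + u\<^sup>2) + 1 / (1 + (u - t)\<^sup>2)" by (simp add: v_def)
      finally show "exp (- v) \<le> 36 * (1 / (1 + u\<^sup>2) + 1 / (1 + (u - t)\<^sup>2))" by simp
    qed (use v in auto)
    finally show ?thesis using C(1) t by (simp add: C'_def mult_left_mono mult_ac)
  qed
  moreover have "C' > 0" using C by (simp add: C'_def)
  ultimately show ?thesis using that by blast
qed

definition cauchy_mass :: real where
  "cauchy_mass = (LINT u|lborel. 1 / (1 + u\<^sup>2))"

lemma integral_tail_bound:
  fixes g :: "real \<Rightarrow> real"
  assumes g: "integrable lborel g" and M: "M \<ge> 0"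
    and b: "\<And>u. u \<notin> {A..B} \<Longrightarrow> \<bar>g u\<bar> \<le> M * (1 / (1 + u\<^sup>2) + 1 / (1 + (u - t)\<^sup>2))"
  shows "\<bar>(LINT u|lborel. g u) - integral {A..B} g\<bar> \<le> 2 * M * cauchy_mass"
proof -
  have shift: "integrable lborel (\<lambda>u. 1 / (1 + (u - t)\<^sup>2))" "(LINT u|lborel. 1 / (1 + (u - t)\<^sup>2)) = cauchy_mass"
    using lborel_integrable_real_affine[OF integrable_inverse_1_plus_square, of 1 "-t"]
      lborel_integral_real_affine[of 1 "\<lambda>u. 1 / (1 + u\<^sup>2)" "-t"] by (simp_all add: cauchy_mass_def)
  have s: "set_integrable lborel {A..B} g" unfolding set_integrable_def by (rule integrable_mult_indicator[OF _ g]) simp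
  have "integral {A..B} g = (LINT u|lborel. indicator {A..B} u * g u)"
    using set_borel_integral_eq_integral(2)[OF s] by (simp add: set_lebesgue_integral_def)
  moreover have i2: "integrable lborel (\<lambda>u. indicator {A..B} u * g u)" using s by (simp add: set_integrable_def)
  ultimately have "(LINT u|lborel. g u) - integral {A..B} g = (LINT u|lborel. g u - indicator {A..B} u * g u)"
    using g by simp
  also have "\<bar>\<dots>\<bar> \<le> (LINT u|lborel. \<bar>g u - indicator {A..B} u * g u\<bar>)"
    using integral_norm_bound[of lborel "\<lambda>u. g u - indicator {A..B} u * g u"] by simp
  also have "\<dots> \<le> (LINT u|lborel. M * (1 / (1 + u\<^sup>2) + 1 / (1 + (u - t)\<^sup>2)))"
  proof (rule integral_mono)
    show "integrable lborel (\<lambda>u. \<bar>g u - indicator {A..B} u * g u\<bar>)" using g i2 by simp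
    show "integrable lborel (\<lambda>u. M * (1 / (1 + u\<^sup>2) + 1 / (1 + (u - t)\<^sup>2)))"
      by (intro integrable_mult_right Bochner_Integration.integrable_add integrable_inverse_1_plus_square shift)
    show "\<bar>g u - indicator {A..B} u * g u\<bar> \<le> M * (1 / (1 + u\<^sup>2) + 1 / (1 + (u - t)\<^sup>2))" for u
      using b[of u] M by (cases "u \<in> {A..B}") auto
  qed
  also have "\<dots> = M * ((LINT u|lborel. 1 / (1 + u\<^sup>2)) + (LINT u|lborel. 1 / (1 + (u - t)\<^sup>2)))"
    using integrable_inverse_1_plus_square shift(1) by simp
  also have "\<dots> = 2 * M * cauchy_mass" unfolding shift(2) cauchy_mass_def[symmetric] by simp
  finally show ?thesis .
qed

lemma integral_stretch:
  fixes g :: "real \<Rightarrow> real"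
  assumes g: "continuous_on UNIV g" and t: "t > 0"
  shows "t * integral {a..b} (\<lambda>x. g (t * x)) = integral {t * a..t * b} g"
proof -
  have s1: "set_integrable lborel {t * a..t * b} g"
    by (rule borel_integrable_atLeastAtMost'[OF continuous_on_subset[OF g]]) simp
  have s2: "set_integrable lborel {a..b} (\<lambda>x. g (t * x))"
    by (rule borel_integrable_atLeastAtMost') (intro continuous_intros continuous_on_compose2[OF g], auto)
  have "integral {t * a..t * b} g = (LINT u|lborel. indicator {t * a..t * b} u *\<^sub>R g u)"
    using set_borel_integral_eq_integral(2)[OF s1] by (simp only: set_lebesgue_integral_def)
  also have "\<dots> = \<bar>t\<bar> *\<^sub>R (LINT x|lborel. indicator {t * a..t * b} (0 + t * x) *\<^sub>R g (0 + t * x))"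
    by (rule lborel_integral_real_affine) (use t in simp)
  also have "(\<lambda>x. indicator {t * a..t * b} (0 + t * x) *\<^sub>R g (0 + t * x)) = (\<lambda>x. indicator {a..b} x *\<^sub>R g (t * x))"
    using t by (intro ext) (auto simp: indicator_def)
  also have "(LINT x|lborel. indicator {a..b} x *\<^sub>R g (t * x)) = integral {a..b} (\<lambda>x. g (t * x))"
    using set_borel_integral_eq_integral(2)[OF s2] by (simp only: set_lebesgue_integral_def)
  finally show ?thesis using t by simp
qed

text \<open>The truncated integrals of \<open>f\<close> and \<open>h\<close> coincide, and the
  indefinite integral of \<open>h\<close> is continuous at \<open>c\<close>.\<close>

lemma has_principal_value_continuous:
  assumes h: "continuous_on UNIV h" and f: "\<And>x. x \<noteq> c \<Longrightarrow> f x = h x" and ab: "a < c" "c < b"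
  shows "has_principal_value f c a b (integral {a..b} h)"
proof -
  have int: "h integrable_on {x..y}" for x y
    by (rule integrable_continuous_real[OF continuous_on_subset[OF h]]) simp
  have eq: "integral S f = integral S h" "f integrable_on S \<longleftrightarrow> h integrable_on S" if "c \<notin> S" for S
  proof -
    have "f x = h x" if "x \<in> S" for x using f \<open>c \<notin> S\<close> that by metis
    thus "integral S f = integral S h" by (rule integral_cong)
    show "f integrable_on S \<longleftrightarrow> h integrable_on S" by (rule integrable_cong) fact
  qed
  define F where "F x = integral {a..x} h" for x
  have "continuous_on {a..b} F" unfolding F_def by (rule indefinite_integral_continuous_1[OF int])
  moreover have "c \<in> interior {a..b}" using ab by simp
  ultimately have "isCont F c" by (rule continuous_on_interior)
  hence F: "(F \<longlongrightarrow> F c) (nhds c)" by (simp add: continuous_at tendsto_at_iff_tendsto_nhds)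
  have m: "filterlim (\<lambda>\<epsilon>. c - \<epsilon>) (nhds c) (at_right 0)" "filterlim (\<lambda>\<epsilon>. c + \<epsilon>) (nhds c) (at_right 0)"
    by (auto intro!: tendsto_eq_intros)
  have ev: "\<forall>\<^sub>F \<epsilon> in at_right 0. \<epsilon> \<in> {0<..<b - c}" "\<forall>\<^sub>F \<epsilon> in at_right 0. \<epsilon> \<in> {0<..<c - a}"
    using eventually_at_right_real[of 0 "b - c"] eventually_at_right_real[of 0 "c - a"] ab by simp_all
  have "((\<lambda>\<epsilon>. F (c - \<epsilon>) + (F b - F (c + \<epsilon>))) \<longlongrightarrow> F c + (F b - F c)) (at_right 0)"
    by (intro tendsto_intros filterlim_compose[OF F] m)
  moreover have "\<forall>\<^sub>F \<epsilon> in at_right 0. F (c - \<epsilon>) + (F b - F (c + \<epsilon>)) = integral {a..c - \<epsilon>} f + integral {c + \<epsilon>..b} f"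
    using ev
  proof eventually_elim
    case (elim \<epsilon>)
    have "F (c + \<epsilon>) + integral {c + \<epsilon>..b} h = F b"
      unfolding F_def using elim ab by (intro Henstock_Kurzweil_Integration.integral_combine int) auto
    moreover have "c \<notin> {a..c - \<epsilon>}" "c \<notin> {c + \<epsilon>..b}" using elim by auto
    ultimately show ?case by (simp add: eq F_def)
  qed
  ultimately have "((\<lambda>\<epsilon>. integral {a..c - \<epsilon>} f + integral {c + \<epsilon>..b} f) \<longlongrightarrow> integral {a..b} h) (at_right 0)"
    by (simp add: F_def filterlim_cong[OF refl refl] Lim_transform_eventually)
  moreover have "\<forall>\<^sub>F \<epsilon> in at_right 0. f integrable_on {a..c - \<epsilon>} \<and> f integrable_on {c + \<epsilon>..b}"
    using ev(1)
  proof eventually_elim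
    case (elim \<epsilon>)
    hence "c \<notin> {a..c - \<epsilon>}" "c \<notin> {c + \<epsilon>..b}" by auto
    thus ?case by (simp add: eq int)
  qed
  ultimately show ?thesis using ab by (simp add: has_principal_value_def)
qed

text \<open>The summands are conjugate, so their sum is 2 (\<sigma> - 1) / |s - 1|^2: of order 1 /
  t^2, although each summand alone is of order 1 / t.\<close>

lemma pole_term_bound:
  assumes "t \<ge> 1" "0 < \<sigma>" "\<sigma> < 1"
  shows "norm (1 / (Complex \<sigma> t - 1) + 1 / (cnj (Complex \<sigma> t) - 1)) \<le> 2 / t\<^sup>2"
proof -
  let ?z = "Complex \<sigma> t - 1"
  have z: "?z \<noteq> 0" "cnj ?z \<noteq> 0" using assms by (auto simp: complex_eq_iff)
  have "1 / ?z + 1 / cnj ?z = (?z + cnj ?z) / (?z * cnj ?z)" using z by (simp add: field_simps)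
  also have "?z + cnj ?z = of_real (2 * (\<sigma> - 1))" by (simp add: complex_eq_iff)
  also have "?z * cnj ?z = of_real ((norm ?z)\<^sup>2)" by (rule complex_norm_square[symmetric])
  finally have "norm (1 / ?z + 1 / cnj ?z) = \<bar>2 * (\<sigma> - 1)\<bar> / \<bar>(norm ?z)\<^sup>2\<bar>"
    by (simp only: norm_divide norm_of_real)
  also have "\<dots> = 2 * (1 - \<sigma>) / (norm ?z)\<^sup>2" using assms by (simp add: abs_if)
  also have "\<dots> \<le> 2 / t\<^sup>2"
  proof (rule frac_le)
    show "t\<^sup>2 \<le> (norm ?z)\<^sup>2" by (simp add: cmod_power2)
  qed (use assms in auto)
  finally show ?thesis by simp
qed

text \<open>For \<sigma> other than 1/2 the freedom in \<open>A_terms\<close> lets \<open>A\<close>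
  reproduce the Gamma quotient exactly, and only the pole term is left over. For \<sigma> = 1/2 the
  set is a singleton and the digamma error joins the remainder.\<close>

lemma main_term_asymp:
  fixes \<sigma> :: real
  assumes \<sigma>: "0 < \<sigma>" "\<sigma> < 1"
  obtains A C where "A \<in> A_terms \<sigma>" "\<And>t. t \<ge> 2 \<Longrightarrow>
    \<bar>- Re (zeta (2 * of_real \<sigma> - 1) * (1 / (Complex \<sigma> t - 1) + 1 / (cnj (Complex \<sigma> t) - 1)))
       + 2 * Re ((\<Sum>p\<in>{0, of_real (2 * \<sigma> - 1)}. residue (zeta_kernel (Complex \<sigma> t) (cnj (Complex \<sigma> t))) p) / Gamma (Complex \<sigma> t)) + A t\<bar> \<le> C / t\<^sup>2"
proof -
  define p0 where "p0 = complex_of_real (2 * \<sigma> - 1)"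
  have p0: "2 * of_real \<sigma> - 1 = p0" by (simp add: p0_def)
  have pole: "\<bar>Re (zeta p0 * (1 / (Complex \<sigma> t - 1) + 1 / (cnj (Complex \<sigma> t) - 1)))\<bar> \<le> norm (zeta p0) * 2 / t\<^sup>2" if "t \<ge> 2" for t
  proof -
    have "\<bar>Re (zeta p0 * (1 / (Complex \<sigma> t - 1) + 1 / (cnj (Complex \<sigma> t) - 1)))\<bar> \<le> norm (zeta p0) * norm (1 / (Complex \<sigma> t - 1) + 1 / (cnj (Complex \<sigma> t) - 1))"
      unfolding norm_mult[symmetric] by (rule abs_Re_le_cmod)
    also have "\<dots> \<le> norm (zeta p0) * (2 / t\<^sup>2)" using that \<sigma> by (intro mult_left_mono pole_term_bound) auto
    finally show ?thesis by simp
  qed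
  have cnj_s: "cnj (Complex \<sigma> t) = Complex \<sigma> (-t)" for t by (simp add: complex_eq_iff)
  have Gs: "Gamma (Complex \<sigma> t) \<noteq> 0" for t
    unfolding Gamma_eq_zero_iff using \<sigma> by (intro not_nonpos_Ints_Re_pos) simp
  show ?thesis
  proof (cases "\<sigma> = 1 / 2")
    case True
    show ?thesis
    proof (rule that[of "\<lambda>t. ln t + 2 * euler_mascheroni - ln (2 * pi)" "norm (zeta p0) * 2 + 2"])
      show "(\<lambda>t. ln t + 2 * euler_mascheroni - ln (2 * pi)) \<in> A_terms \<sigma>" using True by (simp add: A_terms_def)
      fix t :: real assume t: "t \<ge> 2"
      have p00: "p0 = 0" unfolding p0_def True by simp
      let ?s = "Complex (1/2) t"
      have "(\<Sum>p\<in>{0, p0}. residue (zeta_kernel ?s (Complex (1/2) (-t))) p) / Gamma ?s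
         = - (Digamma ?s + 2 * euler_mascheroni - of_real (ln (2 * pi))) / 2"
        using Gs[of t] True unfolding p00 by (simp add: residue_zeta_kernel_half field_simps)
      hence r: "2 * Re ((\<Sum>p\<in>{0, p0}. residue (zeta_kernel ?s (Complex (1/2) (-t))) p) / Gamma ?s)
        = - (Re (Digamma ?s) + 2 * euler_mascheroni - ln (2 * pi))"
      proof -
        assume e: "(\<Sum>p\<in>{0, p0}. residue (zeta_kernel ?s (Complex (1/2) (-t))) p) / Gamma ?s
         = - (Digamma ?s + 2 * euler_mascheroni - of_real (ln (2 * pi))) / 2"
        have em: "euler_mascheroni = Re euler_mascheroni"
          using arg_cong[OF of_real_euler_mascheroni[where ?'a = complex], of Re] unfolding Re_complex_of_real .
        show ?thesis unfolding e by (simp add: em[symmetric])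
      qed
      have D: "\<bar>Re (Digamma ?s) - ln t\<bar> \<le> 2 / t\<^sup>2" using t by (intro Re_Digamma_half_line) simp
      have "\<bar>- X + - (Re (Digamma ?s) + 2 * euler_mascheroni - ln (2 * pi)) + (ln t + 2 * euler_mascheroni - ln (2 * pi))\<bar>
        \<le> (norm (zeta p0) * 2 + 2) / t\<^sup>2" if "\<bar>X\<bar> \<le> norm (zeta p0) * 2 / t\<^sup>2" for X
        using D that unfolding add_divide_distrib by linarith
      from this[OF pole[OF t]]
      show "\<bar>- Re (zeta (2 * of_real \<sigma> - 1) * (1 / (Complex \<sigma> t - 1) + 1 / (cnj (Complex \<sigma> t) - 1)))
       + 2 * Re ((\<Sum>p\<in>{0, of_real (2 * \<sigma> - 1)}. residue (zeta_kernel (Complex \<sigma> t) (cnj (Complex \<sigma> t))) p) / Gamma (Complex \<sigma> t))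
       + (ln t + 2 * euler_mascheroni - ln (2 * pi))\<bar> \<le> (norm (zeta p0) * 2 + 2) / t\<^sup>2"
        unfolding p0 p0_def[symmetric] cnj_s unfolding r[symmetric] unfolding True .
    qed
  next
    case False
    define q where "q t = Re (Gamma (Complex (1 - \<sigma>) t) / Gamma (Complex \<sigma> t))" for t
    \<comment> \<open>The exact relative error of the Gamma quotient; sin (pi \<sigma>) > 0 permits
      the division, and \<open>Gamma_ratio_asymp\<close> makes it O(1 / t).\<close>
    define r where "r t = q t / (t powr (1 - 2 * \<sigma>) * sin (pi * \<sigma>)) - 1" for t
    have sn: "sin (pi * \<sigma>) > 0" using \<sigma> by (intro sin_gt_zero) auto
    define A where "A t = Re (zeta (of_real (2 * \<sigma>))) + 2 * Gamma (2 * \<sigma> - 1) * Re (zeta (of_real (2 * \<sigma> - 1)))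
                      * sin (pi * \<sigma>) * t powr (1 - 2 * \<sigma>) * (1 + r t)" for t
    have r_bound: "\<bar>r t\<bar> \<le> 4 * exp 2 / sin (pi * \<sigma>) * (1 / t)" if t: "t \<ge> 2" for t
    proof -
      define y where "y = t powr (1 - 2 * \<sigma>)"
      have y: "y > 0" using t by (simp add: y_def)
      have "\<bar>q t - y * sin (pi * \<sigma>)\<bar> \<le> 4 * exp 2 * y / t"
        unfolding q_def y_def using Gamma_ratio_asymp[OF \<sigma> t] by simp
      note b = this
      have e: "r t = (q t - y * sin (pi * \<sigma>)) / (y * sin (pi * \<sigma>))"
        using y sn unfolding r_def y_def[symmetric] by (simp add: diff_divide_distrib)
      have ys: "y * sin (pi * \<sigma>) > 0" using y sn by simp
      hence "\<bar>r t\<bar> = \<bar>q t - y * sin (pi * \<sigma>)\<bar> / (y * sin (pi * \<sigma>))"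
        unfolding e abs_divide by (simp only: abs_of_pos)
      also have "\<dots> \<le> (4 * exp 2 * y / t) / (y * sin (pi * \<sigma>))"
        by (rule divide_right_mono[OF b]) (use ys in simp)
      also have "\<dots> = 4 * exp 2 / sin (pi * \<sigma>) * (1 / t)" using y by simp
      finally show ?thesis .
    qed
    have rO: "r \<in> O[at_top](\<lambda>t. 1 / t)"
    proof (rule bigoI)
      show "\<forall>\<^sub>F t in at_top. norm (r t) \<le> 4 * exp 2 / sin (pi * \<sigma>) * norm (1 / t)"
        using eventually_ge_at_top[of 2] by eventually_elim (use r_bound in auto)
    qed
    show ?thesis
    proof (rule that[of A "norm (zeta p0) * 2"])
      show "A \<in> A_terms \<sigma>" unfolding A_terms_def A_def using False rO by auto
      fix t :: real assume t: "t \<ge> 2"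
      let ?s = "Complex \<sigma> t"
      define y where "y = t powr (1 - 2 * \<sigma>)"
      have y: "y > 0" using t by (simp add: y_def)
      have "p0 \<noteq> 0" unfolding p0_def of_real_eq_0_iff using False by simp
      hence "(\<Sum>p\<in>{0, p0}. residue (zeta_kernel ?s (Complex \<sigma> (-t))) p) =
        - Gamma ?s * zeta (of_real (2 * \<sigma>)) / 2 - Gamma p0 * Gamma (Complex (1 - \<sigma>) t) * zeta p0"
        using residue_zeta_kernel_0[OF \<sigma> False, of t] residue_zeta_kernel_1[OF \<sigma> False, of t] by (simp add: p0_def)
      hence "2 * ((\<Sum>p\<in>{0, p0}. residue (zeta_kernel ?s (Complex \<sigma> (-t))) p) / Gamma ?s)
         = - zeta (of_real (2 * \<sigma>)) - 2 * (Gamma p0 * zeta p0) * (Gamma (Complex (1 - \<sigma>) t) / Gamma ?s)"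
        using Gs[of t] by (simp add: diff_divide_distrib right_diff_distrib)
      moreover have "Gamma p0 * zeta p0 = of_real (Gamma (2 * \<sigma> - 1) * Re (zeta p0))"
      proof -
        have "cnj (zeta p0) = zeta p0" using cnj_zeta[of p0] \<sigma> by (auto simp: p0_def complex_eq_iff)
        hence "zeta p0 = of_real (Re (zeta p0))" by (simp add: complex_eq_iff)
        moreover have "Gamma p0 = of_real (Gamma (2 * \<sigma> - 1))" unfolding p0_def by (rule Gamma_complex_of_real)
        ultimately have "Gamma p0 * zeta p0 = of_real (Gamma (2 * \<sigma> - 1)) * of_real (Re (zeta p0))"
          by (intro arg_cong2[of _ _ _ _ "(*)"])
        thus ?thesis by simp
      qed
      ultimately have "2 * ((\<Sum>p\<in>{0, p0}. residue (zeta_kernel ?s (Complex \<sigma> (-t))) p) / Gamma ?s)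
         = - zeta (of_real (2 * \<sigma>)) - of_real (2 * (Gamma (2 * \<sigma> - 1) * Re (zeta p0))) * (Gamma (Complex (1 - \<sigma>) t) / Gamma ?s)"
        by simp
      from arg_cong[OF this, of Re]
      have e1: "2 * Re ((\<Sum>p\<in>{0, p0}. residue (zeta_kernel ?s (Complex \<sigma> (-t))) p) / Gamma ?s)
         = - Re (zeta (of_real (2 * \<sigma>))) - 2 * (Gamma (2 * \<sigma> - 1) * Re (zeta p0)) * q t"
      proof -
        have "Re (of_real x * z) = x * Re z" "Re (2 * z) = 2 * Re z" for x z by simp_all
        with \<open>Re _ = Re _\<close> show ?thesis unfolding q_def by (simp only: minus_complex.simps uminus_complex.simps)
      qed
      have "sin (pi * \<sigma>) * y * (1 + r t) = q t"
        using y sn unfolding r_def y_def[symmetric] by simp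
      hence e2: "A t = Re (zeta (of_real (2 * \<sigma>))) + 2 * (Gamma (2 * \<sigma> - 1) * Re (zeta p0)) * q t"
      proof -
        assume e: "sin (pi * \<sigma>) * y * (1 + r t) = q t"
        show ?thesis unfolding A_def e[symmetric] y_def p0_def by (simp only: mult_ac)
      qed
      show "\<bar>- Re (zeta (2 * of_real \<sigma> - 1) * (1 / (?s - 1) + 1 / (cnj ?s - 1)))
       + 2 * Re ((\<Sum>p\<in>{0, of_real (2 * \<sigma> - 1)}. residue (zeta_kernel ?s (cnj ?s)) p) / Gamma ?s) + A t\<bar> \<le> norm (zeta p0) * 2 / t\<^sup>2"
        using pole[OF t] unfolding p0 p0_def[symmetric] cnj_s e1 e2 by simp
    qed
  qed
qed

lemma cauchy_mass_nonneg: "cauchy_mass \<ge> 0"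
  unfolding cauchy_mass_def by (intro integral_nonneg_AE) (simp add: add_nonneg_nonneg)

theorem corollary2p1:
  fixes \<delta>\<^sub>1 \<delta>\<^sub>4 \<delta>\<^sub>1\<^sub>4 \<sigma> :: real
  assumes "\<delta>\<^sub>1 > 0" and "\<delta>\<^sub>4 > 0" and "\<delta>\<^sub>1\<^sub>4 = min \<delta>\<^sub>1 \<delta>\<^sub>4" and "0 < \<sigma>" and "\<sigma> < 1"
  shows "\<exists>I A E\<^sub>1 E\<^sub>2 :: real \<Rightarrow> real.
           A \<in> A_terms \<sigma> \<and>
           E\<^sub>1 \<in> O[at_top](\<lambda>t. exp (- pi * t powr \<delta>\<^sub>1\<^sub>4)) \<and>
           E\<^sub>2 \<in> O[at_top](\<lambda>t. 1 / t\<^sup>2) \<and>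
           (\<forall>\<^sub>F t in at_top.
              has_principal_value (zeta_integrand \<sigma> t) 1
                (- (t powr (\<delta>\<^sub>1 - 1))) (1 + t powr (\<delta>\<^sub>4 - 1)) (I t) \<and>
              t / pi * I t + A t + E\<^sub>1 t + E\<^sub>2 t = 0)"
proof -
  note \<sigma> = assms(4,5)
  define V where "V t = - Re (zeta (2 * of_real \<sigma> - 1) * (1 / (Complex \<sigma> t - 1) + 1 / (cnj (Complex \<sigma> t) - 1)))
       + 2 * Re ((\<Sum>p\<in>{0, of_real (2 * \<sigma> - 1)}. residue (zeta_kernel (Complex \<sigma> t) (cnj (Complex \<sigma> t))) p) / Gamma (Complex \<sigma> t))" for t
  obtain A C where A: "A \<in> A_terms \<sigma>" and AC: "\<And>t. t \<ge> 2 \<Longrightarrow> \<bar>V t + A t\<bar> \<le> C / t\<^sup>2"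
    unfolding V_def by (rule main_term_asymp[OF \<sigma>]) blast
  obtain K where K: "K > 0" "\<And>t u D. t \<ge> 1 \<Longrightarrow> D \<ge> 1 \<Longrightarrow> u \<le> - D \<or> u \<ge> t + D \<Longrightarrow>
     \<bar>zeta_integrand \<sigma> t (u / t)\<bar> \<le> K * (1 + t) ^ 9 * exp (- D) * (1 / (1 + u\<^sup>2) + 1 / (1 + (u - t)\<^sup>2))"
    using zeta_integrand_tail_bound[OF \<sigma>] by blast
  define P where "P t g \<longleftrightarrow> continuous_on UNIV g \<and> integrable lborel g \<and> (\<forall>u. u \<noteq> t \<longrightarrow> g u = zeta_integrand \<sigma> t (u / t))
      \<and> (LINT u|lborel. g u) / pi = V t" for t and g :: "real \<Rightarrow> real"
  have "\<forall>t\<in>{1..}. \<exists>g. P t g"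
  proof
    fix t :: real assume "t \<in> {1..}"
    hence "t \<ge> 1" by simp
    then obtain h where "continuous_on UNIV h" "integrable lborel h"
      "\<And>u. u \<noteq> t \<Longrightarrow> h u = zeta_integrand \<sigma> t (u / t)" "(LINT u|lborel. h u) / pi = V t"
      unfolding V_def by (rule exact_formula[OF \<sigma>]) blast
    hence "P t h" unfolding P_def by simp
    thus "\<exists>g. P t g" by (rule exI[where x = h])
  qed
  \<comment> \<open>The exact formula is an existence statement for each t separately; choice turns
    its witnesses into a function of t.\<close>
  from bchoice[OF this] obtain g where g: "\<forall>t\<in>{1..}. P t (g t)" by blast
  define a b where "a t = - (t powr (\<delta>\<^sub>1 - 1))" and "b t = 1 + t powr (\<delta>\<^sub>4 - 1)" for t :: real
  define I where "I t = integral {a t..b t} (\<lambda>\<tau>. g t (t * \<tau>))" for t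
  \<comment> \<open>Defined as what makes the asserted equation true, so that only its size remains
    to be estimated.\<close>
  define E where "E t = - (t / pi * I t) - A t" for t
  define \<delta> where "\<delta> = \<delta>\<^sub>1\<^sub>4"
  have \<delta>: "\<delta> > 0" "\<delta> \<le> \<delta>\<^sub>1" "\<delta> \<le> \<delta>\<^sub>4" using assms by (auto simp: \<delta>_def)
  have pv: "has_principal_value (zeta_integrand \<sigma> t) 1 (a t) (b t) (I t)" if t: "t \<ge> 1" for t
    unfolding I_def
  proof (rule has_principal_value_continuous)
    have P: "P t (g t)" using g t by simp
    show "continuous_on UNIV (\<lambda>\<tau>. g t (t * \<tau>))"
    proof (rule continuous_on_compose2[of UNIV "g t"])
      show "continuous_on UNIV (g t)" using P unfolding P_def by blast
      show "continuous_on UNIV (\<lambda>\<tau>. t * \<tau>)" by (intro continuous_intros)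
    qed simp
    show "zeta_integrand \<sigma> t \<tau> = g t (t * \<tau>)" if "\<tau> \<noteq> 1" for \<tau>
    proof -
      have "t * \<tau> \<noteq> t" using that t by simp
      hence "g t (t * \<tau>) = zeta_integrand \<sigma> t (t * \<tau> / t)" using P unfolding P_def by blast
      thus ?thesis using t by simp
    qed
    have "t powr x > 0" for x using t by simp
    from this[of "\<delta>\<^sub>1 - 1"] this[of "\<delta>\<^sub>4 - 1"] show "a t < 1" "1 < b t"
      unfolding a_def b_def by linarith+
  qed
  define B where "B t = C * (1 / t\<^sup>2) + 2 * K * cauchy_mass * ((1 + t) ^ 9 * exp (- (t powr \<delta>)))" for t
  have E_bound: "\<bar>E t\<bar> \<le> B t" if t: "t \<ge> 2" for t
  proof -
    have P: "continuous_on UNIV (g t)" "integrable lborel (g t)" "\<And>u. u \<noteq> t \<Longrightarrow> g t u = zeta_integrand \<sigma> t (u / t)"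
      "(LINT u|lborel. g t u) / pi = V t" using g t unfolding P_def by auto
    \<comment> \<open>With the smaller exponent, both truncation points, -
      t^\<open>\<delta>\<^sub>1\<close> and t + t^\<open>\<delta>\<^sub>4\<close> in the variable u
      = t \<tau>, lie at distance at least \<open>D\<close> from [0, t].\<close>
    define D where "D = t powr \<delta>"
    have D: "D \<ge> 1" "D \<le> t powr \<delta>\<^sub>1" "D \<le> t powr \<delta>\<^sub>4"
      using t \<delta> by (auto simp: D_def ge_one_powr_ge_zero intro: powr_mono)
    \<comment> \<open>The substitution u = t \<tau> absorbs the factor t in front of the
      integral.\<close>
    define X where "X = integral {t * a t..t * b t} (g t)"
    have X: "t * I t = X" unfolding I_def X_def using t by (intro integral_stretch P(1)) simp
    have ta: "t * a t = - (t powr \<delta>\<^sub>1)" "t * b t = t + t powr \<delta>\<^sub>4"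
      using t by (auto simp: a_def b_def ring_distribs powr_mult_base)
    have "\<bar>(LINT u|lborel. g t u) - X\<bar> \<le> 2 * (K * (1 + t) ^ 9 * exp (- D)) * cauchy_mass"
      unfolding X_def
    proof (rule integral_tail_bound[where t = t, OF P(2)])
      fix u assume "u \<notin> {t * a t..t * b t}"
      hence u: "u \<le> - D \<or> u \<ge> t + D" using D unfolding ta by auto
      hence "u \<noteq> t" using D t by auto
      from P(3)[OF this] show "\<bar>g t u\<bar> \<le> K * (1 + t) ^ 9 * exp (- D) * (1 / (1 + u\<^sup>2) + 1 / (1 + (u - t)\<^sup>2))"
        using K(2)[OF _ D(1) u] t by simp
    qed (use K t in auto)
    hence "\<bar>V t - X / pi\<bar> \<le> 2 * (K * (1 + t) ^ 9 * exp (- D)) * cauchy_mass / pi"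
      unfolding P(4)[symmetric] diff_divide_distrib[symmetric] abs_divide by (simp add: divide_right_mono)
    also have "\<dots> \<le> 2 * (K * (1 + t) ^ 9 * exp (- D)) * cauchy_mass / 1"
      using K t cauchy_mass_nonneg pi_gt3 by (intro divide_left_mono mult_nonneg_nonneg) auto
    finally have 1: "\<bar>V t - X / pi\<bar> \<le> 2 * (K * (1 + t) ^ 9 * exp (- D)) * cauchy_mass" by simp
    have "E t = (V t - X / pi) - (V t + A t)" unfolding E_def X[symmetric] by simp
    hence "\<bar>E t\<bar> \<le> \<bar>V t - X / pi\<bar> + \<bar>V t + A t\<bar>" by linarith
    also have "\<dots> \<le> 2 * (K * (1 + t) ^ 9 * exp (- D)) * cauchy_mass + C / t\<^sup>2"
      by (intro add_mono 1 AC t)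
    also have "\<dots> = B t" by (simp add: B_def D_def)
    finally show ?thesis .
  qed
  have "(\<lambda>t. (1 + t) ^ 9 * exp (- (t powr \<delta>))) \<in> O[at_top](\<lambda>t. 1 / t\<^sup>2)"
    using \<delta>(1) by real_asymp
  hence "(\<lambda>t. 2 * K * cauchy_mass * ((1 + t) ^ 9 * exp (- (t powr \<delta>)))) \<in> O[at_top](\<lambda>t. 1 / t\<^sup>2)"
    by simp
  moreover have "(\<lambda>t. C * (1 / t\<^sup>2)) \<in> O[at_top](\<lambda>t. 1 / t\<^sup>2)"
    by (rule bigoI[of _ "\<bar>C\<bar>"]) (simp add: abs_mult)
  ultimately have B: "B \<in> O[at_top](\<lambda>t. 1 / t\<^sup>2)" unfolding B_def by (intro sum_in_bigo)
  have "E \<in> O[at_top](\<lambda>t. 1 / t\<^sup>2)"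
  proof (rule landau_o.big_trans[OF _ B])
    show "E \<in> O[at_top](B)"
    proof (rule bigoI[where c = 1])
      show "\<forall>\<^sub>F t in at_top. norm (E t) \<le> 1 * norm (B t)"
        using eventually_ge_at_top[of 2]
      proof eventually_elim
        case (elim t)
        from E_bound[OF elim] show ?case by simp
      qed
    qed
  qed
  moreover have "\<forall>\<^sub>F t in at_top. has_principal_value (zeta_integrand \<sigma> t) 1 (- (t powr (\<delta>\<^sub>1 - 1))) (1 + t powr (\<delta>\<^sub>4 - 1)) (I t) \<and>
              t / pi * I t + A t + 0 + E t = 0"
    using eventually_ge_at_top[of 1]
  proof eventually_elim
    case (elim t)
    from pv[OF elim] show ?case by (simp add: a_def b_def E_def)
  qed
  moreover have "(\<lambda>_. 0) \<in> O[at_top](\<lambda>t. exp (- pi * t powr \<delta>\<^sub>1\<^sub>4))" by simp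
  ultimately have "A \<in> A_terms \<sigma> \<and> (\<lambda>_. 0) \<in> O[at_top](\<lambda>t. exp (- pi * t powr \<delta>\<^sub>1\<^sub>4)) \<and> E \<in> O[at_top](\<lambda>t. 1 / t\<^sup>2) \<and>
      (\<forall>\<^sub>F t in at_top. has_principal_value (zeta_integrand \<sigma> t) 1 (- (t powr (\<delta>\<^sub>1 - 1))) (1 + t powr (\<delta>\<^sub>4 - 1)) (I t) \<and>
              t / pi * I t + A t + (\<lambda>_. 0) t + E t = 0)"
    using A by blast
  note all = this
  show ?thesis
    by (rule exI[where x = I], rule exI[where x = A], rule exI[where x = "\<lambda>_. 0"], rule exI[where x = E], rule all)
qed

end
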